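(* Let $A=\{u_0,\dots,u_s\}\subset\mathbb{Z}^n$ (with $|A|=s+1$) and let $X_A\subset\mathbb{P}^s$ be the associated projective toric variety. If $P=\operatorname{Conv}(A)$ is smooth of dimension $n$ and $A$ contains the nearest lattice neighbors along the edges of each vertex of $P$, then $\operatorname{Sec}X_A$ has the expected dimension $\min\{s,2n+1\}$ unless $A$ is $AGL_n(\mathbb{Z})$-equivalent to the set of all lattice points of one of $$2\Delta_n\ (n\ge2),\qquad (2\Delta_n)_k\ (0\le k\le n-3),\qquad \Delta_\ell\times\Delta_{n-\ell}\ (2\le\ell\le n-2).$$
   Context: All varieties are over $\mathbb{C}$. For a reduced irreducible variety $X\subseteq\mathbb{P}^s$, $\operatorname{Sec}X$ is the closure of the union of all lines in $\mathbb{P}^s$ meeting $X$ in at least $2$ points. A lattice polytope $P\subset\mathbb{R}^n$ is smooth if it is simple (each vertex lies on exactly $\dim P$ edges) and the first lattice vectors along the edges incident at any vertex form part of a $\mathbb{Z}$-basis of $\mathbb{Z}^n$. For $A=\{u_0,\dots,u_s\}\subset\mathbb{Z}^n$, $X_A\subset\mathbb{P}^s$ is the closure of the image of $(\mathbb{C}^* )^n$ under $x\mapsto[\chi^{u_0}(x):\cdots:\chi^{u_s}(x)]$, where $\chi^{u_i}$ are the characters of $(\mathbb{C}^* )^n$. The nearest neighbor of a vertex $v$ along an edge $\sigma\ni v$ is the lattice point of $\sigma\setminus\{v\}$ closest to $v$. $AGL_n(\mathbb{Z})$ is the group of affine linear isomorphisms of $\mathbb{Z}^n$. $\Delta_n=\{p\in\mathbb{R}^n_{\ge0}\mid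 p_1+\cdots+p_n\le1\}$, $2\Delta_n=\{p\in\mathbb{R}^n_{\ge0}\mid p_1+\cdots+p_n\le2\}$, and $(2\Delta_n)_k$ is the convex hull of the lattice points of $2\Delta_n\setminus F$, where $F$ is a $k$-dimensional face of $2\Delta_n$. *)

theory Defs
  imports "HOL-Analysis.Analysis" "HOL-Library.Poly_Mapping" "HOL-Library.Extended_Nat"
begin

section \<open>Projective space with its Zariski topology\<close>

text \<open>
  For a finite index type with \<open>s + 1\<close> elements, a point of \<open>\<P>\<^sup>s\<close> is a line through the origin of
  \<open>\<complex>\<^sup>s\<^sup>+\<^sup>1\<close>, that is, the set of all its homogeneous coordinate vectors together with \<open>0\<close>.
\<close>

definition proj_space :: "(complex ^ 'i) set set" where
  "proj_space = {vec.span {x} | x. x \<noteq> 0}"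

text \<open>The lines of \<open>\<P>\<^sup>s\<close> are the projectivizations of the planes through the origin.\<close>

definition proj_lines :: "(complex ^ 'i) set set set" where
  "proj_lines = {{p \<in> proj_space. p \<subseteq> W} | W. vec.subspace W \<and> vec.dim W = 2}"

type_synonym 'i cpoly = "('i \<Rightarrow>\<^sub>0 nat) \<Rightarrow>\<^sub>0 complex"

definition monom_eval :: "('i \<Rightarrow>\<^sub>0 nat) \<Rightarrow> complex ^ 'i \<Rightarrow> complex" where
  "monom_eval m x = (\<Prod>i\<in>UNIV. x $ i ^ Poly_Mapping.lookup m i)"

definition poly_eval :: "'i cpoly \<Rightarrow> complex ^ 'i \<Rightarrow> complex" where
  "poly_eval f x = (\<Sum>m\<in>Poly_Mapping.keys f. Poly_Mapping.lookup f m * monom_eval m x)"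

definition homogeneous_of_degree :: "nat \<Rightarrow> 'i::finite cpoly \<Rightarrow> bool" where
  "homogeneous_of_degree d f \<longleftrightarrow>
     (\<forall>m\<in>Poly_Mapping.keys f. (\<Sum>i\<in>UNIV. Poly_Mapping.lookup m i) = d)"

definition homogeneous :: "'i::finite cpoly \<Rightarrow> bool" where
  "homogeneous f \<longleftrightarrow> (\<exists>d. homogeneous_of_degree d f)"

text \<open>
  A point contains the vector \<open>0\<close> besides its homogeneous coordinates. This is harmless: homogeneous
  polynomials of positive degree vanish at \<open>0\<close>, and nonzero constants have no zeros anyway.
\<close>

definition zero_locus :: "'i::finite cpoly set \<Rightarrow> (complex ^ 'i) set set" where
  "zero_locus F = {p \<in> proj_space. \<forall>f\<in>F. \<forall>x\<in>p. poly_eval f x = 0}"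

definition zariski :: "(complex ^ 'i::finite) set topology" where
  "zariski = topology (\<lambda>U. \<exists>F. (\<forall>f\<in>F. homogeneous f) \<and> U = proj_space - zero_locus F)"

lemma poly_eval_superset:
  assumes "finite K" "Poly_Mapping.keys f \<subseteq> K"
  shows "poly_eval f x = (\<Sum>m\<in>K. Poly_Mapping.lookup f m * monom_eval m x)"
  unfolding poly_eval_def
  by (rule sum.mono_neutral_left) (use assms in \<open>auto simp: in_keys_iff\<close>)

lemma poly_eval_add: "poly_eval (f + g) x = poly_eval f x + poly_eval g x"
proof -
  let ?K = "Poly_Mapping.keys f \<union> Poly_Mapping.keys g"
  have "Poly_Mapping.keys (f + g) \<subseteq> ?K" by (rule keys_add)
  then show ?thesis
    by (simp add: poly_eval_superset[of ?K] lookup_add algebra_simps sum.distrib)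
qed

lemma poly_eval_zero: "poly_eval 0 x = 0"
  by (simp add: poly_eval_def)

lemma poly_eval_single: "poly_eval (Poly_Mapping.single m c) x = c * monom_eval m x"
  by (simp add: poly_eval_def)

lemma monom_eval_add: "monom_eval (m + m') x = monom_eval m x * monom_eval m' x"
  by (simp add: monom_eval_def lookup_add power_add prod.distrib)

lemma cpoly_induct [case_names zero add]:
  assumes "P 0"
    and "\<And>m c f. P f \<Longrightarrow> P (Poly_Mapping.single m c + f)"
  shows "P (f :: 'a \<Rightarrow>\<^sub>0 'b::comm_monoid_add)"
proof (induction f rule: update_induct)
  case const
  show ?case by (rule assms)
next
  case (update f a b)
  have "Poly_Mapping.update a b f = Poly_Mapping.single a b + f"
    using update(1)
    by (intro poly_mapping_eqI) (auto simp: lookup_update lookup_add lookup_single when_def in_keys_iff)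
  then show ?case using assms(2) update by simp
qed

lemma poly_eval_mult: "poly_eval (f * g) x = poly_eval f x * poly_eval g x"
proof -
  have single: "poly_eval (Poly_Mapping.single m c * g) x = c * monom_eval m x * poly_eval g x"
    for m c
    by (induction g rule: cpoly_induct)
      (simp_all add: poly_eval_zero poly_eval_add poly_eval_single monom_eval_add mult_single
        distrib_left mult_ac)
  show ?thesis
    by (induction f rule: cpoly_induct)
      (simp_all add: poly_eval_zero poly_eval_add poly_eval_single single distrib_right)
qed

lemma homogeneous_zero: "homogeneous 0"
  by (simp add: homogeneous_def homogeneous_of_degree_def)

lemma homogeneous_one: "homogeneous 1"
  by (auto simp: homogeneous_def homogeneous_of_degree_def)

lemma homogeneous_mult:
  assumes "homogeneous f" "homogeneous g"
  shows "homogeneous (f * g)"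
proof -
  obtain d e where d: "homogeneous_of_degree d f" and e: "homogeneous_of_degree e g"
    using assms unfolding homogeneous_def by blast
  have "homogeneous_of_degree (d + e) (f * g)"
    unfolding homogeneous_of_degree_def
  proof
    fix m assume "m \<in> Poly_Mapping.keys (f * g)"
    then obtain a b where "m = a + b" "a \<in> Poly_Mapping.keys f" "b \<in> Poly_Mapping.keys g"
      using keys_mult[of f g] by blast
    then show "(\<Sum>i\<in>UNIV. Poly_Mapping.lookup m i) = d + e"
      using d e by (simp add: homogeneous_of_degree_def lookup_add sum.distrib)
  qed
  then show ?thesis unfolding homogeneous_def by blast
qed

lemma poly_eval_scale:
  assumes "homogeneous_of_degree d f"
  shows "poly_eval f (c *s x) = c ^ d * poly_eval f x"
proof -
  have "monom_eval m (c *s x) = c ^ d * monom_eval m x" if "m \<in> Poly_Mapping.keys f" for m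
  proof -
    have "(\<Sum>i\<in>UNIV. Poly_Mapping.lookup m i) = d"
      using assms that by (simp add: homogeneous_of_degree_def)
    then show ?thesis
      by (simp add: monom_eval_def power_mult_distrib prod.distrib flip: power_sum)
  qed
  then show ?thesis
    by (auto simp: poly_eval_def sum_distrib_left intro!: sum.cong)
qed

lemma zero_locus_span:
  assumes "\<forall>f\<in>F. homogeneous f" "x \<noteq> 0"
  shows "vec.span {x} \<in> zero_locus F \<longleftrightarrow> (\<forall>f\<in>F. poly_eval f x = 0)"
proof -
  have "vec.span {x} \<in> proj_space" using assms(2) by (auto simp: proj_space_def)
  moreover have "poly_eval f y = 0"
    if f: "f \<in> F" "poly_eval f x = 0" and y: "y \<in> vec.span {x}" for f y
  proof -
    obtain d where "homogeneous_of_degree d f" using f assms(1) by (auto simp: homogeneous_def)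
    moreover obtain c where "y = c *s x" using y by (auto simp: vec.span_singleton)
    ultimately show ?thesis using f(2) by (simp add: poly_eval_scale)
  qed
  moreover have "x \<in> vec.span {x}" by (simp add: vec.span_base)
  ultimately show ?thesis unfolding zero_locus_def by auto
qed

lemma zero_locus_products:
  assumes F: "\<forall>f\<in>F. homogeneous f" and G: "\<forall>g\<in>G. homogeneous g"
  shows "zero_locus {f * g | f g. f \<in> F \<and> g \<in> G} = zero_locus F \<union> zero_locus G"
    (is "zero_locus ?H = _")
proof -
  have H: "\<forall>h\<in>?H. homogeneous h" using F G homogeneous_mult by auto
  have "p \<in> zero_locus ?H \<longleftrightarrow> p \<in> zero_locus F \<union> zero_locus G" if p: "p \<in> proj_space" for p
  proof -
    obtain x where x: "x \<noteq> 0" "p = vec.span {x}" using p by (auto simp: proj_space_def)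
    have "p \<in> zero_locus ?H \<longleftrightarrow> (\<forall>f\<in>F. \<forall>g\<in>G. poly_eval f x * poly_eval g x = 0)"
      unfolding x(2) zero_locus_span[OF H x(1)] by (auto simp flip: poly_eval_mult)
    then show ?thesis
      unfolding x(2) Un_iff zero_locus_span[OF F x(1)] zero_locus_span[OF G x(1)] by auto
  qed
  moreover have "zero_locus E \<subseteq> proj_space" for E :: "'a cpoly set" by (auto simp: zero_locus_def)
  ultimately show ?thesis by blast
qed

lemma istopology_zariski:
  "istopology (\<lambda>U. \<exists>F. (\<forall>f\<in>F. homogeneous f) \<and> U = proj_space - zero_locus F)"
  unfolding istopology_def
proof (intro conjI allI impI)
  fix S T :: "(complex ^ 'a) set set"
  assume "\<exists>F. (\<forall>f\<in>F. homogeneous f) \<and> S = proj_space - zero_locus F"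
    and "\<exists>F. (\<forall>f\<in>F. homogeneous f) \<and> T = proj_space - zero_locus F"
  then obtain F G where F: "\<forall>f\<in>F. homogeneous f" "S = proj_space - zero_locus F"
    and G: "\<forall>f\<in>G. homogeneous f" "T = proj_space - zero_locus G" by blast
  have "S \<inter> T = proj_space - zero_locus {f * g | f g. f \<in> F \<and> g \<in> G}"
    using F G zero_locus_products[of F G] by auto
  moreover have "\<forall>h\<in>{f * g | f g. f \<in> F \<and> g \<in> G}. homogeneous h"
    using F G homogeneous_mult by auto
  ultimately show "\<exists>F. (\<forall>f\<in>F. homogeneous f) \<and> S \<inter> T = proj_space - zero_locus F" by blast
next
  fix K :: "(complex ^ 'a) set set set"
  assume "\<forall>U\<in>K. \<exists>F. (\<forall>f\<in>F. homogeneous f) \<and> U = proj_space - zero_locus F"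
  then obtain F where F: "\<And>U. U \<in> K \<Longrightarrow> (\<forall>f\<in>F U. homogeneous f) \<and> U = proj_space - zero_locus (F U)"
    by metis
  have "\<Union>K = (\<Union>U\<in>K. proj_space - zero_locus (F U))" using F by blast
  also have "\<dots> = proj_space - zero_locus (insert 0 (\<Union>U\<in>K. F U))"
    by (auto simp: zero_locus_def poly_eval_zero)
  finally show "\<exists>F. (\<forall>f\<in>F. homogeneous f) \<and> \<Union>K = proj_space - zero_locus F"
    using F homogeneous_zero by (intro exI[of _ "insert 0 (\<Union>U\<in>K. F U)"]) auto
qed

lemma openin_zariski:
  "openin zariski U \<longleftrightarrow> (\<exists>F. (\<forall>f\<in>F. homogeneous f) \<and> U = proj_space - zero_locus F)"
  unfolding zariski_def topology_inverse'[OF istopology_zariski] ..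

lemma topspace_zariski: "topspace zariski = (proj_space :: (complex ^ 'i::finite) set set)"
proof
  show "topspace zariski \<subseteq> (proj_space :: (complex ^ 'i) set set)"
    by (auto simp: topspace_def openin_zariski)
  have "zero_locus {1 :: 'i cpoly} = {}"
    by (auto simp: zero_locus_def proj_space_def poly_eval_def monom_eval_def
        intro: vec.span_zero)
  then have "openin zariski (proj_space :: (complex ^ 'i) set set)"
    unfolding openin_zariski by (intro exI[of _ "{1}"]) (simp add: homogeneous_one)
  then show "(proj_space :: (complex ^ 'i) set set) \<subseteq> topspace zariski"
    by (rule openin_subset)
qed

lemma closedin_zariski:
  "closedin zariski C \<longleftrightarrow> (\<exists>F. (\<forall>f\<in>F. homogeneous f) \<and> C = zero_locus F)"
proof -
  have "zero_locus F \<subseteq> proj_space" for F :: "'a cpoly set" by (auto simp: zero_locus_def)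
  then show ?thesis
    unfolding closedin_def topspace_zariski openin_zariski by blast
qed


section \<open>Krull dimension\<close>

definition irreducible_in :: "'a topology \<Rightarrow> 'a set \<Rightarrow> bool" where
  "irreducible_in T Z \<longleftrightarrow> Z \<noteq> {} \<and> Z \<subseteq> topspace T \<and>
     (\<forall>C D. closedin T C \<and> closedin T D \<and> Z \<subseteq> C \<union> D \<longrightarrow> Z \<subseteq> C \<or> Z \<subseteq> D)"

text \<open>
  The supremum of the lengths \<open>k\<close> of chains \<open>Z\<^sub>0 \<subset> \<dots> \<subset> Z\<^sub>k\<close> of irreducible closed sets. Because the
  supremum is taken in \<^typ>\<open>enat\<close>, the empty space gets dimension \<open>0\<close>.
\<close>

definition krull_dim :: "'a topology \<Rightarrow> enat" where
  "krull_dim T = Sup {enat k | k. \<exists>Z :: nat \<Rightarrow> 'a set.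
     (\<forall>i\<le>k. closedin T (Z i) \<and> irreducible_in T (Z i)) \<and> (\<forall>i<k. Z i \<subset> Z (Suc i))}"

definition proj_dim :: "(complex ^ 'i::finite) set set \<Rightarrow> enat" where
  "proj_dim X = krull_dim (subtopology zariski X)"


section \<open>Secant varieties and toric varieties\<close>

definition secant_variety :: "(complex ^ 'i::finite) set set \<Rightarrow> (complex ^ 'i) set set" where
  "secant_variety X =
     zariski closure_of (\<Union>{l \<in> proj_lines. \<exists>p\<in>l \<inter> X. \<exists>q\<in>l \<inter> X. p \<noteq> q})"

definition torus :: "(complex ^ 'n) set" where
  "torus = {t. \<forall>j. t $ j \<noteq> 0}"

definition torus_character :: "int ^ 'n \<Rightarrow> complex ^ 'n \<Rightarrow> complex" where
  "torus_character a t = (\<Prod>j\<in>UNIV. t $ j powi (a $ j))"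

definition toric_variety :: "('i::finite \<Rightarrow> int ^ 'n) \<Rightarrow> (complex ^ 'i) set set" where
  "toric_variety u =
     zariski closure_of ((\<lambda>t. vec.span {\<chi> i. torus_character (u i) t}) ` torus)"


section \<open>Lattice polytopes\<close>

definition real_of_lattice :: "int ^ 'n \<Rightarrow> real ^ 'n" where
  "real_of_lattice a = (\<chi> j. real_of_int (a $ j))"

definition lattice_points :: "(real ^ 'n) set \<Rightarrow> (int ^ 'n) set" where
  "lattice_points S = {a. real_of_lattice a \<in> S}"

definition lattice_polytope :: "(real ^ 'n) set \<Rightarrow> bool" where
  "lattice_polytope P \<longleftrightarrow> (\<exists>B. finite B \<and> P = convex hull (real_of_lattice ` B))"

definition nearest_neighbor :: "int ^ 'n \<Rightarrow> (real ^ 'n) set \<Rightarrow> int ^ 'n \<Rightarrow> bool" where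
  "nearest_neighbor v e w \<longleftrightarrow> is_arg_min
     (\<lambda>a. dist (real_of_lattice v) (real_of_lattice a)) (\<lambda>a. a \<in> lattice_points e - {v}) w"

text \<open>
  The vertices of a lattice polytope are lattice points, so it suffices to consider vertices \<open>v\<close> in
  \<open>\<int>\<^sup>n\<close>. The first lattice vector along an edge \<open>e\<close> at \<open>v\<close> is \<open>w - v\<close> for the nearest neighbor \<open>w\<close>
  of \<open>v\<close> along \<open>e\<close>.
\<close>

definition is_neighbor :: "(real ^ 'n) set \<Rightarrow> int ^ 'n \<Rightarrow> int ^ 'n \<Rightarrow> bool" where
  "is_neighbor P v w \<longleftrightarrow> real_of_lattice v extreme_point_of P \<and>
     (\<exists>e. e edge_of P \<and> real_of_lattice v \<in> e \<and> nearest_neighbor v e w)"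

definition lattice_basis :: "(int ^ 'n) set \<Rightarrow> bool" where
  "lattice_basis B \<longleftrightarrow>
     \<not> module.dependent ((*s) :: int \<Rightarrow> int ^ 'n \<Rightarrow> int ^ 'n) B \<and>
     module.span ((*s) :: int \<Rightarrow> int ^ 'n \<Rightarrow> int ^ 'n) B = UNIV"

lemma module_lattice: "module ((*s) :: int \<Rightarrow> int ^ 'n \<Rightarrow> int ^ 'n)"
  by unfold_locales (simp_all add: vec_eq_iff algebra_simps)

definition simple_polytope :: "(real ^ 'n) set \<Rightarrow> bool" where
  "simple_polytope P \<longleftrightarrow>
     (\<forall>v. v extreme_point_of P \<longrightarrow> int (card {e. e edge_of P \<and> v \<in> e}) = aff_dim P)"

definition smooth_polytope :: "(real ^ 'n) set \<Rightarrow> bool" where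
  "smooth_polytope P \<longleftrightarrow> lattice_polytope P \<and> simple_polytope P \<and>
     (\<forall>v. real_of_lattice v extreme_point_of P \<longrightarrow>
       (\<exists>B. lattice_basis B \<and> {w - v | w. is_neighbor P v w} \<subseteq> B))"

text \<open>An integer matrix is \<^const>\<open>invertible\<close> iff it has an inverse with integer entries.\<close>

definition AGL :: "(int ^ 'n \<Rightarrow> int ^ 'n) set" where
  "AGL = {\<lambda>x. M *v x + b | M b. invertible M}"

definition AGL_equivalent :: "(int ^ 'n) set \<Rightarrow> (int ^ 'n) set \<Rightarrow> bool" where
  "AGL_equivalent A B \<longleftrightarrow> (\<exists>\<phi>\<in>AGL. \<phi> ` A = B)"

definition two_simplex :: "(real ^ 'n) set" where
  "two_simplex = {p. (\<forall>j. 0 \<le> p $ j) \<and> (\<Sum>j\<in>UNIV. p $ j) \<le> 2}"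

text \<open>
  With \<open>F\<close> a \<open>k\<close>-dimensional face of \<open>2\<Delta>\<^sub>n\<close> this is \<open>(2\<Delta>\<^sub>n)\<^sub>k\<close>, which up to
  affine automorphisms of \<open>\<int>\<^sup>n\<close> only depends on \<open>k\<close>.
\<close>

definition two_simplex_minus :: "(real ^ 'n) set \<Rightarrow> (real ^ 'n) set" where
  "two_simplex_minus F = convex hull (real_of_lattice ` lattice_points (two_simplex - F))"

text \<open>
  \<open>\<Delta>\<^sub>\<ell> \<times> \<Delta>\<^sub>n\<^sub>-\<^sub>\<ell>\<close> for \<open>\<ell> = card L\<close>, where \<open>\<real>\<^sup>n\<close> is split as \<open>\<real>\<^sup>L \<times> \<real>\<^sup>-\<^sup>L\<close>.
\<close>

definition simplex_product :: "'n::finite set \<Rightarrow> (real ^ 'n) set" where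
  "simplex_product L =
     {p. (\<forall>j. 0 \<le> p $ j) \<and> (\<Sum>j\<in>L. p $ j) \<le> 1 \<and> (\<Sum>j\<in>-L. p $ j) \<le> 1}"

end

theory Submission
  imports Defs "HOL-Computational_Algebra.Polynomial"
begin

text \<open>
  The upper bound \<open>min s (2 n + 1)\<close> comes from counting: a chain of \<open>k + 1\<close> irreducible closed sets
  yields \<open>binomial (j + k) k\<close> linearly independent forms of degree \<open>d j\<close>, whereas a cone parametrized
  by \<open>N\<close> polynomial parameters carries only \<open>O(j\<^sup>N)\<close> of them. For the lower bound, restrict the join
  parametrization \<open>(a, s, b, t) \<mapsto> a \<chi>(s) + b \<chi>(t)\<close> to a flag of parameter subspaces on which it is
  immersive; the same count shows that the closures of the images form a strict chain. By Terracini
  and a tropical degeneration, the rank of the differential is at least the sum of the affine ranks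
  of the two parts into which a hyperplane splits \<open>A\<close>.

  Choose coordinates such that a vertex of \<open>P\<close> is \<open>0\<close> and its neighbors are the unit vectors, and
  split off this unit simplex. If the remaining points of \<open>A\<close> affinely span, the rank is \<open>2 n + 2\<close>.
  Otherwise all edges at \<open>0\<close> have length at most \<open>2\<close>, and comparing the unimodular cones of \<open>P\<close> at
  nearby vertices shows that \<open>A\<close> lies in \<open>2\<Delta>\<^sub>n\<close> (if there is an edge of length \<open>2\<close>) or is a product
  of at most two simplices. These are the exceptional sets, except for those cases in which the
  remaining points are affinely independent, so that the secant variety fills the ambient space.
\<close>

section \<open>Linear systems\<close>

text \<open>The dimension is defined by chains of irreducible closed sets, so the Hilbert function
  serves as the go-between: its order of growth is bounded above by a count of parameters and below
  by an explicit list of independent forms. Strictness of the chain in the lower bound is obtained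
  in the same way, by playing \<open>q ^ (j + 1)\<close> forms off against a bound of order
  \<open>q ^ j\<close>.

  The hyperplane lies between heights 1 and 2: at a smooth vertex the points of height at most 1 are
  the \<open>n + 1\<close> vertices of a unimodular simplex and contribute full affine rank. All
  remaining information sits in the set \<open>far\<close> of points of height at least 2. If
  \<open>far\<close> has affine rank \<open>n + 1\<close>, the dimension reaches
  \<open>2 n + 1\<close>; if \<open>far\<close> is affinely independent, the rank is the number of
  all points and the dimension reaches \<open>s\<close>.

  The choice of the vertex matters: if some edge of \<open>P\<close> has lattice length at least 2,
  such an edge must start at the origin. Only then do unit edges at the origin imply unit edges
  everywhere, which the product case relies on.\<close>

lemma underdetermined_system:
  fixes M :: "'e \<Rightarrow> 'j \<Rightarrow> 'a::field"
  assumes "finite E" "card E < card J"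
  shows "\<exists>c. (\<exists>j\<in>J. c j \<noteq> 0) \<and> (\<forall>e\<in>E. (\<Sum>j\<in>J. c j * M e j) = 0)"
  using assms
proof (induction E arbitrary: J M rule: finite_induct)
  case empty
  then have "J \<noteq> {}" by auto
  then show ?case by (intro exI[of _ "\<lambda>_. 1"]) auto
next
  case (insert e E)
  have finJ: "finite J" using insert.prems by (metis card.infinite not_less0)
  show ?case
  proof (cases "\<forall>j\<in>J. M e j = 0")
    case True
    have "card E < card J" using insert by simp
    from insert.IH[OF this, of M] show ?thesis using True by auto
  next
    case False
    then obtain k where k: "k \<in> J" "M e k \<noteq> 0" by blast
    define N where "N e' j = M e' j - M e' k * M e j / M e k" for e' j
    have "card E < card (J - {k})" using insert k finJ by simp
    from insert.IH[OF this, of N] obtain c where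
      c: "\<exists>j\<in>J - {k}. c j \<noteq> 0" "\<forall>e'\<in>E. (\<Sum>j\<in>J - {k}. c j * N e' j) = 0" by blast
    \<comment> \<open>This value of the eliminated unknown \<open>k\<close> solves equation
      \<open>e\<close>; substituting it turns each equation \<open>e'\<close> into row
      \<open>e'\<close> of \<open>N\<close>.\<close>
    define d where "d = c(k := - (\<Sum>j\<in>J - {k}. c j * M e j) / M e k)"
    have sumd: "(\<Sum>j\<in>J. d j * M e' j) = (\<Sum>j\<in>J - {k}. c j * N e' j)" for e'
    proof -
      have "(\<Sum>j\<in>J. d j * M e' j) = d k * M e' k + (\<Sum>j\<in>J - {k}. d j * M e' j)"
        using k finJ by (simp add: sum.remove)
      also have "(\<Sum>j\<in>J - {k}. d j * M e' j) = (\<Sum>j\<in>J - {k}. c j * M e' j)"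
        by (intro sum.cong) (auto simp: d_def)
      also have "d k * M e' k = - (\<Sum>j\<in>J - {k}. c j * (M e' k * M e j / M e k))"
        by (simp add: d_def sum_divide_distrib sum_distrib_left mult_ac)
      finally show ?thesis
        by (simp add: N_def right_diff_distrib sum_subtractf)
    qed
    have "N e j = 0" for j using k by (simp add: N_def)
    then have "\<forall>e'\<in>insert e E. (\<Sum>j\<in>J. d j * M e' j) = 0" using c(2) by (auto simp: sumd)
    moreover have "\<exists>j\<in>J. d j \<noteq> 0" using c(1) by (auto simp: d_def)
    ultimately show ?thesis by blast
  qed
qed

text \<open>Later the rows are those of a differential, and the dual vectors are parameter
  directions in which it becomes the identity matrix. The induction adds one row at a time and
  corrects the old vectors.\<close>

lemma dual_vectors:
  fixes r :: "'k \<Rightarrow> 'm::finite \<Rightarrow> 'a::field"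
  assumes "finite I"
    and "\<And>c i. (\<And>m. (\<Sum>i\<in>I. c i * r i m) = 0) \<Longrightarrow> i \<in> I \<Longrightarrow> c i = 0"
  shows "\<exists>v :: 'k \<Rightarrow> 'm \<Rightarrow> 'a. \<forall>i\<in>I. \<forall>k\<in>I. (\<Sum>m\<in>UNIV. r k m * v i m) = (if k = i then 1 else 0)"
  using assms
proof (induction I rule: finite_induct)
  case empty
  then show ?case by simp
next
  case (insert k I)
  have "c i = 0" if "\<And>m. (\<Sum>i\<in>I. c i * r i m) = 0" "i \<in> I" for c i
  proof -
    have "(c(k := 0)) i = 0"
    proof (rule insert.prems)
      fix m
      have "(\<Sum>i\<in>I. (c(k := 0)) i * r i m) = (\<Sum>i\<in>I. c i * r i m)"
        using insert.hyps by (intro sum.cong) auto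
      then show "(\<Sum>i\<in>insert k I. (c(k := 0)) i * r i m) = 0"
        using that insert.hyps by simp
    qed (use that in simp)
    then show ?thesis using that insert.hyps by (auto split: if_splits)
  qed
  then obtain v :: "'k \<Rightarrow> 'm \<Rightarrow> 'a" where
    v: "\<And>i j. i \<in> I \<Longrightarrow> j \<in> I \<Longrightarrow> (\<Sum>m\<in>UNIV. r j m * v i m) = (if j = i then 1 else 0)"
    using insert.IH by metis
  define s where "s i = (\<Sum>m\<in>UNIV. r k m * v i m)" for i
  \<comment> \<open>\<open>w\<close> is the part of row \<open>k\<close> that annihilates all
    \<open>v i\<close>; independence makes it nonzero.\<close>
  define w where "w m = r k m - (\<Sum>i\<in>I. s i * r i m)" for m
  have "\<exists>m. w m \<noteq> 0"
  proof (rule ccontr)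
    assume "\<nexists>m. w m \<noteq> 0"
    then have w0: "w m = 0" for m by blast
    define c where "c = (\<lambda>i. - s i)(k := 1)"
    have "c k = 0"
    proof (rule insert.prems)
      fix m
      have "(\<Sum>i\<in>I. c i * r i m) = - (\<Sum>i\<in>I. s i * r i m)"
        unfolding sum_negf[symmetric] using insert.hyps by (intro sum.cong) (auto simp: c_def)
      then show "(\<Sum>i\<in>insert k I. c i * r i m) = 0"
        using insert.hyps w0[of m] by (simp add: c_def w_def)
    qed simp
    then show False by (simp add: c_def)
  qed
  then obtain p where p: "w p \<noteq> 0" by blast
  \<comment> \<open>Projection of the \<open>p\<close>-th unit vector along the \<open>v i\<close>:
    the old rows annihilate it, and before scaling row \<open>k\<close> takes the value
    \<open>w p\<close> on it.\<close>
  define u where "u m = ((if m = p then 1 else 0) - (\<Sum>i\<in>I. r i p * v i m)) / w p" for m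
  have ru: "(\<Sum>m\<in>UNIV. r j m * u m) = (r j p - (\<Sum>i\<in>I. r i p * (\<Sum>m\<in>UNIV. r j m * v i m))) / w p" for j
  proof -
    have "(\<Sum>m\<in>UNIV. r j m * u m)
      = ((\<Sum>m\<in>UNIV. r j m * (if m = p then 1 else 0)) - (\<Sum>m\<in>UNIV. \<Sum>i\<in>I. r j m * (r i p * v i m))) / w p"
      by (simp add: u_def sum_divide_distrib right_diff_distrib diff_divide_distrib sum_subtractf sum_distrib_left)
    also have "(\<Sum>m\<in>UNIV. \<Sum>i\<in>I. r j m * (r i p * v i m)) = (\<Sum>i\<in>I. r i p * (\<Sum>m\<in>UNIV. r j m * v i m))"
      by (subst sum.swap) (simp add: sum_distrib_left mult_ac)
    also have "(\<Sum>m\<in>UNIV. r j m * (if m = p then 1 else 0)) = r j p"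
      by (simp add: if_distrib[of "\<lambda>x. _ * x"] cong: if_cong)
    finally show ?thesis .
  qed
  have rI: "(\<Sum>m\<in>UNIV. r j m * u m) = 0" if "j \<in> I" for j
  proof -
    have "(\<Sum>i\<in>I. r i p * (\<Sum>m\<in>UNIV. r j m * v i m)) = (\<Sum>i\<in>I. if i = j then r j p else 0)"
      using v that by (intro sum.cong) auto
    also have "\<dots> = r j p" using that insert.hyps by simp
    finally show ?thesis by (simp add: ru)
  qed
  have rk: "(\<Sum>m\<in>UNIV. r k m * u m) = 1"
    using p unfolding ru by (simp add: w_def s_def mult_ac)
  define v' where "v' = (\<lambda>i m. v i m - s i * u m)(k := u)"
  have v'r: "(\<Sum>m\<in>UNIV. r j m * v' i m) = (\<Sum>m\<in>UNIV. r j m * v i m) - s i * (\<Sum>m\<in>UNIV. r j m * u m)"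
    if "i \<noteq> k" for i j
    using that by (simp add: v'_def right_diff_distrib sum_subtractf sum_distrib_left mult_ac)
  have "(\<Sum>m\<in>UNIV. r j m * v' i m) = (if j = i then 1 else 0)"
    if "i \<in> insert k I" "j \<in> insert k I" for i j
  proof (cases "i = k")
    case True
    then show ?thesis using that rI rk insert.hyps by (auto simp: v'_def)
  next
    case False
    then show ?thesis using that rI rk v insert.hyps by (auto simp: v'r s_def)
  qed
  then show ?case by blast
qed

section \<open>Homogeneous forms as functions\<close>

text \<open>Forms are handled as functions, so the zero function is a form of every degree and sums
  or powers need no bookkeeping of coefficients.\<close>

definition form :: "nat \<Rightarrow> (complex ^ 'i::finite \<Rightarrow> complex) \<Rightarrow> bool" where
  "form d F \<longleftrightarrow> (\<exists>f. homogeneous_of_degree d f \<and> F = poly_eval f)"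

lemma form_mult:
  assumes "form d F" "form e G" shows "form (d + e) (\<lambda>x. F x * G x)"
proof -
  obtain f g where f: "homogeneous_of_degree d f" "F = poly_eval f"
    and g: "homogeneous_of_degree e g" "G = poly_eval g"
    using assms by (auto simp: form_def)
  have "homogeneous_of_degree (d + e) (f * g)"
    unfolding homogeneous_of_degree_def
  proof
    fix m assume "m \<in> Poly_Mapping.keys (f * g)"
    then obtain a b where "m = a + b" "a \<in> Poly_Mapping.keys f" "b \<in> Poly_Mapping.keys g"
      using keys_mult[of f g] by blast
    then show "(\<Sum>i\<in>UNIV. Poly_Mapping.lookup m i) = d + e"
      using f g by (simp add: homogeneous_of_degree_def lookup_add sum.distrib)
  qed
  then show ?thesis using f g by (auto simp: form_def poly_eval_mult fun_eq_iff)
qed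

lemma form_zero: "form d (\<lambda>x. 0)"
  unfolding form_def by (rule exI[of _ 0]) (auto simp: homogeneous_of_degree_def poly_eval_def)

lemma form_add:
  assumes "form d F" "form d G" shows "form d (\<lambda>x. F x + G x)"
proof -
  obtain f g where f: "homogeneous_of_degree d f" "F = poly_eval f"
    and g: "homogeneous_of_degree d g" "G = poly_eval g"
    using assms by (auto simp: form_def)
  have "homogeneous_of_degree d (f + g)"
    using f g keys_add[of f g] by (auto simp: homogeneous_of_degree_def)
  then show ?thesis using f g by (auto simp: form_def poly_eval_add fun_eq_iff)
qed

lemma form_const: "form 0 (\<lambda>x. c)"
  unfolding form_def
  by (rule exI[of _ "Poly_Mapping.single 0 c"])
    (auto simp: homogeneous_of_degree_def poly_eval_single monom_eval_def fun_eq_iff split: if_splits)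

lemma form_coord: "form 1 (\<lambda>x. x $ i)"
proof -
  let ?m = "Poly_Mapping.single i (1::nat)"
  have "(\<Sum>k\<in>UNIV. Poly_Mapping.lookup ?m k) = 1"
    by (simp add: lookup_single when_def)
  moreover have "monom_eval ?m x = x $ i" for x :: "complex ^ 'a"
  proof -
    have "monom_eval ?m x = (\<Prod>k\<in>UNIV. if k = i then x $ i else 1)"
      unfolding monom_eval_def by (intro prod.cong) (auto simp: lookup_single when_def)
    then show ?thesis by simp
  qed
  ultimately show ?thesis unfolding form_def
    by (intro exI[of _ "Poly_Mapping.single ?m 1"])
      (auto simp: homogeneous_of_degree_def poly_eval_single fun_eq_iff)
qed

lemma form_cmult: "form d F \<Longrightarrow> form d (\<lambda>x. c * F x)"
  using form_mult[OF form_const[of c], of d F] by simp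

lemma form_sum: "(\<And>a. a \<in> S \<Longrightarrow> form d (F a)) \<Longrightarrow> form d (\<lambda>x. \<Sum>a\<in>S. F a x)"
  by (induction S rule: infinite_finite_induct) (auto intro: form_zero form_add)

lemma form_power: "form d F \<Longrightarrow> form (d * k) (\<lambda>x. F x ^ k)"
  by (induction k) (use form_const[of 1] form_mult in \<open>auto simp: add.commute\<close>)

lemma form_prod:
  "finite S \<Longrightarrow> (\<And>a. a \<in> S \<Longrightarrow> form (e a) (F a)) \<Longrightarrow> form (\<Sum>a\<in>S. e a) (\<lambda>x. \<Prod>a\<in>S. F a x)"
  by (induction S rule: finite_induct) (auto intro: form_mult simp: form_const)

lemma form_scale: "form d F \<Longrightarrow> F (c *s x) = c ^ d * F x"
  by (auto simp: form_def poly_eval_scale)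

lemma form_homogeneous: "(\<exists>d. form d F) \<longleftrightarrow> (\<exists>f. homogeneous f \<and> F = poly_eval f)"
  by (auto simp: form_def homogeneous_def)

text \<open>The affine cone over the Zariski closure of the points spanned by \<open>S\<close>.\<close>

definition cone_closure :: "(complex ^ 'i::finite) set \<Rightarrow> (complex ^ 'i) set" where
  "cone_closure S = {x. \<forall>d F. form d F \<and> (\<forall>y\<in>S. F y = 0) \<longrightarrow> F x = 0}"

lemma cone_closureD: "x \<in> cone_closure S \<Longrightarrow> form d F \<Longrightarrow> (\<And>y. y \<in> S \<Longrightarrow> F y = 0) \<Longrightarrow> F x = 0"
  unfolding cone_closure_def by blast

lemma cone_closure_superset: "S \<subseteq> cone_closure S"
  by (auto simp: cone_closure_def)

lemma cone_closure_mono: "S \<subseteq> cone_closure T \<Longrightarrow> cone_closure S \<subseteq> cone_closure T"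
  unfolding cone_closure_def by blast

abbreviation spans :: "(complex ^ 'i) set \<Rightarrow> (complex ^ 'i) set set" where
  "spans S \<equiv> (\<lambda>x. vec.span {x}) ` S"

text \<open>A homogeneous polynomial vanishes on the line of \<open>x\<close> as soon as it vanishes
  at \<open>x\<close>, so membership in a projective closure can be tested on representatives. The
  vector 0 is excluded because it spans no point.\<close>

lemma zariski_closure_iff:
  fixes S :: "(complex ^ 'i::finite) set"
  assumes "0 \<notin> S" "x \<noteq> 0"
  shows "vec.span {x} \<in> zariski closure_of spans S \<longleftrightarrow> x \<in> cone_closure S"
proof
  assume L: "vec.span {x} \<in> zariski closure_of spans S"
  show "x \<in> cone_closure S"
    unfolding cone_closure_def
  proof (intro CollectI allI impI, elim conjE)
    fix d F assume F: "form d F" "\<forall>y\<in>S. F y = 0"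
    then obtain f where f: "homogeneous f" "F = poly_eval f"
      using form_homogeneous by metis
    have "closedin zariski (zero_locus {f})" using f by (auto simp: closedin_zariski)
    moreover have "spans S \<subseteq> zero_locus {f}"
    proof
      fix p assume "p \<in> spans S"
      then obtain y where y: "y \<in> S" "p = vec.span {y}" by blast
      then have "y \<noteq> 0" using assms by auto
      then show "p \<in> zero_locus {f}" using y F f by (simp add: zero_locus_span)
    qed
    ultimately have "zariski closure_of spans S \<subseteq> zero_locus {f}"
      by (simp add: closure_of_minimal)
    then have "vec.span {x} \<in> zero_locus {f}" using L by blast
    then show "F x = 0" using f assms by (simp add: zero_locus_span)
  qed
next
  assume R: "x \<in> cone_closure S"
  have SS: "spans S \<subseteq> topspace zariski"
    using assms by (auto simp: topspace_zariski proj_space_def)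
  obtain E where E: "\<forall>f\<in>E. homogeneous f" "zariski closure_of spans S = zero_locus E"
    using closedin_closure_of[of zariski "spans S"] unfolding closedin_zariski by blast
  have "poly_eval f x = 0" if f: "f \<in> E" for f
  proof -
    have "poly_eval f y = 0" if "y \<in> S" for y
    proof -
      have "vec.span {y} \<in> zero_locus E" using that closure_of_subset[OF SS] E by blast
      then show ?thesis using f E that assms by (metis zero_locus_span)
    qed
    moreover obtain d where "form d (poly_eval f)" using f E form_homogeneous by blast
    ultimately show ?thesis using cone_closureD[OF R] by blast
  qed
  then show "vec.span {x} \<in> zariski closure_of spans S"
    using E assms by (simp add: zero_locus_span)
qed

lemma proj_spaceE:
  assumes "p \<in> proj_space" obtains x where "x \<noteq> 0" "p = vec.span {x}"
  using assms by (auto simp: proj_space_def)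

lemma spans_subset_proj_space: "0 \<notin> S \<Longrightarrow> spans S \<subseteq> proj_space"
  by (auto simp: proj_space_def)

lemma zariski_closure_subset_proj_space: "zariski closure_of T \<subseteq> proj_space"
  using closure_of_subset_topspace[of zariski T] by (simp add: topspace_zariski)


section \<open>Linearly independent forms on a cone\<close>

text \<open>A lower bound \<open>K\<close> for the Hilbert function of the cone \<open>S\<close> in
  degree \<open>m\<close>.\<close>

definition independent_forms :: "(complex ^ 'i::finite) set \<Rightarrow> nat \<Rightarrow> nat \<Rightarrow> bool" where
  "independent_forms S m K \<longleftrightarrow> (\<exists>F. (\<forall>a<K. form m (F a)) \<and>
     (\<forall>c. (\<forall>x\<in>S. (\<Sum>a<K. c a * F a x) = 0) \<longrightarrow> (\<forall>a<K. c a = 0)))"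

text \<open>Primality of the homogeneous vanishing ideal; unlike irreducibility of a closed set it
  makes sense for parametrized sets before taking closures.\<close>

definition prime_cone :: "(complex ^ 'i::finite) set \<Rightarrow> bool" where
  "prime_cone S \<longleftrightarrow> (\<forall>d e F G. form d F \<and> form e G \<and> (\<forall>x\<in>S. F x * G x = 0) \<longrightarrow>
     (\<forall>x\<in>S. F x = 0) \<or> (\<forall>x\<in>S. G x = 0))"

lemma sum_lessThan_add:
  "(\<Sum>i<a + b. f i) = (\<Sum>i<a. f i) + (\<Sum>i<b. f (a + i :: nat))" for f :: "nat \<Rightarrow> 'a::comm_monoid_add"
  by (induction b) (auto simp: add_ac)

text \<open>The exact sequence behind \<open>h\<^sub>1(m + d) \<ge> h\<^sub>0(m + d) + h\<^sub>1(m)\<close> for the Hilbert functions.\<close>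

lemma independent_forms_step:
  assumes "prime_cone S1" "S0 \<subseteq> S1" "form d f" "\<forall>x\<in>S0. f x = 0" "\<exists>x\<in>S1. f x \<noteq> 0"
    and "independent_forms S0 (m + d) a" "independent_forms S1 m b"
  shows "independent_forms S1 (m + d) (a + b)"
proof -
  obtain A where A: "\<And>i. i < a \<Longrightarrow> form (m + d) (A i)"
    and indA: "\<And>c i. \<forall>x\<in>S0. (\<Sum>i<a. c i * A i x) = 0 \<Longrightarrow> i < a \<Longrightarrow> c i = 0"
    using assms(6) unfolding independent_forms_def by blast
  obtain B where B: "\<And>i. i < b \<Longrightarrow> form m (B i)"
    and indB: "\<And>c i. \<forall>x\<in>S1. (\<Sum>i<b. c i * B i x) = 0 \<Longrightarrow> i < b \<Longrightarrow> c i = 0"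
    using assms(7) unfolding independent_forms_def by blast
  define F where "F i = (if i < a then A i else (\<lambda>x. B (i - a) x * f x))" for i
  have "form (m + d) (F i)" if "i < a + b" for i
    using that A B[of "i - a"] form_mult[OF _ assms(3)] by (auto simp: F_def)
  moreover have "\<forall>i<a + b. c i = 0" if c: "\<forall>x\<in>S1. (\<Sum>i<a + b. c i * F i x) = 0" for c
  proof -
    have split: "(\<Sum>i<a + b. c i * F i x) = (\<Sum>i<a. c i * A i x) + f x * (\<Sum>i<b. c (a + i) * B i x)" for x
      by (simp add: sum_lessThan_add F_def sum_distrib_left mult_ac)
    \<comment> \<open>On \<open>S0\<close> the multiples of \<open>f\<close> vanish, so only the
      forms \<open>A\<close> survive there.\<close>
    have ca: "c i = 0" if "i < a" for i
    proof (rule indA[OF _ that])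
      show "\<forall>x\<in>S0. (\<Sum>i<a. c i * A i x) = 0"
        using c assms(2,4) unfolding split by fastforce
    qed
    let ?G = "\<lambda>x. \<Sum>i<b. c (a + i) * B i x"
    have G: "form m ?G" using B by (intro form_sum form_cmult) auto
    have "\<forall>x\<in>S1. f x * ?G x = 0" using c ca unfolding split by simp
    \<comment> \<open>Primality allows the factor \<open>f\<close> to be cancelled on
      \<open>S1\<close>.\<close>
    then have "\<forall>x\<in>S1. ?G x = 0"
      using assms(1,3,5) G unfolding prime_cone_def by blast
    then have cb: "c (a + i) = 0" if "i < b" for i
      using indB[of "\<lambda>i. c (a + i)"] that by blast
    show ?thesis
    proof (intro allI impI)
      fix i assume "i < a + b"
      then show "c i = 0" using ca[of i] cb[of "i - a"] by (cases "i < a") auto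
    qed
  qed
  ultimately show ?thesis unfolding independent_forms_def by blast
qed

lemma independent_forms_one:
  assumes "x \<in> S" "form m f" "f x \<noteq> 0" shows "independent_forms S m 1"
  unfolding independent_forms_def by (rule exI[of _ "\<lambda>_. f"]) (use assms in auto)

text \<open>Writing \<open>h k j\<close> for the guaranteed number of forms,
  \<open>independent_forms_step\<close> reads
  \<open>h (k + 1) (j + 1) \<ge> h k (j + 1) + h (k + 1) j\<close>, which is Pascal's rule; hence
  the binomial coefficient and the double induction.\<close>

lemma independent_forms_chain:
  assumes "\<And>i. i \<le> k \<Longrightarrow> prime_cone (Z i)" "\<And>i. i < k \<Longrightarrow> Z i \<subseteq> Z (Suc i)"
    and "\<And>i. i < k \<Longrightarrow> \<exists>f. form d f \<and> (\<forall>x\<in>Z i. f x = 0) \<and> (\<exists>x\<in>Z (Suc i). f x \<noteq> 0)"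
    and "x \<in> Z 0" "form d f" "f x \<noteq> 0"
  shows "independent_forms (Z k) (d * j) ((j + k) choose k)"
  using assms
proof (induction k arbitrary: j)
  case 0
  then show ?case
    using independent_forms_one[OF 0(4) form_power[OF 0(5), of j]] by simp
next
  case (Suc k)
  have x: "x \<in> Z i" if "i \<le> Suc k" for i
    using that
  proof (induction i)
    case 0
    show ?case by (rule Suc.prems)
  next
    case (Suc i)
    then show ?case using \<open>\<And>i. i < Suc k \<Longrightarrow> Z i \<subseteq> Z (Suc i)\<close>[of i] by auto
  qed
  have Zk: "prime_cone (Z (Suc k))" "Z k \<subseteq> Z (Suc k)" using Suc.prems by auto
  obtain g where g: "form d g" "\<forall>x\<in>Z k. g x = 0" "\<exists>x\<in>Z (Suc k). g x \<noteq> 0"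
    using Suc.prems(3)[of k] by auto
  have IH: "independent_forms (Z k) (d * j) ((j + k) choose k)" for j
    by (rule Suc.IH) (use Suc.prems in auto)
  show ?case
  proof (induction j)
    case 0
    show ?case
      using independent_forms_one[OF x[of "Suc k"] form_const[of 1]] by simp
  next
    case (Suc j)
    have "independent_forms (Z (Suc k)) (d * j + d) ((Suc j + k choose k) + (j + Suc k choose Suc k))"
    proof (rule independent_forms_step[OF _ _ g])
      show "prime_cone (Z (Suc k))" "Z k \<subseteq> Z (Suc k)" by (rule Zk)+
      show "independent_forms (Z k) (d * j + d) (Suc j + k choose k)"
        using IH[of "Suc j"] by (simp add: add.commute)
      show "independent_forms (Z (Suc k)) (d * j) (j + Suc k choose Suc k)" by (rule Suc.IH)
    qed
    then show ?case by (simp add: add.commute)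
  qed
qed

section \<open>Cones parametrized by polynomials\<close>

text \<open>A degree bound in each variable separately is all that vanishing on a grid requires. It
  is expressed by univariate polynomials on lines parallel to the axes, for an arbitrary index
  type.\<close>

definition sep_poly :: "nat \<Rightarrow> (('v \<Rightarrow> complex) \<Rightarrow> complex) \<Rightarrow> bool" where
  "sep_poly D g \<longleftrightarrow> (\<forall>y b. \<exists>p. degree p \<le> D \<and> (\<forall>z. g (y(b := z)) = poly p z))"

lemma sep_poly_mono: "sep_poly D g \<Longrightarrow> D \<le> E \<Longrightarrow> sep_poly E g"
  unfolding sep_poly_def by (meson le_trans)

lemma sep_poly_const: "sep_poly D (\<lambda>y. c)"
  unfolding sep_poly_def by (intro allI exI[of _ "[:c:]"]) auto

lemma sep_poly_var: "sep_poly 1 (\<lambda>y. y b)"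
  unfolding sep_poly_def
proof (intro allI)
  fix y :: "'a \<Rightarrow> complex" and b'
  show "\<exists>p. degree p \<le> 1 \<and> (\<forall>z. (y(b' := z)) b = poly p z)"
    by (cases "b' = b") (auto intro: exI[of _ "[:0, 1:]"] exI[of _ "[:y b:]"])
qed

lemma sep_poly_add:
  assumes "sep_poly D f" "sep_poly D g" shows "sep_poly D (\<lambda>y. f y + g y)"
  unfolding sep_poly_def
proof (intro allI)
  fix y b
  obtain p q where "degree p \<le> D" "degree q \<le> D" "\<forall>z. f (y(b := z)) = poly p z" "\<forall>z. g (y(b := z)) = poly q z"
    using assms unfolding sep_poly_def by meson
  then show "\<exists>p. degree p \<le> D \<and> (\<forall>z. f (y(b := z)) + g (y(b := z)) = poly p z)"
    by (intro exI[of _ "p + q"]) (auto intro: degree_add_le)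
qed

lemma sep_poly_mult:
  assumes "sep_poly D f" "sep_poly E g" shows "sep_poly (D + E) (\<lambda>y. f y * g y)"
  unfolding sep_poly_def
proof (intro allI)
  fix y b
  obtain p q where "degree p \<le> D" "degree q \<le> E" "\<forall>z. f (y(b := z)) = poly p z" "\<forall>z. g (y(b := z)) = poly q z"
    using assms unfolding sep_poly_def by meson
  then show "\<exists>p. degree p \<le> D + E \<and> (\<forall>z. f (y(b := z)) * g (y(b := z)) = poly p z)"
    by (intro exI[of _ "p * q"]) (auto intro: order.trans[OF degree_mult_le])
qed

lemma sep_poly_sum: "(\<And>a. a \<in> S \<Longrightarrow> sep_poly D (f a)) \<Longrightarrow> sep_poly D (\<lambda>y. \<Sum>a\<in>S. f a y)"
  by (induction S rule: infinite_finite_induct) (auto intro: sep_poly_const sep_poly_add)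

lemma sep_poly_prod:
  "(\<And>a. a \<in> S \<Longrightarrow> sep_poly (E a) (f a)) \<Longrightarrow> sep_poly (\<Sum>a\<in>S. E a) (\<lambda>y. \<Prod>a\<in>S. f a y)"
  by (induction S rule: infinite_finite_induct) (auto intro: sep_poly_const sep_poly_mult)

lemma sep_poly_power: "sep_poly D f \<Longrightarrow> sep_poly (D * k) (\<lambda>y. f y ^ k)"
  by (induction k) (auto intro: sep_poly_const sep_poly_mult)

lemma sep_poly_cmult: "sep_poly D f \<Longrightarrow> sep_poly D (\<lambda>y. c * f y)"
  using sep_poly_mult[OF sep_poly_const[of 0 c]] by force

text \<open>One variable at a time: a polynomial of degree at most \<open>D\<close> with
  \<open>D + 1\<close> zeros is zero. \<open>y0\<close> freezes the variables outside
  \<open>B\<close>, which the induction on \<open>B\<close> needs.\<close>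

lemma sep_poly_vanishes:
  assumes "finite B" "sep_poly D g"
    and "\<And>y. (\<forall>b\<in>B. y b \<in> of_nat ` {..D}) \<Longrightarrow> (\<forall>b. b \<notin> B \<longrightarrow> y b = y0 b) \<Longrightarrow> g y = 0"
    and "\<forall>b. b \<notin> B \<longrightarrow> y b = y0 b"
  shows "g y = 0"
  using assms
proof (induction B arbitrary: y y0 rule: finite_induct)
  case empty
  then show ?case by auto
next
  case (insert b B)
  obtain p where p: "degree p \<le> D" "\<And>z. g (y(b := z)) = poly p z"
    using insert.prems(1) unfolding sep_poly_def by meson
  have "poly p z = 0" if z: "z \<in> of_nat ` {..D}" for z
  proof -
    have "g (y(b := z)) = 0"
    proof (rule insert.IH[where ?y0.0 = "y0(b := z)"])
      show "g y = 0" if "\<forall>b\<in>B. y b \<in> of_nat ` {..D}" "\<forall>b'. b' \<notin> B \<longrightarrow> y b' = (y0(b := z)) b'" for y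
        using that z insert.hyps by (intro insert.prems(2)) auto
    qed (use insert.prems in auto)
    then show ?thesis using p by simp
  qed
  then have sub: "of_nat ` {..D} \<subseteq> {z. poly p z = 0}" by blast
  have "p = 0"
  proof (rule ccontr)
    assume "p \<noteq> 0"
    then have "card (of_nat ` {..D} :: complex set) \<le> degree p"
      using card_mono[OF poly_roots_finite sub] card_poly_roots_bound[of p] by linarith
    moreover have "card (of_nat ` {..D} :: complex set) = D + 1"
      by (subst card_image) (auto simp: inj_on_def)
    ultimately show False using p by linarith
  qed
  then show ?case using p(2)[of "y b"] by simp
qed

lemma sep_poly_form:
  assumes "form m F" "\<And>i. sep_poly D (\<lambda>y. \<psi> y $ i)"
  shows "sep_poly (D * m) (\<lambda>y. F (\<psi> y))"
proof -
  obtain f where f: "homogeneous_of_degree m f" "F = poly_eval f" using assms by (auto simp: form_def)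
  have "sep_poly (D * m) (\<lambda>y. monom_eval k (\<psi> y))" if "k \<in> Poly_Mapping.keys f" for k
  proof -
    have "sep_poly (\<Sum>i\<in>UNIV. D * Poly_Mapping.lookup k i) (\<lambda>y. monom_eval k (\<psi> y))"
      unfolding monom_eval_def by (intro sep_poly_prod sep_poly_power assms)
    then show ?thesis using f that by (simp add: homogeneous_of_degree_def flip: sum_distrib_left)
  qed
  then show ?thesis unfolding f(2) poly_eval_def by (intro sep_poly_sum sep_poly_cmult)
qed

text \<open>Pullbacks of forms of degree \<open>m\<close> are determined by their values on
  \<open>(D * m + 1) ^ card B\<close> grid points. More forms than points admit a nontrivial
  combination that vanishes on the grid, hence on the image of \<open>\<psi>\<close> and on its cone
  closure.\<close>

lemma independent_forms_bound:
  fixes \<psi> :: "('v \<Rightarrow> complex) \<Rightarrow> complex ^ 'i::finite"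
  assumes "finite B" "\<And>i. sep_poly D (\<lambda>y. \<psi> y $ i)"
    and "S \<subseteq> cone_closure (\<psi> ` {y. \<forall>b. b \<notin> B \<longrightarrow> y b = 0})" "independent_forms S m K"
  shows "K \<le> (D * m + 1) ^ card B"
proof (rule ccontr)
  assume "\<not> ?thesis"
  then have K: "(D * m + 1) ^ card B < K" by simp
  obtain F where F: "\<And>a. a < K \<Longrightarrow> form m (F a)"
    and ind: "\<And>c a. \<forall>x\<in>S. (\<Sum>a<K. c a * F a x) = 0 \<Longrightarrow> a < K \<Longrightarrow> c a = 0"
    using assms(4) unfolding independent_forms_def by blast
  define grid where "grid = {y :: 'v \<Rightarrow> complex. (\<forall>b\<in>B. y b \<in> of_nat ` {..D * m}) \<and> (\<forall>b. b \<notin> B \<longrightarrow> y b = 0)}"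
  let ?P = "B \<rightarrow>\<^sub>E {..D * m}"
  have "grid \<subseteq> (\<lambda>\<alpha> b. if b \<in> B then of_nat (\<alpha> b) else 0) ` ?P"
  proof
    fix y assume y: "y \<in> grid"
    then have "\<forall>b\<in>B. \<exists>k. k \<le> D * m \<and> y b = of_nat k" by (auto simp: grid_def)
    then obtain k where k: "\<forall>b\<in>B. k b \<le> D * m \<and> y b = of_nat (k b)" by metis
    then have "restrict k B \<in> ?P" by auto
    moreover have "y = (\<lambda>b. if b \<in> B then of_nat (restrict k B b) else 0)"
      using k y by (auto simp: grid_def)
    ultimately show "y \<in> (\<lambda>\<alpha> b. if b \<in> B then of_nat (\<alpha> b) else 0) ` ?P" by blast
  qed
  moreover have finP: "finite ?P" using assms by (intro finite_PiE) auto
  ultimately have "finite grid" "card grid \<le> card ?P"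
    by (auto intro: finite_subset order.trans[OF card_mono card_image_le])
  moreover have "card ?P = (D * m + 1) ^ card B"
    using assms(1) by (simp add: card_PiE)
  ultimately have "finite grid" "card grid < card {..<K}" using K by auto
  from underdetermined_system[OF this, of "\<lambda>y a. F a (\<psi> y)"] obtain c where
    c: "\<exists>a<K. c a \<noteq> 0" "\<forall>y\<in>grid. (\<Sum>a<K. c a * F a (\<psi> y)) = 0" by auto
  have zero: "(\<Sum>a<K. c a * F a (\<psi> y)) = 0" if "\<forall>b. b \<notin> B \<longrightarrow> y b = 0" for y
  proof (rule sep_poly_vanishes[where g = "\<lambda>y. \<Sum>a<K. c a * F a (\<psi> y)" and ?y0.0 = "\<lambda>_. 0" and B = B and D = "D * m"])
    show "sep_poly (D * m) (\<lambda>y. \<Sum>a<K. c a * F a (\<psi> y))"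
      using F by (intro sep_poly_sum sep_poly_cmult sep_poly_form assms) auto
  qed (use that c assms(1) in \<open>auto simp: grid_def\<close>)
  have "(\<Sum>a<K. c a * F a x) = 0" if "x \<in> S" for x
  proof (rule cone_closureD[of _ _ m])
    show "form m (\<lambda>x. \<Sum>a<K. c a * F a x)" using F by (intro form_sum form_cmult) auto
  qed (use that assms(3) zero in auto)
  then show False using ind c(1) by blast
qed

lemma binomial_exceeds_power:
  assumes "N < k"
  shows "\<exists>j. (C * j + 1) ^ N < (j + k choose k :: nat)"
proof -
  \<comment> \<open>The factor \<open>(C + 1) ^ N\<close> bounds the left side by a multiple of
    \<open>J ^ N\<close>, and \<open>k ^ k\<close> is the loss in the estimate of the binomial
    coefficient by \<open>((J + k) / k) ^ k\<close>.\<close>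
  define J where "J = (C + 1) ^ N * k ^ k + 1"
  have J: "1 \<le> J" by (simp add: J_def)
  have k0: "0 < k" using assms by simp
  have "(C * J + 1) ^ N \<le> ((C + 1) * J) ^ N" using J by (intro power_mono) auto
  also have "\<dots> = (C + 1) ^ N * J ^ N" by (rule power_mult_distrib)
  finally have "(C * J + 1) ^ N * k ^ k \<le> (C + 1) ^ N * k ^ k * J ^ N" by (simp add: mult_ac)
  also have "\<dots> < J * J ^ N" using J by (intro mult_strict_right_mono) (auto simp: J_def)
  also have "\<dots> = J ^ Suc N" by simp
  also have "\<dots> \<le> J ^ k" using J assms by (intro power_increasing) auto
  also have "\<dots> \<le> (J + k) ^ k" by (intro power_mono) auto
  finally have lt: "(C * J + 1) ^ N * k ^ k < (J + k) ^ k" .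
  have "(real (J + k) / real k) ^ k \<le> real (J + k choose k)"
    using binomial_ge_n_over_k_pow_k[of k "J + k", where ?'a = real] by simp
  then have "real (J + k) ^ k \<le> real (J + k choose k) * real k ^ k"
    using k0 by (simp add: power_divide field_simps)
  then have "(J + k) ^ k \<le> (J + k choose k) * k ^ k"
    by (metis of_nat_le_iff of_nat_mult of_nat_power)
  with lt have "(C * J + 1) ^ N * k ^ k < (J + k choose k) * k ^ k" by linarith
  then show ?thesis by auto
qed

section \<open>Upper bounds for the Krull dimension\<close>

lemma closed_cone_separation:
  assumes "closedin zariski Z0" "p \<in> proj_space" "p \<notin> Z0"
  shows "\<exists>d F. form d F \<and> (\<forall>x\<in>\<Union>Z0. F x = 0) \<and> (\<exists>x\<in>p. F x \<noteq> 0)"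
proof -
  obtain E where E: "\<forall>f\<in>E. homogeneous f" "Z0 = zero_locus E"
    using assms(1) by (auto simp: closedin_zariski)
  then obtain f where f: "f \<in> E" "\<exists>x\<in>p. poly_eval f x \<noteq> 0"
    using assms by (auto simp: zero_locus_def)
  then have "\<forall>x\<in>\<Union>Z0. poly_eval f x = 0" using E by (auto simp: zero_locus_def)
  moreover obtain d where "form d (poly_eval f)" using f E form_homogeneous by blast
  ultimately show ?thesis using f by blast
qed

lemma prime_cone_irreducible:
  assumes "irreducible_in (subtopology zariski Y) Z"
  shows "prime_cone (\<Union>Z)"
  unfolding prime_cone_def
proof (intro allI impI, elim conjE)
  fix d e F G
  assume F: "form d F" and G: "form e G" and FG: "\<forall>x\<in>\<Union>Z. F x * G x = 0"
  obtain f where f: "homogeneous f" "F = poly_eval f" using F form_homogeneous by metis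
  obtain g where g: "homogeneous g" "G = poly_eval g" using G form_homogeneous by metis
  have Z: "Z \<subseteq> topspace zariski \<inter> Y" using assms by (auto simp: irreducible_in_def)
  have cl: "closedin (subtopology zariski Y) (zero_locus {h} \<inter> Y)" if "homogeneous h" for h
    using that unfolding closedin_subtopology closedin_zariski
    by (intro exI[of _ "zero_locus {h}"] conjI refl exI[of _ "{h}"]) auto
  have "Z \<subseteq> (zero_locus {f} \<inter> Y) \<union> (zero_locus {g} \<inter> Y)"
  proof
    fix p assume p: "p \<in> Z"
    then have "p \<in> proj_space" using Z by (auto simp: topspace_zariski)
    then obtain x where x: "x \<noteq> 0" "p = vec.span {x}" by (rule proj_spaceE)
    have "x \<in> p" using x by (simp add: vec.span_base)
    then have "F x = 0 \<or> G x = 0" using FG p by (metis UnionI mult_eq_0_iff)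
    then show "p \<in> (zero_locus {f} \<inter> Y) \<union> (zero_locus {g} \<inter> Y)"
      using p Z x f g by (auto simp: zero_locus_span)
  qed
  then have "Z \<subseteq> zero_locus {f} \<inter> Y \<or> Z \<subseteq> zero_locus {g} \<inter> Y"
    using assms cl[OF f(1)] cl[OF g(1)] unfolding irreducible_in_def by blast
  then show "(\<forall>x\<in>\<Union>Z. F x = 0) \<or> (\<forall>x\<in>\<Union>Z. G x = 0)"
    using f g by (auto simp: zero_locus_def)
qed

text \<open>The chain forces the Hilbert function of the top cone to grow at least like
  \<open>j ^ k\<close>, while the parametrization allows only order
  \<open>j ^ card B\<close>.\<close>

lemma chain_length_bound:
  fixes Z :: "nat \<Rightarrow> (complex ^ 'i::finite) set set" and \<psi> :: "('v \<Rightarrow> complex) \<Rightarrow> complex ^ 'i"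
  assumes Z: "\<And>i. i \<le> k \<Longrightarrow> closedin zariski (Z i) \<and> irreducible_in (subtopology zariski Y) (Z i)"
    and strict: "\<And>i. i < k \<Longrightarrow> Z i \<subset> Z (Suc i)"
    and \<psi>: "finite B" "\<And>i. sep_poly D (\<lambda>y. \<psi> y $ i)"
    and sub: "\<Union>(Z k) \<subseteq> cone_closure (\<psi> ` {y. \<forall>b. b \<notin> B \<longrightarrow> y b = 0})"
  shows "k \<le> card B"
proof (rule ccontr)
  assume "\<not> k \<le> card B"
  have ne: "\<exists>p\<in>Z i. p \<in> proj_space" if "i \<le> k" for i
    using Z[OF that] by (auto simp: irreducible_in_def topspace_zariski)
  have zero_in: "0 \<in> \<Union>(Z i)" if "i \<le> k" for i
    using ne[OF that] by (auto elim!: proj_spaceE intro: vec.span_zero)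
  have "\<exists>d F. d > 0 \<and> form d F \<and> (\<forall>x\<in>\<Union>(Z i). F x = 0) \<and> (\<exists>x\<in>\<Union>(Z (Suc i)). F x \<noteq> 0)"
    if i: "i < k" for i
  proof -
    obtain p where p: "p \<in> Z (Suc i)" "p \<notin> Z i" using strict[OF i] by blast
    have "p \<in> proj_space" using p Z[of "Suc i"] i by (auto simp: irreducible_in_def topspace_zariski)
    then obtain d F x where F: "form d F" "\<forall>x\<in>\<Union>(Z i). F x = 0" "x \<in> p" "F x \<noteq> 0"
      using closed_cone_separation[of "Z i" p] p Z[of i] i by auto
    \<comment> \<open>A form of degree 0 is constant, and this one vanishes at 0, which every
      nonempty cone contains. Positive degrees are needed for the common degree below.\<close>
    have "d \<noteq> 0"
    proof
      assume "d = 0"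
      then have "F 0 = F x" using form_scale[OF F(1), of 0 x] by simp
      moreover have "F 0 = 0" using F(2) zero_in[OF less_imp_le[OF i]] by blast
      ultimately show False using F(4) by simp
    qed
    then show ?thesis using F p by blast
  qed
  then obtain e F where eF: "\<And>i. i < k \<Longrightarrow> e i > 0 \<and> form (e i) (F i) \<and> (\<forall>x\<in>\<Union>(Z i). F i x = 0)
      \<and> (\<exists>x\<in>\<Union>(Z (Suc i)). F i x \<noteq> 0)"
    by metis
  \<comment> \<open>The separating forms have different degrees; powers of them have the common
    degree \<open>d\<close> and the same zeros.\<close>
  define d where "d = (\<Prod>i<k. e i)"
  obtain x where x: "x \<in> \<Union>(Z 0)" "x \<noteq> 0"
  proof -
    obtain p where p: "p \<in> Z 0" "p \<in> proj_space" using ne[of 0] by auto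
    from p(2) obtain x where "x \<noteq> 0" "p = vec.span {x}" by (rule proj_spaceE)
    then show ?thesis using that p vec.span_base[of x "{x}"] by auto
  qed
  then obtain l where l: "x $ l \<noteq> 0" by (auto simp: vec_eq_iff)
  have "independent_forms (\<Union>(Z k)) (d * j) ((j + k) choose k)" for j
  proof (rule independent_forms_chain[where Z = "\<lambda>i. \<Union>(Z i)"])
    show "prime_cone (\<Union>(Z i))" if "i \<le> k" for i using Z[OF that] prime_cone_irreducible by blast
    show "\<Union>(Z i) \<subseteq> \<Union>(Z (Suc i))" if "i < k" for i using strict[OF that] by blast
    show "\<exists>f. form d f \<and> (\<forall>x\<in>\<Union>(Z i). f x = 0) \<and> (\<exists>x\<in>\<Union>(Z (Suc i)). f x \<noteq> 0)" if i: "i < k" for i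
    proof -
      have "e i dvd d" using i by (auto simp: d_def)
      then obtain q where q: "d = e i * q" by blast
      have "d > 0" using eF by (auto simp: d_def intro: prod_pos)
      then have "q > 0" using q by simp
      then show ?thesis using eF[OF i] form_power[of "e i" "F i" q]
        by (intro exI[of _ "\<lambda>x. F i x ^ q"]) (auto simp: q)
    qed
    show "x \<in> \<Union>(Z 0)" by (rule x)
    show "form d (\<lambda>x. (x $ l) ^ d)" using form_power[OF form_coord, of d l] by simp
    show "(x $ l) ^ d \<noteq> 0" using l by simp
  qed
  from independent_forms_bound[OF \<psi> sub this]
  have "(j + k choose k) \<le> (D * d * j + 1) ^ card B" for j by (simp add: mult.assoc)
  moreover obtain j where "(D * d * j + 1) ^ card B < (j + k choose k)"
    using binomial_exceeds_power[of "card B" k "D * d"] \<open>\<not> k \<le> card B\<close> by auto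
  ultimately show False by (meson leD)
qed

lemma proj_dim_le:
  fixes Y :: "(complex ^ 'i::finite) set set" and \<psi> :: "('v \<Rightarrow> complex) \<Rightarrow> complex ^ 'i"
  assumes Y: "closedin zariski Y"
    and \<psi>: "finite B" "\<And>i. sep_poly D (\<lambda>y. \<psi> y $ i)"
    and sub: "\<Union>Y \<subseteq> cone_closure (\<psi> ` {y. \<forall>b. b \<notin> B \<longrightarrow> y b = 0})"
  shows "proj_dim Y \<le> enat (card B)"
  unfolding proj_dim_def krull_dim_def
proof (rule Sup_least, clarify)
  fix k and Z :: "nat \<Rightarrow> (complex ^ 'i) set set"
  assume Z: "\<forall>i\<le>k. closedin (subtopology zariski Y) (Z i) \<and> irreducible_in (subtopology zariski Y) (Z i)"
    and strict: "\<forall>i<k. Z i \<subset> Z (Suc i)"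
  have "k \<le> card B"
  proof (rule chain_length_bound[OF _ _ \<psi>])
    show "closedin zariski (Z i) \<and> irreducible_in (subtopology zariski Y) (Z i)" if "i \<le> k" for i
      using Z that closedin_closed_subtopology[OF Y] by auto
    show "\<Union>(Z k) \<subseteq> cone_closure (\<psi> ` {y. \<forall>b. b \<notin> B \<longrightarrow> y b = 0})"
    proof -
      have "Z k \<subseteq> Y" using Z closedin_closed_subtopology[OF Y] by blast
      then show ?thesis using sub by blast
    qed
  qed (use strict in blast)
  then show "enat k \<le> enat (card B)" by simp
qed


text \<open>Restriction to polynomial curves reduces density and irreducibility questions to the
  finiteness of the zeros of a nonzero univariate polynomial.\<close>

lemma form_curve:
  assumes "form d F" shows "\<exists>p. \<forall>\<tau>. F (\<chi> i. poly (\<gamma> i) \<tau>) = poly p \<tau>"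
proof -
  obtain f where f: "F = poly_eval f" using assms by (auto simp: form_def)
  show ?thesis
    by (intro exI[of _ "\<Sum>m\<in>Poly_Mapping.keys f. smult (Poly_Mapping.lookup f m)
        (\<Prod>i\<in>UNIV. \<gamma> i ^ Poly_Mapping.lookup m i)"])
      (simp add: f poly_eval_def monom_eval_def poly_sum poly_prod)
qed

lemma poly_zero_cofinite:
  fixes p :: "complex poly"
  assumes "finite {\<tau>. poly p \<tau> \<noteq> 0}" shows "p = 0"
proof (rule ccontr)
  assume "p \<noteq> 0"
  then have "finite ({\<tau>. poly p \<tau> = 0} \<union> {\<tau>. poly p \<tau> \<noteq> 0})"
    using assms poly_roots_finite by blast
  moreover have "{\<tau>. poly p \<tau> = 0} \<union> {\<tau>. poly p \<tau> \<noteq> 0} = UNIV" by blast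
  ultimately show False using infinite_UNIV_char_0[where ?'a = complex] by simp
qed

text \<open>The affine chart where coordinate \<open>l\<close> equals 1 has \<open>s\<close>
  parameters, and the cone over it is dense.\<close>

lemma proj_dim_le_ambient:
  fixes Y :: "(complex ^ 'i::finite) set set"
  assumes "closedin zariski Y" "CARD('i) = s + 1"
  shows "proj_dim Y \<le> enat s"
proof -
  fix l :: 'i
  define \<psi> :: "('i \<Rightarrow> complex) \<Rightarrow> complex ^ 'i" where "\<psi> y = (\<chi> i. if i = l then 1 else y i)" for y
  let ?S = "\<psi> ` {y. \<forall>b. b \<notin> - {l} \<longrightarrow> y b = 0}"
  have in_S: "x \<in> ?S" if "x $ l = 1" for x
    using that by (intro image_eqI[of _ _ "\<lambda>i. if i = l then 0 else x $ i"]) (auto simp: \<psi>_def vec_eq_iff)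
  have "x \<in> cone_closure ?S" for x
    unfolding cone_closure_def
  proof (intro CollectI allI impI, elim conjE)
    fix d F assume F: "form d F" and F0: "\<forall>y\<in>?S. F y = 0"
    have nz: "F x = 0" if "x $ l \<noteq> 0" for x
    proof -
      have "F (inverse (x $ l) *s x) = 0" using that by (intro F0[rule_format] in_S) simp
      then show ?thesis using form_scale[OF F] that by simp
    qed
    \<comment> \<open>A point with vanishing coordinate \<open>l\<close> is approached along the
      line that moves only this coordinate.\<close>
    obtain p where p: "\<And>\<tau>. F (\<chi> i. poly (if i = l then [:x $ l, 1:] else [:x $ i:]) \<tau>) = poly p \<tau>"
      using form_curve[OF F, of "\<lambda>i. if i = l then [:x $ l, 1:] else [:x $ i:]"] by blast
    have "{\<tau>. poly p \<tau> \<noteq> 0} \<subseteq> {- (x $ l)}"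
    proof
      fix \<tau> assume "\<tau> \<in> {\<tau>. poly p \<tau> \<noteq> 0}"
      then have "F (\<chi> i. poly (if i = l then [:x $ l, 1:] else [:x $ i:]) \<tau>) \<noteq> 0" using p by simp
      then have "x $ l + \<tau> = 0"
        using nz[of "\<chi> i. poly (if i = l then [:x $ l, 1:] else [:x $ i:]) \<tau>"] by auto
      then show "\<tau> \<in> {- (x $ l)}" by (simp add: add_eq_0_iff2)
    qed
    then have "p = 0" using poly_zero_cofinite finite_subset by blast
    moreover have "(\<chi> i. poly (if i = l then [:x $ l, 1:] else [:x $ i:]) 0) = x"
      by (simp add: vec_eq_iff)
    ultimately show "F x = 0" using p[of 0] by simp
  qed
  moreover have "sep_poly 1 (\<lambda>y. \<psi> y $ i)" for i
    using sep_poly_var[of i] by (cases "i = l") (simp_all add: \<psi>_def sep_poly_const)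
  ultimately have "proj_dim Y \<le> enat (card (- {l}))"
    by (intro proj_dim_le[of Y "- {l}" 1 \<psi>] assms) auto
  then show ?thesis using assms by (simp add: Compl_eq_Diff_UNIV)
qed

section \<open>Chains of irreducible closed sets\<close>

text \<open>Along a curve from a point where \<open>F\<close> is nonzero to one where
  \<open>G\<close> is nonzero, both pull back to nonzero univariate polynomials, whose product
  cannot vanish for almost all parameters.\<close>

lemma prime_cone_curves:
  assumes "\<And>a b. a \<in> S \<Longrightarrow> b \<in> S \<Longrightarrow> \<exists>\<gamma>. (\<chi> i. poly (\<gamma> i) 0) = a \<and> (\<chi> i. poly (\<gamma> i) 1) = b \<and>
    finite {\<tau>. (\<chi> i. poly (\<gamma> i) \<tau>) \<notin> S}"
  shows "prime_cone S"
  unfolding prime_cone_def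
proof (intro allI impI, elim conjE, rule ccontr)
  fix d e F G
  assume F: "form d F" and G: "form e G" and FG: "\<forall>x\<in>S. F x * G x = 0"
    and "\<not> ((\<forall>x\<in>S. F x = 0) \<or> (\<forall>x\<in>S. G x = 0))"
  then obtain a b where a: "a \<in> S" "F a \<noteq> 0" and b: "b \<in> S" "G b \<noteq> 0" by blast
  obtain \<gamma> where \<gamma>: "(\<chi> i. poly (\<gamma> i) 0) = a" "(\<chi> i. poly (\<gamma> i) 1) = b"
    "finite {\<tau>. (\<chi> i. poly (\<gamma> i) \<tau>) \<notin> S}"
    using assms[OF a(1) b(1)] by blast
  obtain p where p: "\<And>\<tau>. F (\<chi> i. poly (\<gamma> i) \<tau>) = poly p \<tau>" using form_curve[OF F] by blast
  obtain q where q: "\<And>\<tau>. G (\<chi> i. poly (\<gamma> i) \<tau>) = poly q \<tau>" using form_curve[OF G] by blast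
  have "{\<tau>. poly (p * q) \<tau> \<noteq> 0} \<subseteq> {\<tau>. (\<chi> i. poly (\<gamma> i) \<tau>) \<notin> S}"
    using FG by (auto simp flip: p q)
  then have "p * q = 0" using \<gamma>(3) poly_zero_cofinite finite_subset by blast
  moreover have "p \<noteq> 0" using p[of 0] \<gamma> a by auto
  moreover have "q \<noteq> 0" using q[of 1] \<gamma> b by auto
  ultimately show False by simp
qed

lemma irreducible_closure:
  assumes "0 \<notin> S" "S \<noteq> {}" "prime_cone S" "zariski closure_of spans S \<subseteq> Y"
  shows "irreducible_in (subtopology zariski Y) (zariski closure_of spans S)"
  unfolding irreducible_in_def
proof (intro conjI allI impI)
  let ?Z = "zariski closure_of spans S"
  have SZ: "spans S \<subseteq> ?Z"
    using closure_of_subset[of "spans S" zariski] spans_subset_proj_space[OF assms(1)]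
    by (simp add: topspace_zariski)
  then show "?Z \<noteq> {}" using assms(2) by blast
  show "?Z \<subseteq> topspace (subtopology zariski Y)"
    using assms(4) zariski_closure_subset_proj_space[of "spans S"] by (simp add: topspace_zariski)
  fix C D
  assume CD: "closedin (subtopology zariski Y) C \<and> closedin (subtopology zariski Y) D \<and> ?Z \<subseteq> C \<union> D"
  then obtain C' D' where C': "closedin zariski C'" "C = C' \<inter> Y" and D': "closedin zariski D'" "D = D' \<inter> Y"
    by (auto simp: closedin_subtopology)
  show "?Z \<subseteq> C \<or> ?Z \<subseteq> D"
  proof (rule ccontr)
    assume "\<not> ?thesis"
    then have "\<not> spans S \<subseteq> C'" "\<not> spans S \<subseteq> D'"
      using closure_of_minimal[of "spans S" _ zariski] C' D' assms(4) by blast+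
    then obtain a b where a: "a \<in> S" "vec.span {a} \<notin> C'" and b: "b \<in> S" "vec.span {b} \<notin> D'" by blast
    have ab: "vec.span {a} \<in> proj_space" "vec.span {b} \<in> proj_space"
      using a b spans_subset_proj_space[OF assms(1)] by auto
    obtain d F x where F: "form d F" "\<forall>x\<in>\<Union>C'. F x = 0" "x \<in> vec.span {a}" "F x \<noteq> 0"
      using closed_cone_separation[OF C'(1) ab(1) a(2)] by blast
    obtain e G y where G: "form e G" "\<forall>x\<in>\<Union>D'. G x = 0" "y \<in> vec.span {b}" "G y \<noteq> 0"
      using closed_cone_separation[OF D'(1) ab(2) b(2)] by blast
    have "F z * G z = 0" if z: "z \<in> S" for z
    proof -
      have "vec.span {z} \<in> C \<union> D" using SZ CD z by blast
      then show ?thesis using F(2) G(2) vec.span_base[of z "{z}"] C'(2) D'(2) by auto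
    qed
    then consider "\<forall>z\<in>S. F z = 0" | "\<forall>z\<in>S. G z = 0"
      using assms(3) F(1) G(1) unfolding prime_cone_def by blast
    then show False
    proof cases
      case 1
      moreover obtain c where "x = c *s a" using F(3) by (auto simp: vec.span_singleton)
      ultimately show False using form_scale[OF F(1)] F(4) a(1) by simp
    next
      case 2
      moreover obtain c where "y = c *s b" using G(3) by (auto simp: vec.span_singleton)
      ultimately show False using form_scale[OF G(1)] G(4) b(1) by simp
    qed
  qed
qed

text \<open>If two consecutive closures agreed, \<open>S (Suc j)\<close> would lie in the closure of
  a family with \<open>j\<close> parameters and yet carry \<open>q ^ (j + 1)\<close> independent
  forms of degree \<open>(j + 1) * q\<close>, for every \<open>q\<close>.\<close>

lemma proj_dim_ge:
  fixes Y :: "(complex ^ 'i::finite) set set" and \<psi> :: "(nat \<Rightarrow> complex) \<Rightarrow> complex ^ 'i"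
  assumes Y: "closedin zariski Y"
    and \<psi>: "\<And>i. sep_poly D (\<lambda>y. \<psi> y $ i)"
    and S: "\<And>j. 0 \<notin> S j" "\<And>j. S j \<noteq> {}" "\<And>j. S j \<subseteq> S (Suc j)" "\<And>j. prime_cone (S j)"
      "\<And>j. S j \<subseteq> \<psi> ` {y. \<forall>b\<ge>j. y b = 0}" "\<And>j. spans (S j) \<subseteq> Y"
    and ind: "\<And>j q. j \<le> r \<Longrightarrow> 0 < q \<Longrightarrow> independent_forms (S j) (j * q) (q ^ j)"
  shows "enat r \<le> proj_dim Y"
proof -
  define Z where "Z j = zariski closure_of spans (S j)" for j
  have "closedin (subtopology zariski Y) (Z j) \<and> irreducible_in (subtopology zariski Y) (Z j)" for j
  proof -
    have "Z j \<subseteq> Y" unfolding Z_def using S(6) Y by (rule closure_of_minimal)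
    then show ?thesis
      unfolding Z_def
      using irreducible_closure[OF S(1,2,4)] closedin_closed_subtopology[OF Y] by simp
  qed
  moreover have "Z j \<subset> Z (Suc j)" if j: "j < r" for j
  proof
    show "Z j \<subseteq> Z (Suc j)" unfolding Z_def using S(3) by (intro closure_of_mono) auto
    show "Z j \<noteq> Z (Suc j)"
    proof
      assume eq: "Z j = Z (Suc j)"
      \<comment> \<open>Chosen so that \<open>((D * Suc j + 1) * q) ^ j < q ^ Suc j\<close>.\<close>
      define q where "q = (D * Suc j + 1) ^ j + 1"
      have q: "0 < q" by (simp add: q_def)
      have "S (Suc j) \<subseteq> cone_closure (S j)"
      proof
        fix x assume x: "x \<in> S (Suc j)"
        then have "vec.span {x} \<in> Z (Suc j)"
          unfolding Z_def using closure_of_subset[of "spans (S (Suc j))" zariski]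
            spans_subset_proj_space[OF S(1)[of "Suc j"]] by (auto simp: topspace_zariski)
        moreover have "x \<noteq> 0" using x S(1) by blast
        ultimately show "x \<in> cone_closure (S j)"
          using zariski_closure_iff[OF S(1)] eq unfolding Z_def by blast
      qed
      also have "cone_closure (S j) \<subseteq> cone_closure (\<psi> ` {y. \<forall>b. b \<notin> {..<j} \<longrightarrow> y b = 0})"
        using S(5)[of j] by (intro cone_closure_mono order.trans[OF _ cone_closure_superset]) (auto simp: not_less)
      finally have "q ^ Suc j \<le> (D * (Suc j * q) + 1) ^ card {..<j}"
        using ind[of "Suc j" q] q j by (intro independent_forms_bound[OF _ \<psi>]) auto
      also have "\<dots> \<le> ((D * Suc j + 1) * q) ^ j"
        using q by (auto intro!: power_mono simp: algebra_simps)
      also have "\<dots> = (D * Suc j + 1) ^ j * q ^ j" by (rule power_mult_distrib)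
      also have "\<dots> < q * q ^ j" using q by (intro mult_strict_right_mono) (auto simp: q_def)
      finally show False by simp
    qed
  qed
  ultimately show ?thesis
    unfolding proj_dim_def krull_dim_def by (intro Sup_upper) blast
qed

section \<open>Secant varieties\<close>

inductive form_sum_closure :: "(complex ^ 'i::finite \<Rightarrow> complex) \<Rightarrow> bool" where
  form: "form d F \<Longrightarrow> form_sum_closure F"
| add: "form_sum_closure F \<Longrightarrow> form_sum_closure G \<Longrightarrow> form_sum_closure (\<lambda>x. F x + G x)"

lemma form_sum_closure_mult:
  assumes "form_sum_closure F" "form_sum_closure G" shows "form_sum_closure (\<lambda>x. F x * G x)"
  using assms
proof (induction F rule: form_sum_closure.induct)
  case (form d F)
  from form(2,1) show ?case
  proof (induction G rule: form_sum_closure.induct)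
    case (form e G)
    then show ?case by (blast intro: form_sum_closure.form form_mult)
  next
    case (add G H)
    then show ?case by (simp add: distrib_left form_sum_closure.add)
  qed
next
  case (add F H)
  then show ?case by (simp add: distrib_right form_sum_closure.add)
qed

lemma form_sum_closure_sum:
  "(\<And>a. a \<in> S \<Longrightarrow> form_sum_closure (F a)) \<Longrightarrow> form_sum_closure (\<lambda>x. \<Sum>a\<in>S. F a x)"
  by (induction S rule: infinite_finite_induct)
    (auto intro: form_sum_closure.intros form_zero)

lemma form_sum_closure_prod:
  "(\<And>a. a \<in> S \<Longrightarrow> form_sum_closure (F a)) \<Longrightarrow> form_sum_closure (\<lambda>x. \<Prod>a\<in>S. F a x)"
  by (induction S rule: infinite_finite_induct)
    (auto intro: form_sum_closure.form form_sum_closure_mult form_const)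

lemma form_sum_closure_power: "form_sum_closure F \<Longrightarrow> form_sum_closure (\<lambda>x. F x ^ k)"
  by (induction k) (auto intro: form_sum_closure.form form_sum_closure_mult form_const)

text \<open>Translating a form destroys homogeneity but leaves a sum of forms; fixing one summand of
  a point of the join is such a translation.\<close>

lemma form_sum_closure_shift:
  assumes "form d F" shows "form_sum_closure (\<lambda>x. F (x + y))"
proof -
  obtain f where f: "F = poly_eval f" using assms by (auto simp: form_def)
  have "form_sum_closure (\<lambda>x. (x + y) $ i)" for i
    using form_sum_closure.add[OF form_sum_closure.form[OF form_coord] form_sum_closure.form[OF form_const]]
    by simp
  then show ?thesis
    unfolding f poly_eval_def monom_eval_def
    by (intro form_sum_closure_sum form_sum_closure_mult form_sum_closure_prod form_sum_closure_power
        form_sum_closure.form[OF form_const])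
qed

lemma form_sum_closure_graded:
  assumes "form_sum_closure F"
  shows "\<exists>D H. (\<forall>e. form e (H e)) \<and> (\<forall>e>D. H e = (\<lambda>x. 0)) \<and> (\<forall>x. F x = (\<Sum>e\<le>D. H e x))"
  using assms
proof (induction rule: form_sum_closure.induct)
  case (form d F)
  define H where "H e = (if e = d then F else (\<lambda>x. 0))" for e
  have "\<forall>e. form e (H e)" using form by (simp add: H_def form_zero)
  moreover have "F x = (\<Sum>e\<le>d. H e x)" for x
    by (subst sum.remove[of _ d]) (auto simp: H_def intro!: sum.neutral)
  ultimately show ?case by (intro exI[of _ d] exI[of _ H]) (simp add: H_def)
next
  case (add F G)
  then obtain D H E K where H: "\<forall>e. form e (H e)" "\<forall>e>D. H e = (\<lambda>x. 0)" "\<forall>x. F x = (\<Sum>e\<le>D. H e x)"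
    and K: "\<forall>e. form e (K e)" "\<forall>e>E. K e = (\<lambda>x. 0)" "\<forall>x. G x = (\<Sum>e\<le>E. K e x)" by blast
  have "(\<Sum>e\<le>D. H e x) = (\<Sum>e\<le>max D E. H e x)" "(\<Sum>e\<le>E. K e x) = (\<Sum>e\<le>max D E. K e x)" for x
    using H(2) K(2) by (auto intro!: sum.mono_neutral_left) (metis linorder_not_le)+
  then have "\<forall>x. F x + G x = (\<Sum>e\<le>max D E. H e x + K e x)"
    using H(3) K(3) by (simp add: sum.distrib)
  moreover have "\<forall>e. form e (\<lambda>x. H e x + K e x)" using H(1) K(1) by (simp add: form_add)
  moreover have "\<forall>e>max D E. (\<lambda>x. H e x + K e x) = (\<lambda>x. 0)" using H(2) K(2) by simp
  ultimately show ?case by (intro exI[of _ "max D E"] exI[of _ "\<lambda>e x. H e x + K e x"]) blast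
qed

text \<open>For fixed \<open>y\<close>, \<open>F (c *s y)\<close> is a polynomial in
  \<open>c\<close> whose coefficients are the homogeneous components at \<open>y\<close>. Vanishing
  for all nonzero \<open>c\<close> kills each component, and components are forms, so they vanish on
  the cone closure.\<close>

lemma form_sum_closure_vanishes:
  assumes "form_sum_closure F" "\<And>y c. y \<in> S \<Longrightarrow> c \<noteq> 0 \<Longrightarrow> F (c *s y) = 0" "x \<in> cone_closure S"
  shows "F x = 0"
proof -
  obtain D H where H: "\<And>e. form e (H e)" "\<And>x. F x = (\<Sum>e\<le>D. H e x)"
    using form_sum_closure_graded[OF assms(1)] by blast
  have "H e y = 0" if y: "y \<in> S" and e: "e \<le> D" for e y
  proof -
    define p where "p = (\<Sum>e\<le>D. monom (H e y) e)"
    have "poly p c = F (c *s y)" for c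
      by (simp add: p_def poly_sum poly_monom H(2) form_scale[OF H(1)] mult.commute)
    then have "{c. poly p c \<noteq> 0} \<subseteq> {0}" using assms(2) y by auto
    then have "p = 0" using poly_zero_cofinite finite_subset by blast
    moreover have "coeff p e = H e y" using e by (simp add: p_def coeff_sum)
    ultimately show ?thesis by simp
  qed
  then have "H e x = 0" if "e \<le> D" for e using cone_closureD[OF assms(3) H(1)] that by blast
  then show ?thesis by (simp add: H(2))
qed

lemma cone_closure_scale: "x \<in> cone_closure S \<Longrightarrow> c *s x \<in> cone_closure S"
  unfolding cone_closure_def by (auto simp: form_scale[of _ _ c x])

text \<open>The two summands are moved into the closure one at a time, the other one being
  fixed.\<close>

lemma cone_closure_join:
  assumes "x \<in> cone_closure T" "y \<in> cone_closure T"
  shows "x + y \<in> cone_closure {c *s a + b | c a b. a \<in> T \<and> b \<in> T}"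
  unfolding cone_closure_def
proof (intro CollectI allI impI, elim conjE)
  fix d F
  assume F: "form d F" and F0: "\<forall>z\<in>{c *s a + b | c a b. a \<in> T \<and> b \<in> T}. F z = 0"
  \<comment> \<open>Homogeneity of \<open>F\<close> frees the coefficient of the second summand,
    which is 1 in the join.\<close>
  have *: "F (c' *s a + c *s b) = 0" if "a \<in> T" "b \<in> T" "c \<noteq> 0" for a b c c'
  proof -
    have "F (c *s ((c' / c) *s a + b)) = 0"
      using F0 that unfolding form_scale[OF F] by auto
    then show ?thesis using that by (simp add: vec.scale_right_distrib)
  qed
  have **: "F (x + c *s b) = 0" if "b \<in> T" "c \<noteq> 0" for b c
    using form_sum_closure_vanishes[OF form_sum_closure_shift[OF F] _ assms(1)] * that by simp
  have "F (y + x) = 0"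
    using form_sum_closure_vanishes[OF form_sum_closure_shift[OF F] _ assms(2)] ** by (simp add: add.commute)
  then show "F (x + y) = 0" by (simp add: add.commute)
qed

lemma Union_zariski_closure:
  assumes "U \<subseteq> proj_space" "\<Union>U \<subseteq> cone_closure J"
  shows "\<Union>(zariski closure_of U) \<subseteq> cone_closure J"
proof -
  define E where "E = {f. homogeneous f \<and> (\<forall>y\<in>J. poly_eval f y = 0)}"
  have "poly_eval f x = 0" if f: "f \<in> E" and x: "x \<in> cone_closure J" for f x
  proof -
    obtain d where "form d (poly_eval f)"
      using f form_homogeneous[of "poly_eval f"] unfolding E_def by blast
    then show ?thesis using f cone_closureD[OF x, of d "poly_eval f"] unfolding E_def by blast
  qed
  then have "U \<subseteq> zero_locus E" using assms by (auto simp: zero_locus_def)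
  moreover have "closedin zariski (zero_locus E)" unfolding closedin_zariski by (intro exI[of _ E]) (simp add: E_def)
  ultimately have "zariski closure_of U \<subseteq> zero_locus E" by (rule closure_of_minimal)
  moreover have "x \<in> cone_closure J" if "p \<in> zero_locus E" "x \<in> p" for p x
    unfolding cone_closure_def
  proof (intro CollectI allI impI, elim conjE)
    fix d F assume F: "form d F" "\<forall>y\<in>J. F y = 0"
    then obtain f where "homogeneous f" "F = poly_eval f" using form_homogeneous by metis
    then show "F x = 0" using that F by (auto simp: zero_locus_def E_def)
  qed
  ultimately show ?thesis by blast
qed

lemma Union_closure_spans:
  assumes "0 \<notin> T"
  shows "\<Union>(zariski closure_of spans T) \<subseteq> cone_closure T"
proof (rule Union_zariski_closure)
  show "spans T \<subseteq> proj_space" using assms by (rule spans_subset_proj_space)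
  show "\<Union>(spans T) \<subseteq> cone_closure T"
  proof
    fix x assume "x \<in> \<Union>(spans T)"
    then obtain y where y: "y \<in> T" "x \<in> vec.span {y}" by blast
    then obtain c where "x = c *s y" by (auto simp: vec.span_singleton)
    then show "x \<in> cone_closure T"
      using y(1) cone_closure_superset[of T] cone_closure_scale by blast
  qed
qed

section \<open>Secant lines through pairs of points\<close>

lemma span_scale_eq:
  fixes x :: "complex ^ 'i"
  assumes "c \<noteq> 0" shows "vec.span {c *s x} = vec.span {x}"
proof -
  have "k *s x = (k / c) *s (c *s x)" for k using assms by simp
  then have "range (\<lambda>k. k *s x) \<subseteq> range (\<lambda>k. k *s (c *s x))" by (metis image_subsetI rangeI)
  moreover have "range (\<lambda>k. k *s (c *s x)) \<subseteq> range (\<lambda>k. k *s x)" by auto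
  ultimately show ?thesis unfolding vec.span_singleton by (rule equalityI[rotated])
qed

lemma independent_pair:
  fixes x y :: "complex ^ 'i"
  assumes "x \<noteq> 0" "y \<noteq> 0" "vec.span {x} \<noteq> vec.span {y}"
  shows "vec.independent {x, y}" "x \<noteq> y"
proof -
  have "x \<notin> vec.span {y}"
  proof
    assume "x \<in> vec.span {y}"
    then obtain c where c: "x = c *s y" by (auto simp: vec.span_singleton)
    then have "c \<noteq> 0" using assms by auto
    then show False using assms span_scale_eq c by blast
  qed
  then show "vec.independent {x, y}" "x \<noteq> y"
    using assms by (auto simp: vec.independent_insert vec.span_base)
qed

lemma plane_span:
  fixes x y z :: "complex ^ 'i"
  assumes "vec.subspace W" "vec.dim W = 2" "x \<noteq> 0" "y \<noteq> 0" "vec.span {x} \<noteq> vec.span {y}"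
    "x \<in> W" "y \<in> W" "z \<in> W"
  shows "\<exists>a b. z = a *s x + b *s y"
proof -
  note ind = independent_pair(1)[OF assms(3-5)] and ne = independent_pair(2)[OF assms(3-5)]
  have "W \<subseteq> vec.span {x, y}"
    using vec.card_ge_dim_independent[of "{x, y}" W] ind ne assms by simp
  then have "z \<in> vec.span {x, y}" using assms by blast
  then obtain a where "z - a *s x \<in> vec.span {y}" by (auto simp: vec.span_breakdown_eq)
  then obtain b where "z - a *s x = b *s y" by (auto simp: vec.span_singleton)
  then show ?thesis by (metis add.commute diff_add_cancel)
qed

text \<open>Points of a secant line are combinations of vectors in the cone over the closure, and by
  \<open>cone_closure_join\<close> these stay in the closure of the join of the dense part
  \<open>T\<close>.\<close>

lemma secant_variety_upper:
  assumes "0 \<notin> T"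
  shows "\<Union>(secant_variety (zariski closure_of spans T)) \<subseteq> cone_closure {c *s a + b | c a b. a \<in> T \<and> b \<in> T}"
    (is "_ \<subseteq> ?J")
  unfolding secant_variety_def
proof (rule Union_zariski_closure)
  let ?X = "zariski closure_of spans T"
  let ?U = "\<Union>{l \<in> proj_lines. \<exists>p\<in>l \<inter> ?X. \<exists>q\<in>l \<inter> ?X. p \<noteq> q}"
  show "?U \<subseteq> proj_space" by (auto simp: proj_lines_def)
  show "\<Union>?U \<subseteq> ?J"
  proof
    fix z assume "z \<in> \<Union>?U"
    then obtain r l p q where l: "z \<in> r" "r \<in> l" "l \<in> proj_lines" "p \<in> l" "q \<in> l" "p \<in> ?X" "q \<in> ?X" "p \<noteq> q"
      by blast
    then obtain W where W: "vec.subspace W" "vec.dim W = 2" "l = {p \<in> proj_space. p \<subseteq> W}"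
      by (auto simp: proj_lines_def)
    have "p \<in> proj_space" "q \<in> proj_space" using l W by auto
    then obtain x y where x: "x \<noteq> 0" "p = vec.span {x}" and y: "y \<noteq> 0" "q = vec.span {y}"
      by (metis proj_spaceE)
    have mem: "x \<in> p" "y \<in> q" using x y by (auto intro: vec.span_base)
    then have "x \<in> W" "y \<in> W" "z \<in> W" using l W by auto
    then obtain a b where z: "z = a *s x + b *s y"
      using plane_span[OF W(1,2) x(1) y(1)] l x y by metis
    have "x \<in> cone_closure T" "y \<in> cone_closure T"
      using Union_closure_spans[OF assms] mem l by blast+
    then show "z \<in> ?J"
      unfolding z by (intro cone_closure_join cone_closure_scale)
  qed
qed

lemma secant_variety_lower:
  assumes "vec.span {x} \<in> X" "vec.span {y} \<in> X" "X \<subseteq> proj_space" "x \<noteq> 0" "y \<noteq> 0"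
    "vec.span {x} \<noteq> vec.span {y}" "a *s x + b *s y \<noteq> 0"
  shows "vec.span {a *s x + b *s y} \<in> secant_variety X"
proof -
  let ?U = "\<Union>{l \<in> proj_lines. \<exists>p\<in>l \<inter> X. \<exists>q\<in>l \<inter> X. p \<noteq> q}"
  define W where "W = vec.span {x, y}"
  have W: "vec.dim W = 2" "vec.subspace W"
    using independent_pair[OF assms(4-6)]
    unfolding W_def by (simp_all add: vec.dim_eq_card_independent)
  define l where "l = {p \<in> proj_space. p \<subseteq> W}"
  have xW: "x \<in> W" "y \<in> W" by (auto simp: W_def vec.span_base)
  have sub: "vec.span {v} \<subseteq> W" if "v \<in> W" for v
    using that W by (intro vec.span_minimal) auto
  have "a *s x + b *s y \<in> W" using xW W by (simp add: vec.subspace_add vec.subspace_scale)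
  then have "vec.span {a *s x + b *s y} \<in> l" using assms sub by (auto simp: l_def proj_space_def)
  moreover have "l \<in> proj_lines" using W by (auto simp: proj_lines_def l_def)
  moreover have "vec.span {x} \<in> l \<inter> X" "vec.span {y} \<in> l \<inter> X" using assms sub xW by (auto simp: l_def)
  ultimately have "vec.span {a *s x + b *s y} \<in> ?U" using assms by blast
  moreover have "?U \<subseteq> topspace zariski" by (auto simp: proj_lines_def topspace_zariski)
  ultimately show ?thesis unfolding secant_variety_def using closure_of_subset[of ?U zariski] by blast
qed


section \<open>Secant varieties of toric varieties\<close>

text \<open>Affine functions are encoded by coefficient vectors with \<open>None\<close> for the
  constant term; this is also the column index of each of the two blocks of the
  differential.\<close>

definition aff :: "('n::finite option \<Rightarrow> complex) \<Rightarrow> int ^ 'n \<Rightarrow> complex" where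
  "aff f x = f None + (\<Sum>k\<in>UNIV. f (Some k) * of_int (x $ k))"

definition tvec :: "('i::finite \<Rightarrow> int ^ 'n::finite) \<Rightarrow> complex ^ 'n \<Rightarrow> complex ^ 'i" where
  "tvec u t = (\<chi> i. torus_character (u i) t)"

lemma toric_variety_tvec: "toric_variety u = zariski closure_of spans (tvec u ` torus)"
  by (simp add: toric_variety_def tvec_def image_image)

lemma torus_character_nonzero: "t \<in> torus \<Longrightarrow> torus_character a t \<noteq> 0"
  by (auto simp: torus_character_def torus_def)

lemma tvec_nonzero: "t \<in> torus \<Longrightarrow> tvec u t \<noteq> 0"
  by (auto simp: tvec_def vec_eq_iff torus_character_nonzero)

lemma zero_notin_tvec: "0 \<notin> tvec u ` torus"
  using tvec_nonzero by (metis imageE)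

lemma torus_character_nonneg:
  assumes "\<And>k. 0 \<le> a $ k"
  shows "torus_character a t = (\<Prod>k\<in>UNIV. t $ k ^ nat (a $ k))"
  unfolding torus_character_def using assms by (intro prod.cong) (auto simp: power_int_def)

text \<open>Only one of the two summands carries a coefficient, because the cone closure absorbs a
  common scaling. This leaves \<open>1 + n + n\<close> parameters, the expected projective
  dimension.\<close>

lemma proj_dim_secant_toric_le:
  fixes u :: "'i::finite \<Rightarrow> int ^ 'n::finite"
  assumes "\<And>i k. 0 \<le> u i $ k"
  shows "proj_dim (secant_variety (toric_variety u)) \<le> enat (2 * CARD('n) + 1)"
proof -
  define \<psi> :: "(('n + 'n) option \<Rightarrow> complex) \<Rightarrow> complex ^ 'i" where
    "\<psi> y = (\<chi> i. y None * (\<Prod>k\<in>UNIV. y (Some (Inl k)) ^ nat (u i $ k)) +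
      (\<Prod>k\<in>UNIV. y (Some (Inr k)) ^ nat (u i $ k)))" for y
  define \<sigma> where "\<sigma> i = (\<Sum>k\<in>UNIV. nat (u i $ k))" for i
  define D where "D = (\<Sum>i\<in>UNIV. 1 + \<sigma> i)"
  have pw: "sep_poly (\<sigma> i) (\<lambda>y. \<Prod>k\<in>UNIV. y (h k) ^ nat (u i $ k))" for h :: "'n \<Rightarrow> ('n + 'n) option" and i
  proof -
    have "sep_poly (\<Sum>k\<in>UNIV. 1 * nat (u i $ k)) (\<lambda>y. \<Prod>k\<in>UNIV. y (h k) ^ nat (u i $ k))"
      by (intro sep_poly_prod sep_poly_power sep_poly_var)
    then show ?thesis by (simp add: \<sigma>_def)
  qed
  have sep: "sep_poly D (\<lambda>y. \<psi> y $ i)" for i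
  proof -
    have "sep_poly (1 + \<sigma> i) (\<lambda>y. \<psi> y $ i)"
      unfolding \<psi>_def vec_lambda_beta
      by (intro sep_poly_add sep_poly_mult sep_poly_var pw sep_poly_mono[OF pw]) simp
    moreover have "1 + \<sigma> i \<le> D" unfolding D_def by (rule member_le_sum) auto
    ultimately show ?thesis by (rule sep_poly_mono)
  qed
  have "{c *s a + b | c a b. a \<in> tvec u ` torus \<and> b \<in> tvec u ` torus} \<subseteq> range \<psi>"
  proof clarify
    fix c s t
    show "c *s tvec u s + tvec u t \<in> range \<psi>"
      by (intro image_eqI[of _ _ "\<lambda>m. case m of None \<Rightarrow> c | Some (Inl k) \<Rightarrow> s $ k | Some (Inr k) \<Rightarrow> t $ k"])
        (auto simp: \<psi>_def vec_eq_iff tvec_def torus_character_nonneg[OF assms])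
  qed
  from cone_closure_mono[OF order.trans[OF this cone_closure_superset]]
  have "\<Union>(secant_variety (toric_variety u)) \<subseteq> cone_closure (range \<psi>)"
    unfolding toric_variety_tvec
    using secant_variety_upper[OF zero_notin_tvec[of u]] by (rule order.trans[rotated])
  then have "proj_dim (secant_variety (toric_variety u)) \<le> enat (card (UNIV :: ('n + 'n) option set))"
    by (intro proj_dim_le[where \<psi> = \<psi> and D = D] sep) (auto simp: secant_variety_def)
  then show ?thesis by (simp add: card_UNIV_option mult_2)
qed

section \<open>The differential of the join parametrization and its degeneration\<close>

lemma sum_option: "(\<Sum>m\<in>UNIV. g m) = g None + (\<Sum>k\<in>UNIV. g (Some k))"
  for g :: "'n::finite option \<Rightarrow> 'a::comm_monoid_add"
  by (simp add: UNIV_option_conv sum.reindex)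

text \<open>
  The row with index \<open>x\<close> of the differential of \<open>(a, s, b, t) \<mapsto> a \<chi>\<^sup>x(s) + b \<chi>\<^sup>x(t)\<close> at \<open>a = b = 1\<close>,
  \<open>s = (1, \<dots>, 1)\<close>, \<open>t = (\<kappa>, \<dots>, \<kappa>)\<close>, in logarithmic coordinates.
\<close>

definition tangent_row :: "complex \<Rightarrow> int ^ 'n \<Rightarrow> 'n::finite option + 'n option \<Rightarrow> complex" where
  "tangent_row \<kappa> x m = (case m of
     Inl None \<Rightarrow> 1 | Inl (Some k) \<Rightarrow> of_int (x $ k)
   | Inr None \<Rightarrow> \<kappa> ^ (\<Sum>k\<in>UNIV. nat (x $ k))
   | Inr (Some k) \<Rightarrow> \<kappa> ^ (\<Sum>k\<in>UNIV. nat (x $ k)) * of_int (x $ k))"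

lemma tangent_row_aff:
  "(\<Sum>m\<in>UNIV. f m * tangent_row \<kappa> x (Inl m)) = aff f x"
  "(\<Sum>m\<in>UNIV. f m * tangent_row \<kappa> x (Inr m)) = \<kappa> ^ (\<Sum>k\<in>UNIV. nat (x $ k)) * aff f x"
  by (simp_all add: sum_option tangent_row_def aff_def algebra_simps sum_distrib_left)

lemma weighted_sum_bound:
  fixes c :: "'i \<Rightarrow> complex" and A :: "'i \<Rightarrow> 'i \<Rightarrow> real"
  assumes "\<And>i. i \<in> I \<Longrightarrow> l * norm (c i) \<le> (\<Sum>k\<in>K. norm (c k) * A i k)"
    and "finite I" "finite K" "\<And>i k. 0 \<le> A i k"
  shows "l * (\<Sum>i\<in>I. norm (c i)) \<le> (\<Sum>k\<in>K. norm (c k)) * (\<Sum>i\<in>I. \<Sum>k\<in>K. A i k)"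
proof -
  have "l * norm (c i) \<le> (\<Sum>k\<in>K. norm (c k)) * (\<Sum>k\<in>K. A i k)" if "i \<in> I" for i
  proof -
    have "(\<Sum>k\<in>K. norm (c k) * A i k) \<le> (\<Sum>k\<in>K. norm (c k) * (\<Sum>k\<in>K. A i k))"
      using assms by (intro sum_mono mult_left_mono member_le_sum) auto
    then show ?thesis using assms(1)[OF that] by (simp add: sum_distrib_right)
  qed
  then have "(\<Sum>i\<in>I. l * norm (c i)) \<le> (\<Sum>i\<in>I. (\<Sum>k\<in>K. norm (c k)) * (\<Sum>k\<in>K. A i k))"
    by (intro sum_mono)
  then show ?thesis by (simp add: sum_distrib_left)
qed

text \<open>
  For \<open>\<kappa> \<rightarrow> \<infinity>\<close> the suitably scaled rows converge to a block diagonal matrix; this is the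
  tropical argument for nondefectivity.
\<close>

lemma tangent_rows_independent:
  fixes u :: "'i \<Rightarrow> int ^ 'n::finite"
  assumes fin: "finite I" "finite K" and disj: "I \<inter> K = {}"
    and I: "\<And>i. i \<in> I \<Longrightarrow> \<exists>f. \<forall>j\<in>I. aff f (u j) = (if j = i then 1 else 0)"
    and K: "\<And>i. i \<in> K \<Longrightarrow> \<exists>f. \<forall>j\<in>K. aff f (u j) = (if j = i then 1 else 0)"
    and low: "\<And>i. i \<in> I \<Longrightarrow> (\<Sum>k\<in>UNIV. nat (u i $ k)) \<le> 1"
    and high: "\<And>i. i \<in> K \<Longrightarrow> (\<Sum>k\<in>UNIV. nat (u i $ k)) \<ge> 2"
  shows "\<exists>\<kappa>::real. \<kappa> \<ge> 1 \<and> (\<forall>c. (\<forall>m. (\<Sum>i\<in>I \<union> K. c i * tangent_row (of_real \<kappa>) (u i) m) = 0) \<longrightarrow>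
     (\<forall>i\<in>I \<union> K. c i = 0))"
proof -
  obtain f where f: "\<And>i j. i \<in> I \<Longrightarrow> j \<in> I \<Longrightarrow> aff (f i) (u j) = (if j = i then 1 else 0)"
    using I by metis
  obtain g where g: "\<And>i j. i \<in> K \<Longrightarrow> j \<in> K \<Longrightarrow> aff (g i) (u j) = (if j = i then 1 else 0)"
    using K by metis
  define \<sigma> where "\<sigma> i = (\<Sum>k\<in>UNIV. nat (u i $ k))" for i
  define M where "M = (\<Sum>i\<in>I. \<Sum>k\<in>K. norm (aff (f i) (u k)))"
  define N where "N = (\<Sum>i\<in>K. \<Sum>k\<in>I. norm (aff (g i) (u k)))"
  have MN: "0 \<le> M" "0 \<le> N" unfolding M_def N_def by (auto intro!: sum_nonneg)
  \<comment> \<open>The two estimates derived below combine to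
    \<open>\<kappa> * C0 \<le> M * N * C0\<close>, so any value above \<open>M * N\<close> forces
    \<open>C0 = 0\<close>.\<close>
  define \<kappa> where "\<kappa> = M * N + 1"
  have \<kappa>: "1 \<le> \<kappa>" using MN by (simp add: \<kappa>_def)
  have "c i = 0"
    if c: "\<And>m. (\<Sum>i\<in>I \<union> K. c i * tangent_row (of_real \<kappa>) (u i) m) = 0" and i: "i \<in> I \<union> K" for c i
  proof -
    \<comment> \<open>Pairing the linear relation with an affine function in the first block of
      columns. \<open>rel2\<close> does the same in the second block, where each row carries a power
      of \<open>\<kappa>\<close>.\<close>
    have rel1: "(\<Sum>i\<in>I. c i * aff h (u i)) + (\<Sum>i\<in>K. c i * aff h (u i)) = 0" for h
    proof -
      have "(\<Sum>i\<in>I \<union> K. c i * aff h (u i)) = (\<Sum>i\<in>I \<union> K. \<Sum>m\<in>UNIV. h m * (c i * tangent_row (of_real \<kappa>) (u i) (Inl m)))"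
        by (simp add: tangent_row_aff(1)[of h "of_real \<kappa>", symmetric] sum_distrib_left mult_ac)
      also have "\<dots> = (\<Sum>m\<in>UNIV. h m * (\<Sum>i\<in>I \<union> K. c i * tangent_row (of_real \<kappa>) (u i) (Inl m)))"
        by (subst sum.swap) (simp add: sum_distrib_left)
      finally show ?thesis using c fin disj by (simp add: sum.union_disjoint)
    qed
    have rel2: "(\<Sum>i\<in>I. c i * (of_real \<kappa> ^ \<sigma> i * aff h (u i))) + (\<Sum>i\<in>K. c i * (of_real \<kappa> ^ \<sigma> i * aff h (u i))) = 0" for h
    proof -
      have "(\<Sum>i\<in>I \<union> K. c i * (of_real \<kappa> ^ \<sigma> i * aff h (u i))) = (\<Sum>i\<in>I \<union> K. \<Sum>m\<in>UNIV. h m * (c i * tangent_row (of_real \<kappa>) (u i) (Inr m)))"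
      proof (rule sum.cong)
        fix i
        have "of_real \<kappa> ^ \<sigma> i * aff h (u i) = (\<Sum>m\<in>UNIV. h m * tangent_row (of_real \<kappa>) (u i) (Inr m))"
          by (simp only: tangent_row_aff(2) \<sigma>_def)
        then show "c i * (of_real \<kappa> ^ \<sigma> i * aff h (u i)) =
            (\<Sum>m\<in>UNIV. h m * (c i * tangent_row (of_real \<kappa>) (u i) (Inr m)))"
          by (simp only: sum_distrib_left mult.left_commute)
      qed simp
      also have "\<dots> = (\<Sum>m\<in>UNIV. h m * (\<Sum>i\<in>I \<union> K. c i * tangent_row (of_real \<kappa>) (u i) (Inr m)))"
        by (subst sum.swap) (simp add: sum_distrib_left)
      finally show ?thesis using c fin disj by (simp add: sum.union_disjoint)
    qed
    define C0 where "C0 = (\<Sum>i\<in>I. norm (c i))"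
    define C1 where "C1 = (\<Sum>i\<in>K. norm (c i))"
    have C: "0 \<le> C0" "0 \<le> C1" unfolding C0_def C1_def by (auto intro!: sum_nonneg)
    have "1 * norm (c i) \<le> (\<Sum>k\<in>K. norm (c k) * norm (aff (f i) (u k)))" if i: "i \<in> I" for i
    proof -
      have "(\<Sum>j\<in>I. c j * aff (f i) (u j)) = (\<Sum>j\<in>I. if j = i then c i else 0)"
        using f i by (intro sum.cong) auto
      then have "(\<Sum>j\<in>I. c j * aff (f i) (u j)) = c i" using fin i by simp
      then have "norm (c i) = norm (\<Sum>k\<in>K. c k * aff (f i) (u k))"
        using rel1[of "f i"] by (simp add: add_eq_0_iff2)
      also have "\<dots> \<le> (\<Sum>k\<in>K. norm (c k) * norm (aff (f i) (u k)))"
        by (rule sum_norm_le) (simp add: norm_mult)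
      finally show ?thesis by simp
    qed
    then have "1 * C0 \<le> C1 * M"
      unfolding C0_def C1_def M_def using fin by (intro weighted_sum_bound) auto
    moreover have "\<kappa> * norm (c i) \<le> (\<Sum>k\<in>I. norm (c k) * norm (aff (g i) (u k)))" if i: "i \<in> K" for i
    proof -
      have "(\<Sum>j\<in>K. c j * (of_real \<kappa> ^ \<sigma> j * aff (g i) (u j))) = (\<Sum>j\<in>K. if j = i then of_real \<kappa> ^ \<sigma> i * c i else 0)"
        using g i by (intro sum.cong) auto
      then have "(\<Sum>j\<in>K. c j * (of_real \<kappa> ^ \<sigma> j * aff (g i) (u j))) = of_real \<kappa> ^ \<sigma> i * c i" using fin i by simp
      then have "norm (of_real \<kappa> ^ \<sigma> i * c i) = norm (\<Sum>k\<in>I. c k * (of_real \<kappa> ^ \<sigma> k * aff (g i) (u k)))"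
        using rel2[of "g i"] by (simp add: add_eq_0_iff2 add_eq_0_iff)
      also have "\<dots> \<le> (\<Sum>k\<in>I. norm (c k) * (\<kappa> * norm (aff (g i) (u k))))"
      proof (rule sum_norm_le)
        fix k assume k: "k \<in> I"
        have "\<kappa> ^ \<sigma> k \<le> \<kappa> ^ 1" using low[OF k] \<kappa> unfolding \<sigma>_def by (intro power_increasing)
        then show "norm (c k * (of_real \<kappa> ^ \<sigma> k * aff (g i) (u k))) \<le> norm (c k) * (\<kappa> * norm (aff (g i) (u k)))"
          using \<kappa> by (simp add: norm_mult norm_power mult_left_mono mult_right_mono)
      qed
      finally have "\<kappa> ^ \<sigma> i * norm (c i) \<le> \<kappa> * (\<Sum>k\<in>I. norm (c k) * norm (aff (g i) (u k)))"
        using \<kappa> by (simp add: norm_mult norm_power sum_distrib_left mult_ac)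
      \<comment> \<open>The gap between heights at least 2 on \<open>K\<close> and at most 1 on
        \<open>I\<close> leaves one factor \<open>\<kappa>\<close> to spare.\<close>
      moreover have "\<kappa> ^ 2 \<le> \<kappa> ^ \<sigma> i" using high[OF i] \<kappa> unfolding \<sigma>_def by (intro power_increasing)
      then have "\<kappa> * (\<kappa> * norm (c i)) \<le> \<kappa> ^ \<sigma> i * norm (c i)"
        by (simp add: power2_eq_square mult_right_mono flip: mult.assoc)
      ultimately have "\<kappa> * (\<kappa> * norm (c i)) \<le> \<kappa> * (\<Sum>k\<in>I. norm (c k) * norm (aff (g i) (u k)))" by linarith
      then show ?thesis using \<kappa> by simp
    qed
    then have "\<kappa> * C1 \<le> C0 * N"
      unfolding C0_def C1_def N_def using fin by (intro weighted_sum_bound) auto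
    ultimately have bnd: "C0 \<le> C1 * M" "\<kappa> * C1 \<le> C0 * N" by auto
    have "\<kappa> * C0 \<le> \<kappa> * (C1 * M)" using \<kappa> by (intro mult_left_mono bnd) auto
    moreover have "M * (\<kappa> * C1) \<le> M * (C0 * N)" using MN by (intro mult_left_mono bnd)
    ultimately have "\<kappa> * C0 \<le> M * N * C0" by (simp add: mult_ac)
    then have "C0 \<le> 0" by (simp add: \<kappa>_def algebra_simps)
    then have C0: "C0 = 0" using C by simp
    then have "C1 = 0" using bnd(2) C \<kappa> by (simp add: mult_le_0_iff)
    then show ?thesis using C0 i fin unfolding C0_def C1_def by (auto simp: sum_nonneg_eq_0_iff)
  qed
  then show ?thesis using \<kappa> by blast
qed

text \<open>Terms with pairwise distinct orders of vanishing at 0 cannot cancel: the smallest order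
  that occurs survives.\<close>

lemma independent_distinct_orders:
  fixes V :: "nat \<Rightarrow> complex poly"
  assumes "inj_on E {..<K}" "\<And>a. a < K \<Longrightarrow> poly (V a) 0 \<noteq> 0"
    and "(\<Sum>a<K. smult (c a) (monom 1 (E a) * V a)) = 0" "b < K"
  shows "c b = 0"
proof (rule ccontr)
  assume "c b \<noteq> 0"
  define B where "B = {a. a < K \<and> c a \<noteq> 0}"
  have "b \<in> B" using assms(4) \<open>c b \<noteq> 0\<close> by (simp add: B_def)
  then obtain a where a: "a \<in> B" "\<And>a'. a' \<in> B \<Longrightarrow> E a \<le> E a'"
    using ex_has_least_nat[of "\<lambda>x. x \<in> B" b E] by blast
  have "coeff (\<Sum>a<K. smult (c a) (monom 1 (E a) * V a)) (E a)
    = (\<Sum>a'<K. if a' = a then c a * poly (V a) 0 else 0)"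
    unfolding coeff_sum
  proof (rule sum.cong)
    fix a' assume a': "a' \<in> {..<K}"
    have "E a < E a'" if "a' \<noteq> a" "c a' \<noteq> 0"
    proof -
      have "E a \<noteq> E a'" using assms(1) a a' that by (auto simp: inj_on_def B_def)
      then show ?thesis using a(2)[of a'] a' that by (auto simp: B_def)
    qed
    then show "coeff (smult (c a') (monom 1 (E a') * V a')) (E a) = (if a' = a then c a * poly (V a) 0 else 0)"
      by (auto simp: coeff_monom_mult poly_0_coeff_0)
  qed simp
  also have "\<dots> = c a * poly (V a) 0" using a by (simp add: B_def)
  finally show False using assms a by (auto simp: B_def)
qed

section \<open>Base \<open>q\<close> digits and first-order expansions along polynomial arcs\<close>

lemma digits_sum: "(\<Sum>b<j. (a div q ^ b mod q) * q ^ b) = a mod q ^ j" for a q :: nat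
proof (induction j)
  case (Suc j)
  have "a mod q ^ Suc j = q ^ j * (a div q ^ j mod q) + a mod q ^ j"
    using mod_mult2_eq[of a "q ^ j" q] by (simp add: mult.commute)
  then show ?case using Suc by (simp add: mult.commute)
qed simp

text \<open>\<open>p\<close> equals \<open>1 + \<delta>\<close> up to second order in
  \<open>h\<close>; divisibility replaces limits, since \<open>h\<close> will be a power of the arc
  parameter.\<close>

definition first_order :: "'a::comm_ring_1 \<Rightarrow> 'a \<Rightarrow> 'a \<Rightarrow> bool" where
  "first_order h p \<delta> \<longleftrightarrow> h dvd \<delta> \<and> h * h dvd p - (1 + \<delta>)"

lemma first_order_mult:
  assumes "first_order h p \<delta>" "first_order h q \<epsilon>" shows "first_order h (p * q) (\<delta> + \<epsilon>)"
proof -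
  obtain \<alpha> where \<alpha>: "p - (1 + \<delta>) = h * h * \<alpha>" using assms by (auto simp: first_order_def)
  obtain \<beta> where \<beta>: "q - (1 + \<epsilon>) = h * h * \<beta>" using assms by (auto simp: first_order_def)
  obtain d e where de: "\<delta> = h * d" "\<epsilon> = h * e" using assms unfolding first_order_def by (elim conjE dvdE) blast
  have "p = 1 + \<delta> + h * h * \<alpha>" "q = 1 + \<epsilon> + h * h * \<beta>"
    using \<alpha> \<beta> by (simp_all add: algebra_simps)
  then have "p * q - (1 + (\<delta> + \<epsilon>)) = h * h * (d * e + \<alpha> * q + \<beta> * (1 + \<delta>))"
    by (simp add: de algebra_simps)
  then show ?thesis using assms by (auto simp: first_order_def)
qed

lemma first_order_one: "first_order h 1 0"
  by (simp add: first_order_def)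

lemma first_order_base: "h dvd \<delta> \<Longrightarrow> first_order h (1 + \<delta>) \<delta>"
  by (simp add: first_order_def)

lemma first_order_power: "first_order h p \<delta> \<Longrightarrow> first_order h (p ^ k) (of_nat k * \<delta>)"
proof (induction k)
  case (Suc k)
  then have "first_order h (p * p ^ k) (\<delta> + of_nat k * \<delta>)" by (intro first_order_mult) auto
  then show ?case by (simp add: distrib_right)
qed (simp add: first_order_one)

lemma first_order_prod:
  "(\<And>k. k \<in> S \<Longrightarrow> first_order h (p k) (\<delta> k)) \<Longrightarrow> first_order h (\<Prod>k\<in>S. p k) (\<Sum>k\<in>S. \<delta> k)"
  by (induction S rule: infinite_finite_induct) (auto intro: first_order_one first_order_mult)

text \<open>The join map near \<open>a = b = 1\<close>, \<open>s = (1, ..., 1)\<close>,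
  \<open>t = (\<kappa>, ..., \<kappa>)\<close>. Perturbing every parameter by a factor
  \<open>1 + \<theta>\<close> makes \<open>tangent_row\<close> its linear term.\<close>

definition join_point :: "('i::finite \<Rightarrow> int ^ 'n::finite) \<Rightarrow> complex \<Rightarrow> ('n option + 'n option \<Rightarrow> complex) \<Rightarrow> complex ^ 'i" where
  "join_point u \<kappa> \<theta> = (\<chi> i.
     (1 + \<theta> (Inl None)) * (\<Prod>k\<in>UNIV. (1 + \<theta> (Inl (Some k))) ^ nat (u i $ k)) +
     (1 + \<theta> (Inr None)) * (\<Prod>k\<in>UNIV. (\<kappa> * (1 + \<theta> (Inr (Some k)))) ^ nat (u i $ k)))"

definition join_poly :: "('i::finite \<Rightarrow> int ^ 'n::finite) \<Rightarrow> complex \<Rightarrow> ('n option + 'n option \<Rightarrow> complex poly) \<Rightarrow> 'i \<Rightarrow> complex poly" where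
  "join_poly u \<kappa> \<Theta> i =
     (1 + \<Theta> (Inl None)) * (\<Prod>k\<in>UNIV. (1 + \<Theta> (Inl (Some k))) ^ nat (u i $ k)) +
     (1 + \<Theta> (Inr None)) * (\<Prod>k\<in>UNIV. (smult \<kappa> (1 + \<Theta> (Inr (Some k)))) ^ nat (u i $ k))"

lemma poly_join_poly: "(\<chi> i. poly (join_poly u \<kappa> \<Theta> i) \<tau>) = join_point u \<kappa> (\<lambda>m. poly (\<Theta> m) \<tau>)"
  by (simp add: join_poly_def join_point_def poly_prod)

lemma smult_sum_right: "smult a (\<Sum>x\<in>S. p x) = (\<Sum>x\<in>S. smult a (p x))"
  by (induction S rule: infinite_finite_induct) (auto simp: smult_add_right)

lemma sum_Plus: "(\<Sum>m\<in>UNIV. g m) = (\<Sum>k\<in>UNIV. g (Inl k)) + (\<Sum>k\<in>UNIV. g (Inr k))"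
  for g :: "'a::finite + 'b::finite \<Rightarrow> 'c::comm_monoid_add"
proof -
  have "(\<Sum>m\<in>UNIV. g m) = sum g (UNIV <+> UNIV)" by simp
  then show ?thesis by (simp only: sum.Plus finite comp_def)
qed

lemma join_poly_first_order:
  fixes u :: "'i::finite \<Rightarrow> int ^ 'n::finite"
  assumes nonneg: "\<And>k. 0 \<le> u i $ k" and h: "\<And>m. h dvd \<Theta> m"
  shows "h * h dvd join_poly u \<kappa> \<Theta> i -
    ([:1 + \<kappa> ^ (\<Sum>k\<in>UNIV. nat (u i $ k)):] + (\<Sum>m\<in>UNIV. smult (tangent_row \<kappa> (u i) m) (\<Theta> m)))"
proof -
  define \<sigma> where "\<sigma> = (\<Sum>k\<in>UNIV. nat (u i $ k))"
  define P where "P inj = (1 + \<Theta> (inj None)) * (\<Prod>k\<in>UNIV. (1 + \<Theta> (inj (Some k))) ^ nat (u i $ k))"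
    for inj :: "'n option \<Rightarrow> 'n option + 'n option"
  define \<delta> where "\<delta> inj = \<Theta> (inj None) + (\<Sum>k\<in>UNIV. of_nat (nat (u i $ k)) * \<Theta> (inj (Some k)))"
    for inj :: "'n option \<Rightarrow> 'n option + 'n option"
  have fo: "h * h dvd P inj - (1 + \<delta> inj)" for inj
  proof -
    have "first_order h (P inj) (\<delta> inj)"
      unfolding P_def \<delta>_def by (intro first_order_mult first_order_base first_order_prod first_order_power h)
    then show ?thesis by (simp add: first_order_def)
  qed
  have join: "join_poly u \<kappa> \<Theta> i = P Inl + smult (\<kappa> ^ \<sigma>) (P Inr)"
    by (simp add: join_poly_def P_def smult_power prod_smult \<sigma>_def power_sum)
  have "smult (of_int (u i $ k)) p = of_nat (nat (u i $ k)) * p" for k and p :: "complex poly"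
  proof -
    have "(of_int (u i $ k) :: complex) = of_nat (nat (u i $ k))" using nonneg[of k] by simp
    then show ?thesis by (simp add: of_nat_poly)
  qed
  then have row: "(\<Sum>m\<in>UNIV. smult (tangent_row \<kappa> (u i) m) (\<Theta> m)) = \<delta> Inl + smult (\<kappa> ^ \<sigma>) (\<delta> Inr)"
    by (simp add: sum_Plus sum_option tangent_row_def \<delta>_def \<sigma>_def smult_add_right smult_sum_right flip: smult_smult)
  have "join_poly u \<kappa> \<Theta> i - ([:1 + \<kappa> ^ \<sigma>:] + (\<Sum>m\<in>UNIV. smult (tangent_row \<kappa> (u i) m) (\<Theta> m)))
      = (P Inl - (1 + \<delta> Inl)) + smult (\<kappa> ^ \<sigma>) (P Inr - (1 + \<delta> Inr))"
    unfolding join row by (simp add: smult_add_right smult_diff_right one_pCons)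
  then show ?thesis using fo unfolding \<sigma>_def by (simp add: dvd_add dvd_smult)
qed

definition admissible :: "('i::finite \<Rightarrow> int ^ 'n::finite) \<Rightarrow> complex \<Rightarrow> ('n option + 'n option \<Rightarrow> complex) \<Rightarrow> bool" where
  "admissible u \<kappa> \<theta> \<longleftrightarrow> (\<forall>k. 1 + \<theta> (Inl (Some k)) \<noteq> 0 \<and> 1 + \<theta> (Inr (Some k)) \<noteq> 0) \<and> join_point u \<kappa> \<theta> \<noteq> 0"

text \<open>All nondegeneracy conditions are implied by the nonvanishing of a single polynomial,
  which is nonzero at \<open>\<tau>\<^sub>0\<close>.\<close>

lemma admissible_cofinite:
  fixes u :: "'i::finite \<Rightarrow> int ^ 'n::finite"
  assumes "admissible u \<kappa> (\<lambda>m. poly (\<Theta> m) \<tau>\<^sub>0)"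
  shows "finite {\<tau>. \<not> admissible u \<kappa> (\<lambda>m. poly (\<Theta> m) \<tau>)}"
proof -
  obtain i where i: "join_point u \<kappa> (\<lambda>m. poly (\<Theta> m) \<tau>\<^sub>0) $ i \<noteq> 0"
    using assms by (auto simp: admissible_def vec_eq_iff)
  define p where "p = join_poly u \<kappa> \<Theta> i * (\<Prod>k\<in>UNIV. (1 + \<Theta> (Inl (Some k))) * (1 + \<Theta> (Inr (Some k))))"
  have join: "poly (join_poly u \<kappa> \<Theta> i) \<tau> = join_point u \<kappa> (\<lambda>m. poly (\<Theta> m) \<tau>) $ i" for \<tau>
    by (simp flip: poly_join_poly)
  have "poly p \<tau>\<^sub>0 \<noteq> 0" using assms i by (auto simp: p_def join poly_prod admissible_def)
  then have "finite {\<tau>. poly p \<tau> = 0}" by (intro poly_roots_finite) auto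
  moreover have "{\<tau>. \<not> admissible u \<kappa> (\<lambda>m. poly (\<Theta> m) \<tau>)} \<subseteq> {\<tau>. poly p \<tau> = 0}"
    by (auto simp: admissible_def p_def join poly_prod)
  ultimately show ?thesis by (rule finite_subset[rotated])
qed

text \<open>The origin and the unit vectors among the exponents allow a torus point to be recovered
  from its image, so distinct torus points span a genuine secant line.\<close>

lemma join_point_secant:
  fixes u :: "'i::finite \<Rightarrow> int ^ 'n::finite"
  assumes nonneg: "\<And>i k. 0 \<le> u i $ k" and origin: "u i0 = 0" and axes: "\<And>k. \<exists>i. u i = axis k 1"
    and \<kappa>: "\<kappa> \<noteq> 0" and admissible: "admissible u \<kappa> \<theta>"
  shows "vec.span {join_point u \<kappa> \<theta>} \<in> secant_variety (toric_variety u)"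
proof -
  define s :: "complex ^ 'n" where "s = (\<chi> k. 1 + \<theta> (Inl (Some k)))"
  define t :: "complex ^ 'n" where "t = (\<chi> k. \<kappa> * (1 + \<theta> (Inr (Some k))))"
  have st: "s \<in> torus" "t \<in> torus" using admissible \<kappa> by (auto simp: s_def t_def torus_def admissible_def)
  have eq: "join_point u \<kappa> \<theta> = (1 + \<theta> (Inl None)) *s tvec u s + (1 + \<theta> (Inr None)) *s tvec u t"
    unfolding vec_eq_iff
    by (simp only: join_point_def tvec_def torus_character_nonneg[OF nonneg] s_def t_def
        vector_add_component vector_smult_component vec_lambda_beta) simp
  have lower: "vec.span {a *s tvec u x + b *s tvec u y} \<in> secant_variety (toric_variety u)"
    if xy: "x \<in> torus" "y \<in> torus" "x \<noteq> y" "a *s tvec u x + b *s tvec u y \<noteq> 0" for x y a b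
  proof (rule secant_variety_lower)
    have sub: "spans (tvec u ` torus) \<subseteq> toric_variety u"
      unfolding toric_variety_tvec
      using closure_of_subset[of "spans (tvec u ` torus)" zariski] spans_subset_proj_space[OF zero_notin_tvec[of u]]
      by (simp add: topspace_zariski)
    then show "vec.span {tvec u x} \<in> toric_variety u" "vec.span {tvec u y} \<in> toric_variety u" using xy by auto
    show "toric_variety u \<subseteq> proj_space"
      unfolding toric_variety_tvec by (rule zariski_closure_subset_proj_space)
    show "tvec u x \<noteq> 0" "tvec u y \<noteq> 0" using xy tvec_nonzero by auto
    show "vec.span {tvec u x} \<noteq> vec.span {tvec u y}"
    proof
      assume "vec.span {tvec u x} = vec.span {tvec u y}"
      then have "tvec u x \<in> vec.span {tvec u y}" using vec.span_base[of "tvec u x" "{tvec u x}"] by simp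
      then obtain c where c: "tvec u x = c *s tvec u y" by (auto simp: vec.span_singleton)
      have ax: "torus_character (axis k 1) z = z $ k" for k and z :: "complex ^ 'n"
        by (subst torus_character_nonneg)
          (auto simp: axis_def if_distrib[of nat] if_distrib[of "\<lambda>e. _ ^ e"] cong: if_cong)
      have "tvec u x $ i0 = c * tvec u y $ i0" using c by simp
      then have "c = 1" by (simp add: tvec_def origin torus_character_def)
      have "x $ k = y $ k" for k
      proof -
        obtain i where "u i = axis k 1" using axes by blast
        then show ?thesis using arg_cong[OF c, of "\<lambda>v. v $ i"] \<open>c = 1\<close> by (simp add: tvec_def ax)
      qed
      then show False using xy by (simp add: vec_eq_iff)
    qed
  qed (use xy in auto)
  show ?thesis
  proof (cases "s = t")
    case False
    then show ?thesis using lower st admissible unfolding admissible_def eq by blast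
  next
    case True
    \<comment> \<open>If both torus points coincide they span no line; a second point with
      coefficient 0 supplies one.\<close>
    have "2 *s s \<in> torus" "s \<noteq> 2 *s s" using st by (auto simp: torus_def vec_eq_iff)
    moreover have J: "join_point u \<kappa> \<theta> =
        ((1 + \<theta> (Inl None)) + (1 + \<theta> (Inr None))) *s tvec u s + 0 *s tvec u (2 *s s)"
      unfolding eq True[symmetric] by (simp only: vec.scale_left_distrib vec.scale_zero_left add_0_right)
    moreover have "join_point u \<kappa> \<theta> \<noteq> 0" using admissible by (simp add: admissible_def)
    ultimately show ?thesis using lower[OF st(1)] by metis
  qed
qed

text \<open>By duality, coordinate \<open>e b\<close> of the join point is a constant plus
  \<open>y b\<close> up to second order, while coordinate \<open>l\<close> is constant to first
  order. Suitable linear forms thus act as local parameters, and the monomials in them with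
  exponents below \<open>q\<close> are the \<open>q ^ j\<close> independent forms.\<close>

lemma independent_forms_join:
  fixes u :: "'i::finite \<Rightarrow> int ^ 'n::finite"
  assumes nonneg: "\<And>i k. 0 \<le> u i $ k" and \<kappa>: "\<kappa> \<ge> 1" and \<theta>_def: "\<And>y m. \<theta> y m = (\<Sum>b<r. y b * v (e b) m)"
    and dual: "\<And>b. b < r \<Longrightarrow> (\<Sum>m\<in>UNIV. tangent_row (of_real \<kappa>) (u l) m * v (e b) m) = 0"
      "\<And>b c. b < r \<Longrightarrow> c < r \<Longrightarrow> (\<Sum>m\<in>UNIV. tangent_row (of_real \<kappa>) (u (e c)) m * v (e b) m) = (if b = c then 1 else 0)"
    and j: "j \<le> r" and q: "0 < q"
  shows "independent_forms {join_point u (of_real \<kappa>) (\<theta> y) | y. admissible u (of_real \<kappa>) (\<theta> y) \<and> (\<forall>b\<ge>j. y b = 0)}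
    (j * q) (q ^ j)"
proof -
  let ?\<kappa> = "complex_of_real \<kappa>"
  let ?S = "{join_point u (of_real \<kappa>) (\<theta> y) | y. admissible u (of_real \<kappa>) (\<theta> y) \<and> (\<forall>b\<ge>j. y b = 0)}"
  define base where "base i = 1 + ?\<kappa> ^ (\<Sum>k\<in>UNIV. nat (u i $ k))" for i
  have base: "base i \<noteq> 0" for i
  proof -
    have "base i = of_real (1 + \<kappa> ^ (\<Sum>k\<in>UNIV. nat (u i $ k)))" by (simp add: base_def)
    moreover have "1 + \<kappa> ^ (\<Sum>k\<in>UNIV. nat (u i $ k)) > 0" using \<kappa> by (simp add: add_pos_nonneg)
    ultimately show ?thesis by (metis of_real_eq_0_iff less_irrefl)
  qed
  define dig where "dig a b = a div q ^ b mod q" for a b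
  have dig: "dig a b < q" for a b using q by (simp add: dig_def)
  have digsum: "(\<Sum>b<j. dig a b) \<le> j * q" for a
    using sum_bounded_above[of "{..<j}" "dig a" q] dig by (auto intro: less_imp_le)
  \<comment> \<open>Subtracting a multiple of coordinate \<open>l\<close> removes the value at the
    base point.\<close>
  define L where "L b x = x $ e b - base (e b) / base l * x $ l" for b and x :: "complex ^ 'i"
  have L: "form 1 (L b)" for b
    using form_add[OF form_coord form_cmult[OF form_coord], of "e b" "- (base (e b) / base l)" l]
    unfolding L_def by simp
  \<comment> \<open>The power of coordinate \<open>l\<close> pads the product of the
    \<open>L b\<close> to the common degree \<open>j * q\<close>.\<close>
  define F where "F a x = (x $ l) ^ (j * q - (\<Sum>b<j. dig a b)) * (\<Prod>b<j. L b x ^ dig a b)" for a x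
  have F: "form (j * q) (F a)" for a
  proof -
    have "form ((j * q - (\<Sum>b<j. dig a b)) + (\<Sum>b<j. dig a b)) (F a)"
      unfolding F_def using form_power[OF form_coord, of "j * q - (\<Sum>b<j. dig a b)" l]
      by (intro form_mult form_prod) (use form_power[OF L] in auto)
    then show ?thesis using digsum[of a] by simp
  qed
  \<comment> \<open>Along the arc \<open>y b = \<tau> ^ (W + q ^ b)\<close> the products of the \<open>L b\<close> have pairwise distinct orders, as their
    exponents are the base \<open>q\<close> digits of \<open>a\<close>, and the quadratic error terms are negligible.\<close>
  define W where "W = q ^ j + 1"
  define w where "w b = W + q ^ b" for b
  \<comment> \<open>All linear terms have order at least \<open>W\<close> and below the order
    \<open>2 * W\<close> of the errors. Moreover \<open>a < W\<close> for \<open>a < q ^ j\<close>,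
    so \<open>a\<close> can be read off from \<open>E a\<close> modulo \<open>W\<close>.\<close>
  have w: "W \<le> w b" "w b < 2 * W" if "b < j" for b
  proof -
    have "q ^ b \<le> q ^ j" using that q by (intro power_increasing) auto
    then show "W \<le> w b" "w b < 2 * W" by (auto simp: w_def W_def)
  qed
  define \<Theta> where "\<Theta> m = (\<Sum>b<j. monom (v (e b) m) (w b))" for m
  define arc where "arc \<tau> b = (if b < j then \<tau> ^ w b else 0)" for \<tau> :: complex and b
  have \<Theta>: "(\<lambda>m. poly (\<Theta> m) \<tau>) = \<theta> (arc \<tau>)" for \<tau>
  proof
    fix m
    have "\<theta> (arc \<tau>) m = (\<Sum>b<j. arc \<tau> b * v (e b) m)"
      unfolding \<theta>_def using j by (intro sum.mono_neutral_right) (auto simp: arc_def)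
    then show "poly (\<Theta> m) \<tau> = \<theta> (arc \<tau>) m"
      by (simp add: \<Theta>_def poly_sum poly_monom arc_def mult.commute)
  qed
  define X :: "complex poly" where "X = monom 1 W"
  define \<gamma> where "\<gamma> = join_poly u ?\<kappa> \<Theta>"
  have "X dvd \<Theta> m" for m
    unfolding \<Theta>_def
  proof (rule dvd_sum)
    fix b assume "b \<in> {..<j}"
    then have "monom (v (e b) m) (w b) = X * monom (v (e b) m) (w b - W)"
      using w by (simp add: X_def mult_monom)
    then show "X dvd monom (v (e b) m) (w b)" by simp
  qed
  from join_poly_first_order[OF nonneg this]
  have fo: "X * X dvd \<gamma> i - ([:base i:] + (\<Sum>m\<in>UNIV. smult (tangent_row ?\<kappa> (u i) m) (\<Theta> m)))" for i
    by (simp add: \<gamma>_def base_def)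
  have lin: "(\<Sum>m\<in>UNIV. smult (tangent_row ?\<kappa> (u i) m) (\<Theta> m)) =
      (\<Sum>b<j. monom (\<Sum>m\<in>UNIV. tangent_row ?\<kappa> (u i) m * v (e b) m) (w b))" for i
    unfolding \<Theta>_def smult_sum_right smult_monom by (subst sum.swap) (simp flip: monom_sum)
  obtain \<alpha> where \<alpha>: "\<gamma> l = [:base l:] + X * X * \<alpha>"
  proof -
    have "(\<Sum>m\<in>UNIV. smult (tangent_row ?\<kappa> (u l) m) (\<Theta> m)) = 0"
      unfolding lin using dual(1) j by (intro sum.neutral) auto
    then have "X * X dvd \<gamma> l - [:base l:]" using fo[of l] by simp
    then obtain \<alpha> where "\<gamma> l - [:base l:] = X * X * \<alpha>" by (elim dvdE)
    then have "\<gamma> l = [:base l:] + X * X * \<alpha>" by (simp add: diff_eq_eq add.commute)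
    then show ?thesis using that by blast
  qed
  have "\<exists>U. poly U 0 = 1 \<and> (\<forall>\<tau>. L b (join_point u ?\<kappa> (\<theta> (arc \<tau>))) = poly (monom 1 (w b) * U) \<tau>)"
    if b: "b < j" for b
  proof -
    have "(\<Sum>m\<in>UNIV. smult (tangent_row ?\<kappa> (u (e b)) m) (\<Theta> m)) = (\<Sum>b'<j. if b' = b then monom 1 (w b) else 0)"
      unfolding lin using dual(2)[of _ b] j b by (intro sum.cong) auto
    then have "(\<Sum>m\<in>UNIV. smult (tangent_row ?\<kappa> (u (e b)) m) (\<Theta> m)) = monom 1 (w b)" using b by simp
    then have "X * X dvd \<gamma> (e b) - ([:base (e b):] + monom 1 (w b))" using fo[of "e b"] by simp
    then obtain \<beta> where \<beta>: "\<gamma> (e b) - ([:base (e b):] + monom 1 (w b)) = X * X * \<beta>" by (elim dvdE)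
    define \<rho> where "\<rho> = base (e b) / base l"
    define U where "U = 1 + monom 1 (2 * W - w b) * (\<beta> - smult \<rho> \<alpha>)"
    have "X * X = monom 1 (w b) * monom 1 (2 * W - w b)" using w[OF b] by (simp add: X_def mult_monom mult_2)
    moreover have "smult \<rho> [:base l:] = [:base (e b):]" using base by (simp add: \<rho>_def)
    moreover have "\<gamma> (e b) = [:base (e b):] + monom 1 (w b) + X * X * \<beta>" using \<beta> by (simp add: algebra_simps)
    ultimately have U: "\<gamma> (e b) - smult \<rho> (\<gamma> l) = monom 1 (w b) * U"
      unfolding \<alpha> U_def by (simp add: smult_add_right algebra_simps)
    have "poly U 0 = 1" using w[OF b] by (simp add: U_def poly_monom)
    moreover have "L b (join_point u ?\<kappa> (\<theta> (arc \<tau>))) = poly (\<gamma> (e b) - smult \<rho> (\<gamma> l)) \<tau>" for \<tau>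
      by (simp add: L_def \<rho>_def \<gamma>_def flip: \<Theta> poly_join_poly)
    ultimately show ?thesis using U by auto
  qed
  then obtain U where U: "\<And>b. b < j \<Longrightarrow> poly (U b) 0 = 1"
    "\<And>b \<tau>. b < j \<Longrightarrow> L b (join_point u ?\<kappa> (\<theta> (arc \<tau>))) = poly (monom 1 (w b) * U b) \<tau>"
    by metis
  define E where "E a = (\<Sum>b<j. w b * dig a b)" for a
  define V where "V a = \<gamma> l ^ (j * q - (\<Sum>b<j. dig a b)) * (\<Prod>b<j. U b ^ dig a b)" for a
  have FV: "F a (join_point u ?\<kappa> (\<theta> (arc \<tau>))) = poly (monom 1 (E a) * V a) \<tau>" for a \<tau>
  proof -
    have l: "join_point u ?\<kappa> (\<theta> (arc \<tau>)) $ l = poly (\<gamma> l) \<tau>"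
      by (simp add: \<gamma>_def flip: \<Theta> poly_join_poly)
    have "(\<Prod>b<j. L b (join_point u ?\<kappa> (\<theta> (arc \<tau>))) ^ dig a b) = (\<Prod>b<j. \<tau> ^ (w b * dig a b) * poly (U b) \<tau> ^ dig a b)"
      by (intro prod.cong) (auto simp: U(2) poly_monom power_mult_distrib power_mult)
    then show ?thesis
      by (simp add: F_def V_def E_def l poly_monom poly_prod prod.distrib power_sum)
  qed
  have E: "E a = W * (\<Sum>b<j. dig a b) + a" if "a < q ^ j" for a
  proof -
    have "E a = W * (\<Sum>b<j. dig a b) + (\<Sum>b<j. dig a b * q ^ b)"
      by (simp add: E_def w_def algebra_simps sum.distrib sum_distrib_left)
    then show ?thesis using digits_sum[of a q j] that by (simp add: dig_def)
  qed
  have "inj_on E {..<q ^ j}"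
  proof (rule inj_onI)
    fix a a' assume a: "a \<in> {..<q ^ j}" "a' \<in> {..<q ^ j}" "E a = E a'"
    have "E a mod W = a" if "a < q ^ j" for a
    proof -
      have "a < W" using that by (simp add: W_def)
      then show ?thesis using that by (simp add: E)
    qed
    then show "a = a'" using a by (metis lessThan_iff)
  qed
  moreover have "poly (V a) 0 \<noteq> 0" for a
  proof -
    have "poly (\<gamma> l) 0 = base l" by (simp add: \<alpha> X_def W_def poly_monom)
    then show ?thesis using base[of l] U(1) by (simp add: V_def poly_prod)
  qed
  moreover have "(\<Sum>a<q ^ j. smult (c a) (monom 1 (E a) * V a)) = 0"
    if c: "\<forall>x\<in>?S. (\<Sum>a<q ^ j. c a * F a x) = 0" for c
  proof -
    have "admissible u ?\<kappa> (\<lambda>m. poly (\<Theta> m) 0)"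
    proof -
      have "\<Theta> m = X * (\<Sum>b<j. monom (v (e b) m) (w b - W))" for m
        unfolding \<Theta>_def sum_distrib_left by (intro sum.cong) (use w in \<open>auto simp: X_def mult_monom\<close>)
      then have z: "poly (\<Theta> m) 0 = 0" for m by (simp add: X_def poly_monom W_def)
      have "join_point u ?\<kappa> (\<lambda>m. 0) $ l = base l"
        by (simp add: join_point_def base_def power_sum)
      then have "join_point u ?\<kappa> (\<lambda>m. 0) \<noteq> 0" using base[of l] by (metis zero_index)
      then show ?thesis by (simp add: admissible_def z)
    qed
    from admissible_cofinite[OF this] have fin: "finite {\<tau>. \<not> admissible u ?\<kappa> (\<theta> (arc \<tau>))}" by (simp add: \<Theta>)
    have "poly (\<Sum>a<q ^ j. smult (c a) (monom 1 (E a) * V a)) \<tau> = 0" if "admissible u ?\<kappa> (\<theta> (arc \<tau>))" for \<tau>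
    proof -
      have "join_point u ?\<kappa> (\<theta> (arc \<tau>)) \<in> ?S" using that by (auto simp: arc_def)
      then have "(\<Sum>a<q ^ j. c a * F a (join_point u ?\<kappa> (\<theta> (arc \<tau>)))) = 0" using c by blast
      then show ?thesis by (simp only: poly_sum poly_smult FV)
    qed
    then have "{\<tau>. poly (\<Sum>a<q ^ j. smult (c a) (monom 1 (E a) * V a)) \<tau> \<noteq> 0} \<subseteq> {\<tau>. \<not> admissible u ?\<kappa> (\<theta> (arc \<tau>))}"
      by blast
    then show ?thesis using fin poly_zero_cofinite finite_subset by blast
  qed
  ultimately have "c a = 0" if "\<forall>x\<in>?S. (\<Sum>a<q ^ j. c a * F a x) = 0" "a < q ^ j" for c a
    using independent_distinct_orders[of E "q ^ j" V c a] that by blast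
  then show ?thesis
    unfolding independent_forms_def using F by (intro exI[of _ F]) simp
qed

text \<open>One of the \<open>r + 1\<close> independent rows, \<open>l\<close>, is reserved for the
  homogenizing coordinate; the dual vectors of the other \<open>r\<close> are the directions of the
  flag of parameter spaces.\<close>

lemma proj_dim_secant_toric_ge:
  fixes u :: "'i::finite \<Rightarrow> int ^ 'n::finite"
  assumes nonneg: "\<And>i k. 0 \<le> u i $ k" and origin: "u i0 = 0" and axes: "\<And>k. \<exists>i. u i = axis k 1"
    and disj: "I \<inter> K = {}"
    and I: "\<And>i. i \<in> I \<Longrightarrow> \<exists>f. \<forall>j\<in>I. aff f (u j) = (if j = i then 1 else 0)"
    and K: "\<And>i. i \<in> K \<Longrightarrow> \<exists>f. \<forall>j\<in>K. aff f (u j) = (if j = i then 1 else 0)"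
    and low: "\<And>i. i \<in> I \<Longrightarrow> (\<Sum>k\<in>UNIV. nat (u i $ k)) \<le> 1"
    and high: "\<And>i. i \<in> K \<Longrightarrow> (\<Sum>k\<in>UNIV. nat (u i $ k)) \<ge> 2"
    and r: "card (I \<union> K) = r + 1"
  shows "enat r \<le> proj_dim (secant_variety (toric_variety u))"
proof -
  obtain \<kappa> :: real where \<kappa>: "\<kappa> \<ge> 1" and ind: "\<And>c i. (\<And>m. (\<Sum>i\<in>I \<union> K. c i * tangent_row (of_real \<kappa>) (u i) m) = 0) \<Longrightarrow>
     i \<in> I \<union> K \<Longrightarrow> c i = 0"
    using tangent_rows_independent[OF _ _ disj I K low high] by (meson finite)
  let ?\<kappa> = "complex_of_real \<kappa>"
  obtain v where v: "\<And>i k. i \<in> I \<union> K \<Longrightarrow> k \<in> I \<union> K \<Longrightarrow>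
      (\<Sum>m\<in>UNIV. tangent_row ?\<kappa> (u k) m * v i m) = (if k = i then 1 else 0)"
  proof -
    have "\<exists>v. \<forall>i\<in>I \<union> K. \<forall>k\<in>I \<union> K. (\<Sum>m\<in>UNIV. tangent_row ?\<kappa> (u k) m * v i m) = (if k = i then 1 else 0)"
      by (rule dual_vectors[of "I \<union> K" "\<lambda>i. tangent_row ?\<kappa> (u i)"]) (use ind in auto)
    then show ?thesis using that by blast
  qed
  have "I \<union> K \<noteq> {}" using r by auto
  then obtain l where l: "l \<in> I \<union> K" by blast
  have "card (I \<union> K - {l}) = r" using r l by simp
  then obtain e where e: "bij_betw e {..<r} (I \<union> K - {l})"
    using ex_bij_betw_nat_finite[of "I \<union> K - {l}"] by (auto simp: lessThan_atLeast0)
  have eI: "e b \<in> I \<union> K" "e b \<noteq> l" if "b < r" for b using e that by (auto simp: bij_betw_def)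
  have einj: "e b = e c \<longleftrightarrow> b = c" if "b < r" "c < r" for b c
    using e that by (auto simp: bij_betw_def inj_on_def)
  define \<theta> where "\<theta> y m = (\<Sum>b<r. y b * v (e b) m)" for y m
  define \<psi> where "\<psi> y = join_point u ?\<kappa> (\<theta> y)" for y
  define S where "S j = {\<psi> y | y. admissible u ?\<kappa> (\<theta> y) \<and> (\<forall>b\<ge>j. y b = 0)}" for j
  define \<sigma> where "\<sigma> i = (\<Sum>k\<in>UNIV. nat (u i $ k))" for i
  define D where "D = (\<Sum>i\<in>UNIV. 1 + \<sigma> i)"
  have sep\<theta>: "sep_poly 1 (\<lambda>y. \<theta> y m)" for m
    unfolding \<theta>_def mult.commute[of "_ :: complex" "v _ _"]
    by (intro sep_poly_sum sep_poly_cmult sep_poly_var)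
  have sep1: "sep_poly 1 (\<lambda>y. c * (1 + \<theta> y m))" for m c
    by (intro sep_poly_cmult sep_poly_add sep_poly_const sep\<theta>)
  have pw: "sep_poly (\<sigma> i) (\<lambda>y. \<Prod>k\<in>UNIV. (c * (1 + \<theta> y (h k))) ^ nat (u i $ k))" for h c i
  proof -
    have "sep_poly (\<Sum>k\<in>UNIV. 1 * nat (u i $ k)) (\<lambda>y. \<Prod>k\<in>UNIV. (c * (1 + \<theta> y (h k))) ^ nat (u i $ k))"
      by (intro sep_poly_prod sep_poly_power sep1)
    then show ?thesis by (simp add: \<sigma>_def)
  qed
  have sep1': "sep_poly 1 (\<lambda>y. 1 + \<theta> y m)" for m using sep1[of 1 m] by simp
  have pw1: "sep_poly (\<sigma> i) (\<lambda>y. \<Prod>k\<in>UNIV. (1 + \<theta> y (h k)) ^ nat (u i $ k))" for h i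
    using pw[of i 1 h] by simp
  show ?thesis
  proof (rule proj_dim_ge[where \<psi> = \<psi> and S = S and D = D])
    show "closedin zariski (secant_variety (toric_variety u))" by (simp add: secant_variety_def)
    show "sep_poly D (\<lambda>y. \<psi> y $ i)" for i
    proof -
      have "sep_poly (1 + \<sigma> i) (\<lambda>y. \<psi> y $ i)"
        unfolding \<psi>_def join_point_def vec_lambda_beta
        by (intro sep_poly_add[OF sep_poly_mult[OF sep1' pw1] sep_poly_mult[OF sep1' pw]])
      moreover have "1 + \<sigma> i \<le> D" unfolding D_def by (rule member_le_sum) auto
      ultimately show ?thesis by (rule sep_poly_mono)
    qed
    show "0 \<notin> S j" for j by (auto simp: S_def admissible_def \<psi>_def)
    show "S j \<noteq> {}" for j
    proof -
      have z: "\<theta> (\<lambda>_. 0) = (\<lambda>m. 0)" by (simp add: \<theta>_def fun_eq_iff)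
      have "join_point u ?\<kappa> (\<lambda>m. 0) $ i0 = 2" by (simp add: join_point_def origin)
      then have "join_point u ?\<kappa> (\<lambda>m. 0) \<noteq> 0" by (metis zero_index zero_neq_numeral)
      then have "admissible u ?\<kappa> (\<theta> (\<lambda>_. 0))" by (simp add: admissible_def z)
      then show ?thesis unfolding S_def by blast
    qed
    show "S j \<subseteq> S (Suc j)" for j by (auto simp: S_def)
    show "S j \<subseteq> \<psi> ` {y. \<forall>b\<ge>j. y b = 0}" for j by (auto simp: S_def)
    show "spans (S j) \<subseteq> secant_variety (toric_variety u)" for j
      using join_point_secant[OF nonneg origin axes, of ?\<kappa>] \<kappa> by (auto simp: S_def \<psi>_def)
    show "prime_cone (S j)" for j
    proof (rule prime_cone_curves)
      fix a b assume "a \<in> S j" "b \<in> S j"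
      then obtain y z where y: "a = \<psi> y" "admissible u ?\<kappa> (\<theta> y)" "\<forall>b\<ge>j. y b = 0"
        and z: "b = \<psi> z" "admissible u ?\<kappa> (\<theta> z)" "\<forall>b\<ge>j. z b = 0" by (auto simp: S_def)
      define \<Theta> where "\<Theta> m = [:\<theta> y m, \<theta> z m - \<theta> y m:]" for m
      \<comment> \<open>A line in parameter space stays admissible for almost all parameters, so
        \<open>prime_cone_curves\<close> applies.\<close>
      define line where "line \<tau> b = y b + \<tau> * (z b - y b)" for \<tau> b
      have \<Theta>: "(\<lambda>m. poly (\<Theta> m) \<tau>) = \<theta> (line \<tau>)" for \<tau>
        by (simp add: \<Theta>_def \<theta>_def line_def fun_eq_iff algebra_simps sum.distrib sum_subtractf sum_distrib_left)
      have "line 0 = y" "line 1 = z" by (simp_all add: line_def fun_eq_iff)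
      then have ends: "(\<lambda>m. poly (\<Theta> m) 0) = \<theta> y" "(\<lambda>m. poly (\<Theta> m) 1) = \<theta> z" by (simp_all add: \<Theta>)
      have "finite {\<tau>. \<not> admissible u ?\<kappa> (\<lambda>m. poly (\<Theta> m) \<tau>)}"
        by (rule admissible_cofinite[of _ _ _ 0]) (use y ends in simp)
      moreover have "{\<tau>. join_point u ?\<kappa> (\<lambda>m. poly (\<Theta> m) \<tau>) \<notin> S j} \<subseteq> {\<tau>. \<not> admissible u ?\<kappa> (\<lambda>m. poly (\<Theta> m) \<tau>)}"
      proof
        fix \<tau> assume "\<tau> \<in> {\<tau>. join_point u ?\<kappa> (\<lambda>m. poly (\<Theta> m) \<tau>) \<notin> S j}"
        then have "\<psi> (line \<tau>) \<notin> S j" by (simp add: \<psi>_def \<Theta>)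
        moreover have "\<forall>b\<ge>j. line \<tau> b = 0" using y z by (simp add: line_def)
        ultimately show "\<tau> \<in> {\<tau>. \<not> admissible u ?\<kappa> (\<lambda>m. poly (\<Theta> m) \<tau>)}" unfolding S_def \<Theta> by blast
      qed
      ultimately have "finite {\<tau>. join_point u ?\<kappa> (\<lambda>m. poly (\<Theta> m) \<tau>) \<notin> S j}" by (rule finite_subset[rotated])
      then show "\<exists>\<gamma>. (\<chi> i. poly (\<gamma> i) 0) = a \<and> (\<chi> i. poly (\<gamma> i) 1) = b \<and>
          finite {\<tau>. (\<chi> i. poly (\<gamma> i) \<tau>) \<notin> S j}"
        using y z ends by (intro exI[of _ "join_poly u ?\<kappa> \<Theta>"]) (simp add: poly_join_poly \<psi>_def)
    qed
    show "independent_forms (S j) (j * q) (q ^ j)" if "j \<le> r" "0 < q" for j q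
      unfolding S_def \<psi>_def
      by (rule independent_forms_join[OF nonneg \<kappa> \<theta>_def, where l = l]) (use that v l eI einj in auto)
  qed
qed


section \<open>Smooth lattice configurations\<close>

abbreviation unit_vec :: "'n::finite \<Rightarrow> int ^ 'n" where "unit_vec k \<equiv> axis k 1"

definition height :: "int ^ 'n::finite \<Rightarrow> int" where "height x = (\<Sum>k\<in>UNIV. x $ k)"

text \<open>Dual form of the statement that \<open>B\<close> affinely spans the space; such a set
  supplies \<open>n + 1\<close> independent rows of the differential.\<close>

definition aff_generic :: "(int ^ 'n::finite) set \<Rightarrow> bool" where
  "aff_generic B \<longleftrightarrow> (\<forall>f. (\<forall>x\<in>B. aff f x = 0) \<longrightarrow> f = (\<lambda>_. 0))"

text \<open>Dual form of affine independence, which directly provides the functions needed in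
  \<open>tangent_rows_independent\<close>.\<close>

definition aff_indep :: "(int ^ 'n::finite) set \<Rightarrow> bool" where
  "aff_indep B \<longleftrightarrow> (\<forall>p\<in>B. \<exists>f. \<forall>q\<in>B. aff f q = (if q = p then 1 else 0))"

lemma unit_vec_nth: "unit_vec j $ k = (if k = j then 1 else 0)"
  by (simp add: axis_def)

lemma height_add: "height (x + y) = height x + height y"
  by (simp add: height_def sum.distrib)

lemma height_scale: "height (c *s x) = c * height x"
  by (simp add: height_def sum_distrib_left)

lemma height_unit_vec [simp]: "height (unit_vec k) = 1"
  by (simp add: height_def unit_vec_nth)

lemma height_zero [simp]: "height 0 = 0"
  by (simp add: height_def)

lemma height_sum: "height (\<Sum>a\<in>S. f a) = (\<Sum>a\<in>S. height (f a))"
  by (induction S rule: infinite_finite_induct) (auto simp: height_add)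

lemma nonneg_height_0:
  assumes "\<And>k. 0 \<le> x $ k" "height x \<le> 0" shows "x = 0"
proof -
  have "height x = 0" using assms unfolding height_def by (meson antisym sum_nonneg)
  then show ?thesis using assms by (simp add: height_def sum_nonneg_eq_0_iff vec_eq_iff)
qed

lemma nonneg_decrease:
  assumes "\<And>k. 0 \<le> x $ k" "height x \<ge> 1"
  shows "\<exists>j y. x = unit_vec j + y \<and> (\<forall>k. 0 \<le> y $ k) \<and> height y = height x - 1"
proof -
  have "\<exists>j. x $ j \<noteq> 0"
  proof (rule ccontr)
    assume "\<nexists>j. x $ j \<noteq> 0"
    then have "height x = 0" by (simp add: height_def)
    then show False using assms by simp
  qed
  then obtain j where "x $ j \<noteq> 0" by blast
  then have "0 < x $ j" using assms(1)[of j] by simp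
  then have "\<forall>k. 0 \<le> (x - unit_vec j) $ k" using assms(1) by (auto simp: unit_vec_nth)
  moreover have "x = unit_vec j + (x - unit_vec j)" by simp
  moreover from this have "height (x - unit_vec j) = height x - 1"
    by (metis add_diff_cancel_left' height_add height_unit_vec)
  ultimately show ?thesis by blast
qed

lemma nonneg_height_1:
  assumes "\<And>k. 0 \<le> x $ k" "height x = 1" shows "\<exists>j. x = unit_vec j"
  using nonneg_decrease[OF assms(1)] assms(2) nonneg_height_0 by (metis add.right_neutral diff_self order_refl)

lemma nonneg_height_2:
  assumes "\<And>k. 0 \<le> x $ k" "height x = 2" shows "\<exists>j k. x = unit_vec j + unit_vec k"
proof -
  obtain j y where "x = unit_vec j + y" "\<forall>k. 0 \<le> y $ k" "height y = 1"
    using nonneg_decrease[OF assms(1)] assms(2) by auto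
  then show ?thesis using nonneg_height_1[of y] by blast
qed

lemma unit_vec_expand: "x = (\<Sum>k\<in>UNIV. x $ k *s unit_vec k)" for x :: "int ^ 'n::finite"
  by (simp add: vec_eq_iff unit_vec_nth if_distrib[of "\<lambda>c. _ * c"] cong: if_cong)

definition lin_part :: "('n::finite option \<Rightarrow> complex) \<Rightarrow> int ^ 'n \<Rightarrow> complex" where
  "lin_part f x = (\<Sum>k\<in>UNIV. f (Some k) * of_int (x $ k))"

lemma aff_lin_part: "aff f x = f None + lin_part f x"
  by (simp add: aff_def lin_part_def)

lemma lin_part_add: "lin_part f (x + y) = lin_part f x + lin_part f y"
  by (simp add: lin_part_def algebra_simps sum.distrib)

lemma lin_part_scale: "lin_part f (c *s x) = of_int c * lin_part f x"
  by (simp add: lin_part_def sum_distrib_left mult_ac)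

lemma lin_part_sum: "lin_part f (\<Sum>a\<in>S. g a) = (\<Sum>a\<in>S. lin_part f (g a))"
  by (induction S rule: infinite_finite_induct) (auto simp: lin_part_add, simp_all add: lin_part_def)

lemma lin_part_unit_vec [simp]: "lin_part f (unit_vec k) = f (Some k)"
  by (simp add: lin_part_def unit_vec_nth if_distrib[of of_int] if_distrib[of "\<lambda>c. _ * c"] cong: if_cong)

lemmas lin_part_simps = aff_lin_part lin_part_add lin_part_scale

lemma aff_zeroI: "f None = 0 \<Longrightarrow> (\<And>k. f (Some k) = 0) \<Longrightarrow> f = (\<lambda>_. 0)"
  by (metis ext option.exhaust)

text \<open>
  \<open>V\<close> is the set of vertices of \<open>conv A\<close>, \<open>G v\<close> the set of first lattice vectors along the edges
  at \<open>v\<close>, and \<open>\<beta> v\<close> the basis dual to \<open>G v\<close>.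
\<close>

locale smooth_config =
  fixes A V :: "(int ^ 'n::finite) set" and G :: "int ^ 'n \<Rightarrow> (int ^ 'n) set"
    and \<beta> :: "int ^ 'n \<Rightarrow> int ^ 'n \<Rightarrow> int ^ 'n \<Rightarrow> int"
  assumes finite_A: "finite A"
    and V_subset: "V \<subseteq> A"
    and finite_G: "v \<in> V \<Longrightarrow> finite (G v)"
    and \<beta>_add: "v \<in> V \<Longrightarrow> g \<in> G v \<Longrightarrow> \<beta> v g (x + y) = \<beta> v g x + \<beta> v g y"
    and \<beta>_scale: "v \<in> V \<Longrightarrow> g \<in> G v \<Longrightarrow> \<beta> v g (c *s x) = c * \<beta> v g x"
    and dual: "v \<in> V \<Longrightarrow> g \<in> G v \<Longrightarrow> h \<in> G v \<Longrightarrow> \<beta> v g h = (if g = h then 1 else 0)"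
    and expand: "v \<in> V \<Longrightarrow> x = (\<Sum>g\<in>G v. \<beta> v g x *s g)"
    and cone: "v \<in> V \<Longrightarrow> g \<in> G v \<Longrightarrow> x \<in> A \<Longrightarrow> 0 \<le> \<beta> v g (x - v)"
    and neighbor: "v \<in> V \<Longrightarrow> g \<in> G v \<Longrightarrow> v + g \<in> A"
    and edge: "v \<in> V \<Longrightarrow> g \<in> G v \<Longrightarrow> \<exists>l>0. v + l *s g \<in> V \<and> - g \<in> G (v + l *s g)"
begin

lemma \<beta>_minus: "v \<in> V \<Longrightarrow> g \<in> G v \<Longrightarrow> \<beta> v g (- x) = - \<beta> v g x"
proof -
  assume "v \<in> V" "g \<in> G v"
  moreover have "(-1) *s x = - x" by (simp add: vec_eq_iff)
  ultimately show ?thesis using \<beta>_scale[of v g "-1" x] by simp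
qed

lemma \<beta>_diff: "v \<in> V \<Longrightarrow> g \<in> G v \<Longrightarrow> \<beta> v g (x - y) = \<beta> v g x - \<beta> v g y"
  using \<beta>_add[of v g x "- y"] \<beta>_minus by simp

lemmas \<beta>_simps = \<beta>_add \<beta>_scale \<beta>_minus \<beta>_diff

lemma expand_nth: "v \<in> V \<Longrightarrow> x $ k = (\<Sum>g\<in>G v. \<beta> v g x * g $ k)"
  by (subst expand[of v x]) auto

lemma lin_part_zeroI:
  assumes "v \<in> V" "\<And>g. g \<in> G v \<Longrightarrow> lin_part f g = 0" "aff f v = 0"
  shows "f = (\<lambda>_. 0)"
proof -
  have lin: "lin_part f x = 0" for x
    by (subst expand[OF assms(1), of x]) (simp add: lin_part_sum lin_part_scale assms(2))
  show ?thesis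
  proof (rule aff_zeroI)
    show "f None = 0" using assms(3) lin by (simp add: aff_lin_part)
    show "f (Some k) = 0" for k using lin[of "unit_vec k"] by simp
  qed
qed

end

section \<open>Configurations with a vertex at the origin and the unit vectors as its
  neighbors\<close>

locale based_config = smooth_config A V G \<beta>
  for A V :: "(int ^ 'n::finite) set" and G :: "int ^ 'n \<Rightarrow> (int ^ 'n) set"
    and \<beta> :: "int ^ 'n \<Rightarrow> int ^ 'n \<Rightarrow> int ^ 'n \<Rightarrow> int" +
  assumes origin: "0 \<in> V" and G_origin: "G 0 = range unit_vec"
begin

lemma unit_vec_in_A: "unit_vec k \<in> A"
  using neighbor[OF origin, of "unit_vec k"] by (simp add: G_origin)

lemma origin_in_A: "0 \<in> A"
  using origin V_subset by blast

lemma nonneg: "x \<in> A \<Longrightarrow> 0 \<le> x $ k"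
proof -
  assume x: "x \<in> A"
  have inj: "inj (\<lambda>k::'n. unit_vec k)" by (auto simp: inj_def axis_eq_axis)
  have "x $ k = (\<Sum>j\<in>UNIV. \<beta> 0 (unit_vec j) x * unit_vec j $ k)"
    using expand_nth[OF origin, of x k] by (simp add: G_origin sum.reindex[OF inj])
  also have "\<dots> = \<beta> 0 (unit_vec k) x"
    by (simp add: unit_vec_nth if_distrib[of "\<lambda>c. _ * c"] cong: if_cong)
  finally show ?thesis using cone[OF origin, of "unit_vec k" x] x by (simp add: G_origin)
qed

definition far :: "(int ^ 'n) set" where
  "far = A - insert 0 (range unit_vec)"

text \<open>The cone at the origin is the nonnegative orthant, whose only lattice points below
  height 2 are the origin and the unit vectors.\<close>

lemma far_iff: "x \<in> far \<longleftrightarrow> x \<in> A \<and> 2 \<le> height x"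
proof
  assume x: "x \<in> far"
  then have "x \<in> A" by (simp add: far_def)
  moreover have "\<not> height x \<le> 0" using nonneg_height_0[of x] nonneg x by (auto simp: far_def)
  moreover have "height x \<noteq> 1" using nonneg_height_1[of x] nonneg x by (auto simp: far_def)
  ultimately show "x \<in> A \<and> 2 \<le> height x" by linarith
qed (auto simp: far_def)

text \<open>Passing to the other end \<open>v\<close> of an edge keeps the 2-dimensional faces along
  it. Edge vectors at \<open>v\<close> are nonnegative off coordinate \<open>i\<close>, and
  \<open>unit_vec j - v\<close> is a nonnegative integer combination of them. Its single coordinate
  1 off \<open>i\<close> must come from one edge vector, of the form
  \<open>unit_vec j + c *s unit_vec i\<close>; the coordinate \<open>\<phi>\<close> dual to
  \<open>- unit_vec i\<close> reads off \<open>c\<close>.\<close>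

lemma opposite_vertex:
  assumes v: "l *s unit_vec i \<in> V" "- unit_vec i \<in> G (l *s unit_vec i)"
  shows "\<exists>\<phi>. (\<forall>x y. \<phi> (x + y) = \<phi> x + \<phi> y) \<and> (\<forall>c x. \<phi> (c *s x) = c * \<phi> x) \<and> \<phi> (unit_vec i) = -1 \<and>
    (\<forall>j. j \<noteq> i \<longrightarrow> unit_vec j + \<phi> (unit_vec j) *s unit_vec i \<in> G (l *s unit_vec i)) \<and> (\<forall>x\<in>A. 0 \<le> l + \<phi> x)"
proof -
  define v where "v = l *s (unit_vec i :: int ^ 'n)"
  have V: "v \<in> V" and ei: "- unit_vec i \<in> G v" using v by (auto simp: v_def)
  have g_nonneg: "0 \<le> g $ k" if "g \<in> G v" "k \<noteq> i" for g k
    using nonneg[OF neighbor[OF V that(1)], of k] that(2) by (simp add: v_def unit_vec_nth)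
  have ex: "\<exists>c. unit_vec j + c *s unit_vec i \<in> G v" if j: "j \<noteq> i" for j
  proof -
    define n where "n g = \<beta> v g (unit_vec j - v)" for g
    have n: "0 \<le> n g" if "g \<in> G v" for g using cone[OF V that unit_vec_in_A] by (simp add: n_def)
    have sum: "(\<Sum>g\<in>G v. n g * g $ k) = (if k = j then 1 else 0)" if "k \<noteq> i" for k
      using expand_nth[OF V, of "unit_vec j - v" k] that by (simp add: n_def v_def unit_vec_nth)
    obtain g where g: "g \<in> G v" "n g * g $ j > 0"
    proof -
      have "\<not> (\<forall>g\<in>G v. n g * g $ j \<le> 0)" using sum[OF j] sum_nonpos[of "G v" "\<lambda>g. n g * g $ j"] by auto
      then show ?thesis using that by force
    qed
    have le: "n g * g $ k \<le> (if k = j then 1 else 0)" if "k \<noteq> i" for k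
      using member_le_sum[of g "G v" "\<lambda>g. n g * g $ k"] finite_G[OF V] g n g_nonneg that sum[OF that] by auto
    have "n g * g $ j = 1" using le[OF j] g by simp
    then have ng: "n g = 1" "g $ j = 1" using n[OF g(1)] by (auto simp: zmult_eq_1_iff)
    have "g $ k = 0" if "k \<noteq> i" "k \<noteq> j" for k
      using le[OF that(1)] that ng g_nonneg[OF g(1) that(1)] by simp
    then have "g = unit_vec j + g $ i *s unit_vec i"
      using ng j by (auto simp: vec_eq_iff unit_vec_nth)
    then show ?thesis using g by metis
  qed
  define \<phi> where "\<phi> = \<beta> v (- unit_vec i)"
  have \<phi>: "\<phi> (x + y) = \<phi> x + \<phi> y" "\<phi> (c *s x) = c * \<phi> x" "\<phi> (- x) = - \<phi> x" "\<phi> (x - y) = \<phi> x - \<phi> y" for x y c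
    using \<beta>_simps[OF V ei] by (simp_all add: \<phi>_def)
  have \<phi>i: "\<phi> (unit_vec i) = -1"
    using dual[OF V ei ei] \<phi>(3)[of "unit_vec i"] by (simp add: \<phi>_def)
  have "unit_vec j + \<phi> (unit_vec j) *s unit_vec i \<in> G v" if j: "j \<noteq> i" for j
  proof -
    obtain c where c: "unit_vec j + c *s unit_vec i \<in> G v" using ex[OF j] by blast
    have "- unit_vec i \<noteq> unit_vec j + c *s (unit_vec i :: int ^ 'n)"
      using j by (auto simp: vec_eq_iff unit_vec_nth intro!: exI[of _ j])
    then have "\<phi> (unit_vec j + c *s unit_vec i) = 0" using dual[OF V ei c] by (simp add: \<phi>_def)
    then have "\<phi> (unit_vec j) = c" by (simp add: \<phi> \<phi>i)
    then show ?thesis using c by simp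
  qed
  moreover have "0 \<le> l + \<phi> x" if "x \<in> A" for x
  proof -
    have "\<phi> (x - v) = \<phi> x + l" by (simp add: v_def \<phi> \<phi>i)
    then show ?thesis using cone[OF V ei that] by (simp add: \<phi>_def)
  qed
  ultimately show ?thesis using \<phi> \<phi>i unfolding v_def by blast
qed

text \<open>The point \<open>unit_vec i + unit_vec k\<close> tests all edge coordinates except that
  of \<open>- unit_vec l\<close>, and the other point tests this one. So \<open>unit_vec i\<close>
  is a direction of the cone at the far corner of a square.\<close>

lemma square_cone:
  assumes v: "unit_vec k + unit_vec l \<in> V" "- unit_vec k \<in> G (unit_vec k + unit_vec l)"
      "- unit_vec l \<in> G (unit_vec k + unit_vec l)"
    and kl: "k \<noteq> l" and i: "unit_vec i + unit_vec k \<in> A" "unit_vec i + unit_vec l \<in> A"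
    and g: "g \<in> G (unit_vec k + unit_vec l)"
  shows "0 \<le> \<beta> (unit_vec k + unit_vec l) g (unit_vec i)"
proof -
  define v where "v = unit_vec k + (unit_vec l :: int ^ 'n)"
  note V = v[folded v_def] and g' = g[folded v_def]
  have ne: "- unit_vec k \<noteq> - (unit_vec l :: int ^ 'n)" using kl by (simp add: axis_eq_axis)
  show ?thesis
  proof (cases "g = - unit_vec l")
    case False
    have "0 \<le> \<beta> v g (unit_vec i + unit_vec k - v)" using cone[OF V(1) g' i(1)] .
    also have "unit_vec i + unit_vec k - v = unit_vec i + - unit_vec l" by (simp add: v_def)
    also have "\<beta> v g \<dots> = \<beta> v g (unit_vec i) + \<beta> v g (- unit_vec l)" by (rule \<beta>_add[OF V(1) g'])
    also have "\<beta> v g (- unit_vec l) = 0" using dual[OF V(1) g' V(3)] False by simp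
    finally show ?thesis by (simp add: v_def)
  next
    case True
    have "0 \<le> \<beta> v g (unit_vec i + unit_vec l - v)" using cone[OF V(1) g' i(2)] .
    also have "unit_vec i + unit_vec l - v = unit_vec i + - unit_vec k" by (simp add: v_def)
    also have "\<beta> v g \<dots> = \<beta> v g (unit_vec i) + \<beta> v g (- unit_vec k)" by (rule \<beta>_add[OF V(1) g'])
    also have "\<beta> v g (- unit_vec k) = 0" using dual[OF V(1) g' V(2)] True ne by auto
    finally show ?thesis by (simp add: v_def)
  qed
qed

end

text \<open>\<open>l i\<close> is the length of the edge from the origin in direction
  \<open>i\<close>, and \<open>l i + \<phi> i x \<ge> 0\<close> is the half space of the facet that
  meets this edge only at its far end.\<close>

locale edge_config = based_config A V G \<beta>
  for A V :: "(int ^ 'n::finite) set" and G :: "int ^ 'n \<Rightarrow> (int ^ 'n) set"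
    and \<beta> :: "int ^ 'n \<Rightarrow> int ^ 'n \<Rightarrow> int ^ 'n \<Rightarrow> int" +
  fixes l :: "'n \<Rightarrow> int" and \<phi> :: "'n \<Rightarrow> int ^ 'n \<Rightarrow> int"
  assumes l_pos: "0 < l i"
    and end_vertex: "l i *s unit_vec i \<in> V" "- unit_vec i \<in> G (l i *s unit_vec i)"
    and \<phi>_add: "\<phi> i (x + y) = \<phi> i x + \<phi> i y"
    and \<phi>_scale: "\<phi> i (c *s x) = c * \<phi> i x"
    and \<phi>_self: "\<phi> i (unit_vec i) = -1"
    and end_neighbor: "j \<noteq> i \<Longrightarrow> unit_vec j + \<phi> i (unit_vec j) *s unit_vec i \<in> G (l i *s unit_vec i)"
    and half_space: "x \<in> A \<Longrightarrow> 0 \<le> l i + \<phi> i x"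
begin

lemmas \<phi>_simps = \<phi>_add \<phi>_scale \<phi>_self

text \<open>
  In the two-dimensional face with directions \<open>i\<close> and \<open>j\<close>, the neighbor of the vertex
  \<open>l i *s unit_vec i\<close> other than the one towards \<open>0\<close> is \<open>unit_vec j + d i j *s unit_vec i\<close>. Thus
  \<open>d i j = 0\<close> for a triangle, and \<open>d i j = 1\<close> if \<open>l i = 1\<close> and the face is a parallelogram.
\<close>

definition d :: "'n \<Rightarrow> 'n \<Rightarrow> int" where "d i j = l i + \<phi> i (unit_vec j)"

lemma end_in_A: "l i *s unit_vec i \<in> A"
  using end_vertex V_subset by blast

lemma before_end_in_A: "(l i - 1) *s unit_vec i \<in> A"
proof -
  have "l i *s unit_vec i + - unit_vec i = (l i - 1) *s (unit_vec i :: int ^ 'n)"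
    by (simp add: vec_eq_iff algebra_simps)
  then show ?thesis using neighbor[OF end_vertex] by metis
qed

lemma end_neighbor_in_A:
  assumes "j \<noteq> i" shows "unit_vec j + d i j *s unit_vec i \<in> A"
proof -
  have "l i *s unit_vec i + (unit_vec j + \<phi> i (unit_vec j) *s unit_vec i) = unit_vec j + d i j *s (unit_vec i :: int ^ 'n)"
    by (simp add: vec_eq_iff d_def algebra_simps)
  then show ?thesis using neighbor[OF end_vertex(1) end_neighbor[OF assms]] by metis
qed

lemma d_nonneg: "j \<noteq> i \<Longrightarrow> 0 \<le> d i j"
  using nonneg[OF end_neighbor_in_A, of j i i] by (simp add: unit_vec_nth)

text \<open>An edge of length at least 2 is not part of a triangular face, by smoothness at the apex.\<close>

lemma d_pos:
  assumes "2 \<le> l i" "j \<noteq> i" shows "1 \<le> d i j"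
proof (rule ccontr)
  assume "\<not> 1 \<le> d i j"
  then have \<phi>ij: "\<phi> i (unit_vec j) = - l i" using d_nonneg[OF assms(2)] by (simp add: d_def)
  \<comment> \<open>Each inequality evaluates the half space at the end of one edge at the end of
    the other edge or at a neighbor of that end.\<close>
  have "0 \<le> l i + l j * (- l i)"
    using half_space[OF end_in_A[of j], of i] by (simp add: \<phi>_simps \<phi>ij)
  then have "l i * (l j - 1) \<le> 0" by (simp add: algebra_simps)
  then have lj: "l j = 1" using assms l_pos[of j] by (simp add: mult_le_0_iff)
  have "0 \<le> l i + (-1 + d j i * (- l i))"
    using half_space[OF end_neighbor_in_A[of i j], of i] assms(2) by (simp add: \<phi>_simps \<phi>ij)
  then have "l i * d j i < l i" by (simp add: algebra_simps)
  then have "d j i < 1" using assms by simp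
  then have "d j i = 0" using d_nonneg[of i j] assms(2) by simp
  then have "\<phi> j (unit_vec i) = -1" using lj by (simp add: d_def)
  then show False using half_space[OF end_in_A[of i], of j] assms lj by (simp add: \<phi>_simps)
qed

text \<open>Two points of the edge lie in \<open>far\<close> and kill the constant and the
  coefficient of \<open>i\<close>; \<open>d_pos\<close> puts the end neighbors into
  \<open>far\<close>, and they kill the other coefficients.\<close>

lemma generic_of_long_edge:
  assumes "3 \<le> l i" shows "aff_generic far"
  unfolding aff_generic_def
proof (intro allI impI)
  fix f assume f: "\<forall>x\<in>far. aff f x = 0"
  have "l i *s unit_vec i \<in> far" "(l i - 1) *s unit_vec i \<in> far"
    using end_in_A[of i] before_end_in_A[of i] assms unfolding far_iff height_scale height_unit_vec by auto
  then have "f None + of_int (l i) * f (Some i) = 0" "f None + of_int (l i - 1) * f (Some i) = 0"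
    using f by (auto simp only: lin_part_simps lin_part_unit_vec)
  then have z: "f (Some i) = 0" "f None = 0" by (auto simp: algebra_simps)
  moreover have "f (Some j) = 0" if j: "j \<noteq> i" for j
  proof -
    have "unit_vec j + d i j *s unit_vec i \<in> far"
      using end_neighbor_in_A[OF j] d_pos[OF _ j] assms by (simp add: far_iff height_add height_scale)
    then show ?thesis using f z by (auto simp: lin_part_simps)
  qed
  ultimately show "f = (\<lambda>_. 0)" by (intro aff_zeroI) metis+
qed

text \<open>If \<open>far\<close> lies in a hyperplane, the points forced by the edge of length 2
  determine its equation in terms of the \<open>d i j\<close>. Integrality then gives
  \<open>d i j = 1\<close>, so the equation says that the height is 2.\<close>

lemma edge_of_length_2:
  assumes l: "\<And>j. l j \<le> 2" "l i = 2" and nongen: "\<not> aff_generic far"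
  shows "x \<in> far \<Longrightarrow> height x = 2" "unit_vec i + unit_vec j \<in> A"
proof -
  obtain f where f: "\<And>x. x \<in> far \<Longrightarrow> aff f x = 0" "f \<noteq> (\<lambda>_. 0)"
    using nongen by (auto simp: aff_generic_def)
  have pij: "unit_vec j + d i j *s unit_vec i \<in> far" if "j \<noteq> i" for j
    using end_neighbor_in_A[OF that] d_pos[OF _ that] l by (simp add: far_iff height_add height_scale)
  have "2 *s unit_vec i \<in> far" using end_in_A[of i] l by (simp add: far_iff height_scale)
  then have f0: "f None = - 2 * f (Some i)" using f(1) by (fastforce simp: lin_part_simps eq_neg_iff_add_eq_0)
  have fj: "f (Some j) = of_int (2 - d i j) * f (Some i)" if "j \<noteq> i" for j
    using f(1)[OF pij[OF that]] f0 by (simp add: lin_part_simps algebra_simps)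
  have fi: "f (Some i) \<noteq> 0"
  proof
    assume "f (Some i) = 0"
    then have "f = (\<lambda>_. 0)" using f0 fj by (intro aff_zeroI) (simp, metis mult_zero_right)
    then show False using f by simp
  qed
  have d1: "d i j = 1" if j: "j \<noteq> i" for j
  proof -
    have "l j = 1 \<or> l j = 2" using l(1)[of j] l_pos[of j] by linarith
    then show ?thesis
    proof
      assume "l j = 2"
      then have "2 *s unit_vec j \<in> far" using end_in_A[of j] by (simp add: far_iff height_scale)
      then have "f None + 2 * f (Some j) = 0" using f(1) by (fastforce simp: lin_part_simps)
      then have "of_int (2 - 2 * d i j) * f (Some i) = 0" using f0 fj[OF j] by (simp add: algebra_simps)
      then show ?thesis using fi by simp
    next
      assume lj: "l j = 1"
      have "d j i \<noteq> 0"
      proof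
        assume "d j i = 0"
        then have "\<phi> j (unit_vec i) = -1" using lj by (simp add: d_def)
        then show False using half_space[OF end_in_A[of i], of j] l lj by (simp add: \<phi>_simps)
      qed
      then have dji: "1 \<le> d j i" using d_nonneg[of i j] j by simp
      then have "unit_vec i + d j i *s unit_vec j \<in> far"
        using end_neighbor_in_A[of i j] j by (simp add: far_iff height_add height_scale)
      from f(1)[OF this] have "f None + f (Some i) + of_int (d j i) * f (Some j) = 0"
        by (simp add: lin_part_simps add.assoc)
      then have "of_int (d j i * (2 - d i j) - 1) * f (Some i) = 0" using f0 fj[OF j] by (simp add: algebra_simps)
      then have "d j i * (2 - d i j) - 1 = 0" using fi by (metis mult_eq_0_iff of_int_eq_0_iff)
      then have "d j i * (2 - d i j) = 1" by simp
      then show ?thesis using dji by (auto simp: zmult_eq_1_iff)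
    qed
  qed
  show "unit_vec i + unit_vec j \<in> A"
  proof (cases "j = i")
    case True
    have "unit_vec i + unit_vec i = 2 *s (unit_vec i :: int ^ 'n)" by (simp add: vec_eq_iff)
    then show ?thesis using end_in_A[of i] l True by simp
  next
    case False
    then show ?thesis using end_neighbor_in_A[OF False] d1[OF False] by (simp add: add.commute)
  qed
  assume x: "x \<in> far"
  have "f (Some k) = f (Some i)" for k using fj[of k] d1[of k] by (cases "k = i") auto
  then have "lin_part f x = (\<Sum>k\<in>UNIV. f (Some i) * of_int (x $ k))"
    unfolding lin_part_def by (intro sum.cong) metis+
  then have "lin_part f x = f (Some i) * of_int (height x)"
    by (simp add: height_def sum_distrib_left)
  then have "f (Some i) * of_int (height x - 2) = 0"
    using f(1)[OF x] f0 by (simp add: aff_lin_part algebra_simps)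
  then show "height x = 2" using fi by simp
qed

lemma quadric_edges:
  assumes l: "\<And>j. l j \<le> 2" "l i = 2" and nongen: "\<not> aff_generic far"
  shows "unit_vec j + unit_vec k \<in> A \<longleftrightarrow> l j = 2 \<or> l k = 2"
proof
  assume "l j = 2 \<or> l k = 2"
  then show "unit_vec j + unit_vec k \<in> A"
    using edge_of_length_2(2)[OF l(1) _ nongen] by (metis add.commute)
next
  note height2 = edge_of_length_2(1)[OF l nongen]
  have height_le: "height x \<le> 2" if "x \<in> A" for x
    using height2[of x] that by (cases "2 \<le> height x") (auto simp: far_iff)
  assume jk: "unit_vec j + unit_vec k \<in> A"
  show "l j = 2 \<or> l k = 2"
  proof (rule ccontr)
    assume "\<not> ?thesis"
    then have lj: "l j = 1" and lk: "l k = 1" using l(1)[of j] l(1)[of k] l_pos[of j] l_pos[of k] by auto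
    have ne: "j \<noteq> k"
    proof
      assume "j = k"
      then have "0 \<le> l j + (\<phi> j (unit_vec j) + \<phi> j (unit_vec j))"
        using half_space[OF jk, of j] by (simp only: \<phi>_add)
      then show False using lj by (simp add: \<phi>_self)
    qed
    \<comment> \<open>The half space at \<open>unit_vec a\<close> gives
      \<open>\<phi> a (unit_vec b) \<ge> 0\<close> and the height bound gives the opposite. So an
      edge leaves \<open>unit_vec a\<close> in direction \<open>unit_vec b\<close>, and the height
      bound limits its length to 1.\<close>
    have corner: "unit_vec a + unit_vec b \<in> V \<and> - unit_vec b \<in> G (unit_vec a + unit_vec b)"
      if ab: "a \<noteq> b" "l a = 1" "unit_vec a + unit_vec b \<in> A" for a b
    proof -
      have "0 \<le> \<phi> a (unit_vec b)" using half_space[OF ab(3), of a] ab by (simp add: \<phi>_simps)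
      moreover have "height (unit_vec b + d a b *s (unit_vec a :: int ^ 'n)) \<le> 2"
        using ab by (intro height_le end_neighbor_in_A) auto
      ultimately have "\<phi> a (unit_vec b) = 0" using ab by (simp add: height_add height_scale d_def)
      then have G: "unit_vec b \<in> G (unit_vec a)" and Va: "unit_vec a \<in> V"
        using end_neighbor[of b a] end_vertex[of a] ab by auto
      obtain m where m: "0 < m" "unit_vec a + m *s unit_vec b \<in> V" "- unit_vec b \<in> G (unit_vec a + m *s unit_vec b)"
        using edge[OF Va G] by blast
      have "height (unit_vec a + m *s (unit_vec b :: int ^ 'n)) \<le> 2" using m V_subset by (intro height_le) auto
      then have "m = 1" using m by (simp add: height_add height_scale)
      then show ?thesis using m by simp
    qed
    define v where "v = unit_vec j + (unit_vec k :: int ^ 'n)"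
    have v: "v \<in> V" "- unit_vec k \<in> G v" using corner[OF ne lj jk] by (auto simp: v_def)
    have vj: "- unit_vec j \<in> G v" using corner[of k j] ne lk jk by (auto simp: v_def add.commute)
    \<comment> \<open>The cone at \<open>v\<close> contains \<open>unit_vec i\<close>, although no point of \<open>A\<close> is higher than \<open>v\<close>.\<close>
    have pos: "0 \<le> \<beta> v g (unit_vec i)" if "g \<in> G v" for g
      unfolding v_def using v vj that edge_of_length_2(2)[OF l nongen] ne
      by (intro square_cone) (auto simp: v_def)
    have "1 = height (\<Sum>g\<in>G v. \<beta> v g (unit_vec i) *s g)"
      using expand[OF v(1), of "unit_vec i"] height_unit_vec[of i] by simp
    also have "\<dots> = (\<Sum>g\<in>G v. \<beta> v g (unit_vec i) * height g)" by (simp add: height_sum height_scale)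
    also have "\<dots> \<le> 0"
    proof (rule sum_nonpos)
      fix g assume g: "g \<in> G v"
      have "height (v + g) \<le> 2" using neighbor[OF v(1) g] by (rule height_le)
      then have "height g \<le> 0" by (simp add: v_def height_add)
      then show "\<beta> v g (unit_vec i) * height g \<le> 0" using pos[OF g] by (simp add: mult_nonneg_nonpos)
    qed
    finally show False by simp
  qed
qed

text \<open>With \<open>S\<close> the directions of long edges, \<open>far\<close> consists of the
  sums of two unit vectors at least one of which has its index in \<open>S\<close>. A single long
  edge makes these points affinely independent.\<close>

lemma quadric_case:
  assumes l: "\<And>j. l j \<le> 2" "l i = 2" and nongen: "\<not> aff_generic far"
  shows "aff_indep far \<or> (\<exists>S. 2 \<le> card S \<and>
    A = {x. (\<forall>k. 0 \<le> x $ k) \<and> height x \<le> 2 \<and> (\<Sum>k\<in>- S. x $ k) \<le> 1})"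
proof -
  define S where "S = {j. l j = 2}"
  have iS: "i \<in> S" using l by (simp add: S_def)
  note pair_iff = quadric_edges[OF l nongen]
  have far: "\<exists>j k. j \<in> S \<and> x = unit_vec j + unit_vec k" if x: "x \<in> far" for x
  proof -
    have xA: "x \<in> A" using x by (simp add: far_iff)
    obtain j k where jk: "x = unit_vec j + unit_vec k"
      using nonneg_height_2[of x] nonneg[OF xA] edge_of_length_2(1)[OF l nongen x] by blast
    then have "j \<in> S \<or> k \<in> S" using pair_iff[of j k] xA by (simp add: S_def)
    then show ?thesis using jk add.commute[of "unit_vec j" "unit_vec k"] by metis
  qed
  have "card S \<noteq> 0" using iS by auto
  show ?thesis
  proof (cases "2 \<le> card S")
    case False
    then have "card S = 1" using \<open>card S \<noteq> 0\<close> by linarith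
    then have S: "S = {i}" using iS by (metis card_1_singletonE singletonD)
    have "\<exists>f. \<forall>q\<in>far. aff f q = (if q = p then 1 else 0)" if p: "p \<in> far" for p
    proof -
      obtain k where k: "p = unit_vec i + unit_vec k" using far[OF p] S by auto
      \<comment> \<open>All far points contain \<open>unit_vec i\<close>, and only its double
        contains it twice; the constant -1 accounts for this if \<open>k = i\<close>.\<close>
      define f :: "'n option \<Rightarrow> complex" where
        "f m = (case m of None \<Rightarrow> if k = i then -1 else 0 | Some j \<Rightarrow> if j = k then 1 else 0)" for m
      have "aff f q = (if q = p then 1 else 0)" if q: "q \<in> far" for q
      proof -
        obtain k' where k': "q = unit_vec i + unit_vec k'" using far[OF q] S by auto
        have "q = p \<longleftrightarrow> k' = k" by (simp add: k k' axis_eq_axis)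
        then show ?thesis by (auto simp: k' lin_part_simps f_def)
      qed
      then show ?thesis by blast
    qed
    then show ?thesis by (simp add: aff_indep_def)
  next
    case True
    have "A = {x. (\<forall>k. 0 \<le> x $ k) \<and> height x \<le> 2 \<and> (\<Sum>k\<in>- S. x $ k) \<le> 1}"
    proof (intro equalityI subsetI)
      fix x assume x: "x \<in> A"
      have split: "height x = (\<Sum>k\<in>S. x $ k) + (\<Sum>k\<in>- S. x $ k)"
        unfolding height_def using sum.union_disjoint[of S "- S"] by simp
      have nn: "0 \<le> (\<Sum>k\<in>S. x $ k)" using nonneg[OF x] by (intro sum_nonneg)
      show "x \<in> {x. (\<forall>k. 0 \<le> x $ k) \<and> height x \<le> 2 \<and> (\<Sum>k\<in>- S. x $ k) \<le> 1}"
      proof (cases "x \<in> far")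
        case True
        then obtain j k where jk: "j \<in> S" "x = unit_vec j + unit_vec k" using far by blast
        have "1 \<le> x $ j" using jk by (simp add: unit_vec_nth)
        then have "1 \<le> (\<Sum>k\<in>S. x $ k)" using member_le_sum[of j S "\<lambda>k. x $ k"] jk nonneg[OF x] by auto
        moreover have "height x = 2" using jk by (simp add: height_add)
        ultimately show ?thesis using nonneg[OF x] split by simp
      next
        case False
        then have "height x \<le> 1" using x by (auto simp: far_iff)
        then show ?thesis using nonneg[OF x] split nn by simp
      qed
    next
      fix x assume "x \<in> {x. (\<forall>k. 0 \<le> x $ k) \<and> height x \<le> 2 \<and> (\<Sum>k\<in>- S. x $ k) \<le> 1}"
      then have x: "\<And>k. 0 \<le> x $ k" "height x \<le> 2" "(\<Sum>k\<in>- S. x $ k) \<le> 1" by auto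
      consider "height x \<le> 0" | "height x = 1" | "height x = 2" using x(2) by linarith
      then show "x \<in> A"
      proof cases
        case 1
        then show ?thesis using nonneg_height_0[of x] x origin_in_A by blast
      next
        case 2
        then show ?thesis using nonneg_height_1[of x] x unit_vec_in_A by blast
      next
        case 3
        then obtain j k where jk: "x = unit_vec j + unit_vec k" using nonneg_height_2[of x] x by blast
        have "j \<in> S \<or> k \<in> S"
        proof (rule ccontr)
          assume "\<not> ?thesis"
          then have "(\<Sum>m\<in>- S. x $ m) = 2" by (simp add: jk unit_vec_nth sum.distrib)
          then show False using x by simp
        qed
        then show ?thesis using pair_iff jk by (auto simp: S_def)
      qed
    qed
    then show ?thesis using True by blast
  qed
qed

end

section \<open>Configurations all of whose edges have length 1\<close>

locale unit_edge_config = edge_config A V G \<beta> l \<phi>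
  for A V :: "(int ^ 'n::finite) set" and G :: "int ^ 'n \<Rightarrow> (int ^ 'n) set"
    and \<beta> :: "int ^ 'n \<Rightarrow> int ^ 'n \<Rightarrow> int ^ 'n \<Rightarrow> int" and l \<phi> +
  assumes unit_edge: "v \<in> V \<Longrightarrow> g \<in> G v \<Longrightarrow> v + g \<in> V \<and> - g \<in> G (v + g)"
    and l1: "l i = 1"
begin

lemma unit_vec_in_V: "unit_vec i \<in> V"
  using end_vertex[of i] by (simp add: l1)

lemma d_eq: "d i j = 1 + \<phi> i (unit_vec j)"
  by (simp add: d_def l1)

lemma \<phi>_d: "\<phi> i (unit_vec j) = d i j - 1"
  by (simp add: d_eq)

lemma step_in_G: "j \<noteq> i \<Longrightarrow> unit_vec j + (d i j - 1) *s unit_vec i \<in> G (unit_vec i)"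
  using end_neighbor[of j i] by (simp add: l1 \<phi>_d)

lemma step_in_V:
  assumes "j \<noteq> i"
  shows "unit_vec j + d i j *s unit_vec i \<in> V"
    "- (unit_vec j + (d i j - 1) *s unit_vec i) \<in> G (unit_vec j + d i j *s unit_vec i)"
proof -
  have "unit_vec i + (unit_vec j + (d i j - 1) *s unit_vec i) = unit_vec j + d i j *s (unit_vec i :: int ^ 'n)"
    by (simp add: vec_eq_iff algebra_simps)
  then show "unit_vec j + d i j *s unit_vec i \<in> V"
    "- (unit_vec j + (d i j - 1) *s unit_vec i) \<in> G (unit_vec j + d i j *s unit_vec i)"
    using unit_edge[OF unit_vec_in_V step_in_G[OF assms]] by auto
qed

lemma half_space1: "x \<in> A \<Longrightarrow> 0 \<le> 1 + \<phi> i x"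
  using half_space[of x i] by (simp add: l1)

lemma triangle_sym: "i \<noteq> j \<Longrightarrow> d i j = 0 \<Longrightarrow> d j i = 0"
  using half_space1[OF end_neighbor_in_A[of i j], of i] d_nonneg[of i j] by (simp add: \<phi>_simps \<phi>_d)

text \<open>Together with \<open>triangle_sym\<close> this makes \<open>i = j\<close> or
  \<open>d i j = 0\<close> an equivalence relation on directions, whose classes become the simplex
  factors.\<close>

lemma triangle_trans:
  assumes "i \<noteq> j" "j \<noteq> k" "i \<noteq> k" "d i j = 0" "d j k = 0" shows "d i k = 0"
  using half_space1[OF end_neighbor_in_A[of k i], of j] d_nonneg[of k i] triangle_sym[of i j] assms
  by (simp add: \<phi>_simps \<phi>_d)

text \<open>The fourth corner is a vertex with edge vector \<open>- unit_vec j\<close>, so no point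
  \<open>unit_vec i + t *s unit_vec j\<close> with \<open>t > 1\<close> lies in \<open>A\<close>;
  \<open>triangle_sym\<close> excludes \<open>d j i = 0\<close>.\<close>

lemma square_sym:
  assumes "i \<noteq> j" "d i j = 1" shows "d j i = 1"
proof -
  define v where "v = unit_vec j + (unit_vec i :: int ^ 'n)"
  have v: "v \<in> V" "- unit_vec j \<in> G v" using step_in_V[of j i] assms by (auto simp: v_def)
  have "unit_vec i + d j i *s unit_vec j - v = (1 - d j i) *s (- unit_vec j)"
    by (simp add: vec_eq_iff v_def algebra_simps)
  moreover have "0 \<le> \<beta> v (- unit_vec j) (unit_vec i + d j i *s unit_vec j - v)"
    using cone[OF v end_neighbor_in_A[of i j]] assms by blast
  ultimately have "0 \<le> \<beta> v (- unit_vec j) ((1 - d j i) *s (- unit_vec j))" by metis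
  also have "\<dots> = 1 - d j i" by (simp only: \<beta>_scale[OF v] dual[OF v v(2)]) simp
  finally have "d j i \<le> 1" by simp
  moreover have "d j i \<noteq> 0" using triangle_sym[of j i] assms by auto
  moreover have "0 \<le> d j i" using d_nonneg[of i j] assms by simp
  ultimately show ?thesis by simp
qed

text \<open>The known edge vectors at \<open>unit_vec k\<close> involve at most one direction
  besides \<open>k\<close>. The dual coordinate of an edge vector involving two would vanish on
  \<open>unit_vec i\<close>, \<open>unit_vec j\<close> and \<open>unit_vec k\<close>, hence on the
  vector itself.\<close>

lemma G_unit_vec_two_coords:
  assumes "k \<noteq> i" "k \<noteq> j" "i \<noteq> j" "a \<noteq> 0" "b \<noteq> 0"
  shows "a *s unit_vec i + b *s unit_vec j - unit_vec k \<notin> G (unit_vec k)"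
proof
  define g where "g = a *s unit_vec i + b *s unit_vec j - (unit_vec k :: int ^ 'n)"
  assume "a *s unit_vec i + b *s unit_vec j - unit_vec k \<in> G (unit_vec k)"
  then have g: "g \<in> G (unit_vec k)" by (simp add: g_def)
  note V = unit_vec_in_V[of k]
  note B = \<beta>_simps[OF V g]
  have nz: "g $ i = a" "g $ j = b" using assms by (auto simp: g_def unit_vec_nth)
  have "- unit_vec k \<in> G (unit_vec k)" using end_vertex[of k] by (simp add: l1)
  moreover have "g \<noteq> - unit_vec k" using nz assms by (auto simp: unit_vec_nth)
  ultimately have k: "\<beta> (unit_vec k) g (unit_vec k) = 0" using dual[OF V g] B(3)[of "unit_vec k"] by simp
  have other: "\<beta> (unit_vec k) g (unit_vec m) = 0" if "m \<noteq> k" "g \<noteq> unit_vec m + (d k m - 1) *s unit_vec k" for m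
    using dual[OF V g step_in_G[OF that(1)]] that(2) by (simp add: B k)
  have "g \<noteq> unit_vec i + (d k i - 1) *s unit_vec k" using nz assms by (auto simp: unit_vec_nth)
  then have i: "\<beta> (unit_vec k) g (unit_vec i) = 0" using other assms by auto
  have "g \<noteq> unit_vec j + (d k j - 1) *s unit_vec k" using nz assms by (auto simp: unit_vec_nth)
  then have j: "\<beta> (unit_vec k) g (unit_vec j) = 0" using other assms by auto
  have "\<beta> (unit_vec k) g g = 0" unfolding g_def[symmetric] by (subst (2) g_def) (simp add: B i j k)
  then show False using dual[OF V g g] by simp
qed

text \<open>A 2-dimensional face that is neither a triangle nor a square has a vertex
  \<open>w\<close> all of whose edges except \<open>h\<close> lead into \<open>far\<close>, so
  \<open>f\<close> vanishes along these edges. The mirror image \<open>w'\<close> of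
  \<open>w\<close> is also in \<open>far\<close> and has a positive coordinate along
  \<open>h\<close>, which settles the last direction.\<close>

lemma generic_of_large_face:
  assumes ij: "i \<noteq> j" and dij: "2 \<le> d i j"
  shows "aff_generic far"
  unfolding aff_generic_def
proof (intro allI impI)
  fix f assume f: "\<forall>x\<in>far. aff f x = 0"
  define w where "w = unit_vec j + d i j *s (unit_vec i :: int ^ 'n)"
  define h where "h = - (unit_vec j + (d i j - 1) *s (unit_vec i :: int ^ 'n))"
  have w: "w \<in> V" and h: "h \<in> G w" using step_in_V[of j i] ij by (auto simp: w_def h_def)
  have wA: "w \<in> A" using w V_subset by blast
  define H where "H = \<beta> w h"
  have H: "H (x + y) = H x + H y" "H (c *s x) = c * H x" "H (- x) = - H x" "H (x - y) = H x - H y" for x y c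
    using \<beta>_simps[OF w h] by (simp_all add: H_def)
  \<comment> \<open>On the plane of the face, \<open>H\<close> is known up to the single unknown
    \<open>m\<close>; the cone condition at \<open>w'\<close> forces
    \<open>m \<ge> 1\<close>.\<close>
  define m where "m = - H (unit_vec i)"
  have "H h = 1" using dual[OF w h h] by (simp add: H_def)
  then have Hj: "H (unit_vec j) = (d i j - 1) * m - 1" by (simp add: h_def H m_def algebra_simps)
  have Hw: "H w = - 1 - m" by (simp add: w_def H Hj m_def algebra_simps)
  define w' where "w' = unit_vec i + d j i *s (unit_vec j :: int ^ 'n)"
  have w'A: "w' \<in> A" using end_neighbor_in_A[of i j] ij by (simp add: w'_def)
  have dji: "2 \<le> d j i"
  proof -
    have "d j i \<noteq> 0" using triangle_sym[of j i] ij dij by auto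
    moreover have "d j i \<noteq> 1" using square_sym[of j i] ij dij by auto
    ultimately show ?thesis using d_nonneg[of i j] ij by simp
  qed
  have Hw': "H (w' - w) = 1 - d j i + d j i * ((d i j - 1) * m)"
    by (simp add: w'_def H Hw Hj m_def algebra_simps)
  have m1: "1 \<le> m"
  proof (rule ccontr)
    assume "\<not> 1 \<le> m"
    then have "(d i j - 1) * m \<le> 0" using dij by (simp add: mult_nonneg_nonpos)
    then have "d j i * ((d i j - 1) * m) \<le> 0" using dji by (simp add: mult_nonneg_nonpos)
    moreover have "0 \<le> H (w' - w)" using cone[OF w h w'A] by (simp add: H_def)
    ultimately show False using Hw' dji by simp
  qed
  have "1 * 1 \<le> (d i j - 1) * m" using dij m1 by (intro mult_mono) auto
  then have "d j i * 1 \<le> d j i * ((d i j - 1) * m)" using dji by (intro mult_left_mono) auto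
  then have Hw'_pos: "H (w' - w) > 0" using Hw' by simp
  have "w \<in> far" "w' \<in> far"
    using wA w'A dij dji by (auto simp: far_iff w_def w'_def height_add height_scale)
  then have fw: "aff f w = 0" "aff f w' = 0" using f by auto
  have lin0: "lin_part f g = 0" if g: "g \<in> G w" "g \<noteq> h" for g
  proof -
    have "H g = 0" using dual[OF w h g(1)] g(2) by (simp add: H_def)
    then have Hg: "H (w + g) = - 1 - m" by (simp add: H Hw)
    have "H 0 = 0" using H(2)[of 0 0] by simp
    then have "w + g \<noteq> 0" using Hg m1 by auto
    \<comment> \<open>For \<open>k\<close> other than \<open>i\<close> and \<open>j\<close> there
      would be an edge from \<open>unit_vec k\<close> to \<open>w\<close>, a point with two nonzero
      coordinates; the other cases contradict the value of \<open>H\<close>.\<close>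
    moreover have "w + g \<noteq> unit_vec k" for k
    proof
      assume k: "w + g = unit_vec k"
      have "k \<noteq> i" using Hg k by (auto simp: m_def)
      moreover have "k \<noteq> j"
      proof
        assume "k = j"
        then have "(d i j - 1) * m - 1 = - 1 - m" using Hg k Hj by simp
        then have "d i j * m = 0" by (simp add: algebra_simps)
        then show False using dij m1 by simp
      qed
      moreover have "- g \<in> G (unit_vec k)" using unit_edge[OF w g(1)] k by simp
      moreover have "- g = d i j *s unit_vec i + 1 *s unit_vec j - unit_vec k"
        using k by (simp add: w_def algebra_simps eq_diff_eq flip: k)
      ultimately show False using G_unit_vec_two_coords[of k i j "d i j" 1] ij dij by auto
    qed
    ultimately have "w + g \<in> far" using neighbor[OF w g(1)] by (auto simp: far_def)
    then have "aff f (w + g) = 0" using f by blast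
    moreover have "aff f (w + g) = aff f w + lin_part f g" by (simp add: lin_part_simps)
    ultimately show ?thesis using fw by simp
  qed
  have "lin_part f (w' - w) = (\<Sum>g\<in>G w. of_int (\<beta> w g (w' - w)) * lin_part f g)"
    by (subst expand[OF w, of "w' - w"]) (simp add: lin_part_sum lin_part_scale)
  also have "\<dots> = (\<Sum>g\<in>G w. if g = h then of_int (H (w' - w)) * lin_part f h else 0)"
    by (intro sum.cong) (auto simp: H_def lin0)
  also have "\<dots> = of_int (H (w' - w)) * lin_part f h" using h finite_G[OF w] by simp
  finally have "of_int (H (w' - w)) * lin_part f h = lin_part f (w' - w)" by simp
  also have "lin_part f (w' - w) = 0"
  proof -
    have "lin_part f (w' - w + w) = lin_part f (w' - w) + lin_part f w" by (rule lin_part_add)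
    then show ?thesis using fw by (simp add: aff_lin_part add_eq_0_iff)
  qed
  finally have "lin_part f h = 0" using Hw'_pos by simp
  then show "f = (\<lambda>_. 0)" using lin_part_zeroI[OF w] lin0 fw by metis
qed

text \<open>Here \<open>\<phi> i\<close> is -1 on the unit vectors of the class of \<open>i\<close>
  and 0 on the others, so its half space is the claimed inequality.\<close>

lemma class_sum_le:
  assumes d01: "\<And>k. k \<noteq> i \<Longrightarrow> d i k = 0 \<or> d i k = 1" and x: "x \<in> A"
  shows "(\<Sum>k\<in>{k. k = i \<or> d i k = 0}. x $ k) \<le> 1"
proof -
  have "\<phi> i (\<Sum>k\<in>S. x $ k *s unit_vec k) = (\<Sum>k\<in>S. x $ k * \<phi> i (unit_vec k))" for S
    using \<phi>_scale[of i 0 0] by (induction S rule: infinite_finite_induct) (auto simp: \<phi>_add \<phi>_scale)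
  then have "\<phi> i x = (\<Sum>k\<in>UNIV. x $ k * \<phi> i (unit_vec k))" using unit_vec_expand[of x] by metis
  also have "\<dots> = (\<Sum>k\<in>UNIV. if k = i \<or> d i k = 0 then - (x $ k) else 0)"
  proof (rule sum.cong)
    fix k
    show "x $ k * \<phi> i (unit_vec k) = (if k = i \<or> d i k = 0 then - (x $ k) else 0)"
      using d01[of k] by (cases "k = i") (simp add: \<phi>_self, auto simp: \<phi>_d)
  qed simp
  also have "\<dots> = - (\<Sum>k\<in>{k. k = i \<or> d i k = 0}. x $ k)"
    by (simp add: sum_negf flip: sum.inter_filter)
  finally show ?thesis using half_space1[OF x, of i] by simp
qed

text \<open>Three pairwise inequivalent directions span a cube at the origin. Its edges from height
  2 to height 3 kill the coefficients of their directions, and every direction completes two of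
  \<open>a\<close>, \<open>b\<close>, \<open>c\<close> to such a cube.\<close>

lemma generic_of_three_classes:
  assumes d01: "\<And>i j. i \<noteq> j \<Longrightarrow> d i j = 0 \<or> d i j = 1"
    and abc: "a \<noteq> b" "a \<noteq> c" "b \<noteq> c" "d a b = 1" "d a c = 1" "d b c = 1"
  shows "aff_generic far"
  unfolding aff_generic_def
proof (intro allI impI)
  fix f assume f: "\<forall>x\<in>far. aff f x = 0"
  have sq: "unit_vec j + unit_vec i \<in> V" "- unit_vec j \<in> G (unit_vec j + unit_vec i)" if "i \<noteq> j" "d i j = 1" for i j
    using step_in_V[of j i] that by auto
  have sqA: "unit_vec j + unit_vec i \<in> A" if "i \<noteq> j" "d i j = 1" for i j
    using sq[OF that] V_subset by blast
  have le1: "x $ i \<le> 1" if "x \<in> A" for x i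
  proof -
    have "x $ i \<le> (\<Sum>k\<in>{k. k = i \<or> d i k = 0}. x $ k)"
      using nonneg[OF that] by (intro member_le_sum) auto
    also have "\<dots> \<le> 1" using that d01[of i] by (intro class_sum_le) auto
    finally show ?thesis .
  qed
  \<comment> \<open>At \<open>v\<close>, edge vectors are nonpositive in coordinates
    \<open>i\<close> and \<open>j\<close> and nonnegative elsewhere. So a nonnegative combination
    equal to \<open>unit_vec k\<close> has no cancellation, and \<open>unit_vec k\<close> is itself
    an edge vector.\<close>
  have cube: "unit_vec j + unit_vec i + unit_vec k \<in> A"
    if ijk: "i \<noteq> j" "k \<noteq> i" "k \<noteq> j" "d i j = 1" "d k i = 1" "d k j = 1" for i j k
  proof -
    define v where "v = unit_vec j + (unit_vec i :: int ^ 'n)"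
    have v: "v \<in> V" "- unit_vec j \<in> G v" using sq[of i j] ijk by (auto simp: v_def)
    have vi: "- unit_vec i \<in> G v"
      using sq(2)[of j i] square_sym[of i j] ijk by (auto simp: v_def add.commute)
    have pos: "0 \<le> \<beta> v g (unit_vec k)" if "g \<in> G v" for g
      unfolding v_def
      by (rule square_cone) (use v vi that ijk sqA[of k i] sqA[of k j] in \<open>auto simp: v_def add.commute\<close>)
    have sum: "(\<Sum>g\<in>G v. \<beta> v g (unit_vec k) * g $ m) = (if m = k then 1 else 0)" for m
      using expand_nth[OF v(1), of "unit_vec k" m] by (simp add: unit_vec_nth)
    have nn: "0 \<le> g $ m" if "g \<in> G v" "m \<noteq> i" "m \<noteq> j" for g m
      using nonneg[OF neighbor[OF v(1) that(1)], of m] that by (simp add: v_def unit_vec_nth)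
    have np: "g $ m \<le> 0" if "g \<in> G v" "m = i \<or> m = j" for g m
      using le1[OF neighbor[OF v(1) that(1)], of m] that ijk by (auto simp: v_def unit_vec_nth)
    obtain g where g: "g \<in> G v" "\<beta> v g (unit_vec k) * g $ k > 0"
    proof -
      have "\<not> (\<forall>g\<in>G v. \<beta> v g (unit_vec k) * g $ k \<le> 0)"
        using sum[of k] sum_nonpos[of "G v" "\<lambda>g. \<beta> v g (unit_vec k) * g $ k"] by auto
      then show ?thesis using that by force
    qed
    have le: "\<beta> v g (unit_vec k) * g $ m \<le> (if m = k then 1 else 0)" if "m \<noteq> i" "m \<noteq> j" for m
      using member_le_sum[of g "G v" "\<lambda>g. \<beta> v g (unit_vec k) * g $ m"] finite_G[OF v(1)] g pos nn that sum[of m]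
      by auto
    have "\<beta> v g (unit_vec k) * g $ k = 1" using le[of k] g ijk by simp
    then have bg: "\<beta> v g (unit_vec k) = 1" "g $ k = 1" using pos[OF g(1)] by (auto simp: zmult_eq_1_iff)
    have "g $ m = 0" if "m \<noteq> k" for m
    proof (cases "m = i \<or> m = j")
      case True
      have "(\<Sum>g\<in>G v. - (\<beta> v g (unit_vec k) * g $ m)) = 0"
        using sum[of m] that by (simp add: sum_negf)
      moreover have "- (\<beta> v g (unit_vec k) * g $ m) \<le> (\<Sum>g\<in>G v. - (\<beta> v g (unit_vec k) * g $ m))"
        using finite_G[OF v(1)] g pos np[OF _ True] by (intro member_le_sum) (auto simp: mult_nonneg_nonpos)
      ultimately show ?thesis using bg np[OF g(1) True] by simp
    next
      case False
      then show ?thesis using le[of m] bg nn[OF g(1), of m] that by simp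
    qed
    then have "g = unit_vec k" using bg by (auto simp: vec_eq_iff unit_vec_nth)
    then show ?thesis using neighbor[OF v(1) g(1)] by (simp add: v_def)
  qed
  have coeff0: "f (Some k) = 0" if "i \<noteq> j" "k \<noteq> i" "k \<noteq> j" "d i j = 1" "d k i = 1" "d k j = 1" for i j k
  proof -
    have "unit_vec j + unit_vec i + unit_vec k \<in> far" "unit_vec j + unit_vec i \<in> far"
      using cube[OF that] sqA[of i j] that by (auto simp: far_iff height_add)
    then have "aff f (unit_vec j + unit_vec i + unit_vec k) = 0" "aff f (unit_vec j + unit_vec i) = 0"
      using f by auto
    moreover have "aff f (unit_vec j + unit_vec i + unit_vec k) = aff f (unit_vec j + unit_vec i) + f (Some k)"
      by (simp add: lin_part_simps)
    ultimately show ?thesis by simp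
  qed
  have fk: "f (Some k) = 0" for k
  proof -
    \<comment> \<open>If \<open>k\<close> is equivalent to \<open>i\<close>, transitivity keeps it
      apart from every \<open>j\<close> inequivalent to \<open>i\<close>.\<close>
    have rel: "d j k = 1 \<and> j \<noteq> k" if "i \<noteq> j" "d i j = 1" "\<not> (k \<noteq> i \<and> d k i = 1)" for i j
    proof -
      have "k = i \<or> d k i = 0" using that d01[of k i] by auto
      then show ?thesis
      proof
        assume "k = i"
        then show ?thesis using that square_sym[of i j] by auto
      next
        assume ki: "d k i = 0"
        show ?thesis
        proof (cases "k = i")
          case False
          have jk: "j \<noteq> k" using ki that triangle_sym[of k i] False by auto
          have "d j k \<noteq> 0"
          proof
            assume "d j k = 0"
            then have "d j i = 0" using triangle_trans[of j k i] jk False that ki by auto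
            then show False using triangle_sym[of j i] that by auto
          qed
          then show ?thesis using d01[of j k] jk by auto
        qed (use that square_sym[of i j] in auto)
      qed
    qed
    have comm: "d j i = 1" if "i \<noteq> j" "d i j = 1" for i j using square_sym that by auto
    consider "\<not> (k \<noteq> a \<and> d k a = 1)" | "\<not> (k \<noteq> b \<and> d k b = 1)"
      | "k \<noteq> a \<and> d k a = 1" "k \<noteq> b \<and> d k b = 1" by blast
    then show ?thesis
    proof cases
      case 1
      then show ?thesis using rel[of a b] rel[of a c] abc comm coeff0[of b c k] by metis
    next
      case 2
      then show ?thesis using rel[of b a] rel[of b c] abc comm coeff0[of a c k] by metis
    next
      case 3
      then show ?thesis using coeff0[of a b k] abc by blast
    qed
  qed
  have "unit_vec b + unit_vec a \<in> far"
    using sqA[of a b] abc by (auto simp: far_iff height_add)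
  then have "aff f (unit_vec b + unit_vec a) = 0" using f by blast
  then have "f None = 0" by (simp add: lin_part_simps fk)
  then show "f = (\<lambda>_. 0)" using fk by (intro aff_zeroI)
qed

text \<open>There are at most two classes of directions. A single class leaves no far points, and a
  class with only one element makes the far points affinely independent.\<close>

lemma product_case:
  assumes nongen: "\<not> aff_generic far"
  shows "aff_indep far \<or> (\<exists>S. 2 \<le> card S \<and> 2 \<le> card (- S) \<and>
    A = {x. (\<forall>k. 0 \<le> x $ k) \<and> (\<Sum>k\<in>S. x $ k) \<le> 1 \<and> (\<Sum>k\<in>- S. x $ k) \<le> 1})"
proof -
  have d01: "d i j = 0 \<or> d i j = 1" if "i \<noteq> j" for i j
    using generic_of_large_face[OF that] nongen d_nonneg[of j i] that by force
  have class_le: "(\<Sum>k\<in>{k. k = i \<or> d i k = 0}. x $ k) \<le> 1" if x: "x \<in> A" for i x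
    using d01[of i] x by (intro class_sum_le) auto
  show ?thesis
  proof (cases "\<exists>i j. i \<noteq> j \<and> d i j = 1")
    case False
    have "far = {}"
    proof -
      have "height x \<le> 1" if "x \<in> A" for x
      proof -
        fix i :: 'n
        have "k = i \<or> d i k = 0" for k using False d01[of i k] by (cases "k = i") metis+
        then have "{k. k = i \<or> d i k = 0} = UNIV" by simp
        then show ?thesis using class_le[OF that, of i] by (simp add: height_def)
      qed
      then show ?thesis by (fastforce simp: far_iff)
    qed
    then show ?thesis by (simp add: aff_indep_def)
  next
    case True
    then obtain i j where ij: "i \<noteq> j" "d i j = 1" by blast
    define S where "S = {k. k = i \<or> d i k = 0}"
    have iS: "i \<in> S" and jS: "j \<notin> S" using ij by (auto simp: S_def)
    have S: "-S = {k. k = j \<or> d j k = 0}"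
    proof (intro equalityI subsetI)
      fix k assume "k \<in> - S"
      then have ik: "k \<noteq> i" "d i k = 1" using d01[of i k] by (auto simp: S_def)
      show "k \<in> {k. k = j \<or> d j k = 0}"
      proof (rule ccontr)
        assume "\<not> ?thesis"
        then have "k \<noteq> j" "d j k = 1" using d01[of j k] by auto
        then show False using generic_of_three_classes[OF d01, of i j k] nongen ij ik by auto
      qed
    next
      fix k assume k: "k \<in> {k. k = j \<or> d j k = 0}"
      show "k \<in> - S"
      proof
        assume kS: "k \<in> S"
        then have "k \<noteq> j" using jS by auto
        then have jk: "d j k = 0" using k by simp
        show False
        proof (cases "k = i")
          case True
          then show ?thesis using jk triangle_sym[of j i] ij by auto
        next
          case False
          then have "d i k = 0" "d k j = 0" using kS triangle_sym[of j k] jk \<open>k \<noteq> j\<close> by (auto simp: S_def)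
          then show ?thesis using triangle_trans[of i k j] False \<open>k \<noteq> j\<close> ij by auto
        qed
      qed
    qed
    have cross: "unit_vec a + unit_vec b \<in> A" if ab: "a \<in> S" "b \<notin> S" for a b
    proof -
      have ne: "a \<noteq> b" using ab by auto
      have "d a b = 1"
      proof (rule ccontr)
        assume "d a b \<noteq> 1"
        then have ab0: "d a b = 0" using d01[OF ne] by auto
        show False
        proof (cases "a = i")
          case True
          then show ?thesis using ab0 ab by (auto simp: S_def)
        next
          case False
          then have "d i a = 0" using ab by (auto simp: S_def)
          moreover have "i \<noteq> b" using ab iS by auto
          ultimately have "d i b = 0" using triangle_trans[of i a b] ab0 False ne by auto
          then show ?thesis using ab by (auto simp: S_def)
        qed
      qed
      then show ?thesis using end_neighbor_in_A[of b a] ne by (simp add: add.commute)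
    qed
    have sumsplit: "height x = (\<Sum>k\<in>S. x $ k) + (\<Sum>k\<in>- S. x $ k)" for x
      unfolding height_def using sum.union_disjoint[of S "- S"] by simp
    have A_sub: "(\<Sum>k\<in>S. x $ k) \<le> 1" "(\<Sum>k\<in>- S. x $ k) \<le> 1" if "x \<in> A" for x
      using class_le[OF that, of i] class_le[OF that, of j] S by (auto simp: S_def)
    have split2: "\<exists>a b. a \<in> S \<and> b \<notin> S \<and> x = unit_vec a + unit_vec b"
      if x: "\<And>k. 0 \<le> x $ k" "height x = 2" "(\<Sum>k\<in>S. x $ k) \<le> 1" "(\<Sum>k\<in>- S. x $ k) \<le> 1" for x
    proof -
      obtain a b where ab: "x = unit_vec a + unit_vec b" using nonneg_height_2[of x] x by blast
      have "(\<Sum>k\<in>T. x $ k) = (if a \<in> T then 1 else 0) + (if b \<in> T then 1 else 0)" for T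
        by (simp add: ab unit_vec_nth sum.distrib)
      then have "a \<in> S \<longleftrightarrow> b \<notin> S" using x(3,4) by (auto split: if_splits)
      then show ?thesis using ab add.commute[of "unit_vec a" "unit_vec b"] by metis
    qed
    have far_form: "\<exists>a b. a \<in> S \<and> b \<notin> S \<and> x = unit_vec a + unit_vec b" if "x \<in> far" for x
      using split2[of x] A_sub[of x] sumsplit[of x] nonneg[of x] that by (auto simp: far_iff)
    show ?thesis
    proof (cases "2 \<le> card S \<and> 2 \<le> card (- S)")
      case True
      have "A = {x. (\<forall>k. 0 \<le> x $ k) \<and> (\<Sum>k\<in>S. x $ k) \<le> 1 \<and> (\<Sum>k\<in>- S. x $ k) \<le> 1}"
      proof (intro equalityI subsetI)
        fix x assume "x \<in> A"
        then show "x \<in> {x. (\<forall>k. 0 \<le> x $ k) \<and> (\<Sum>k\<in>S. x $ k) \<le> 1 \<and> (\<Sum>k\<in>- S. x $ k) \<le> 1}"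
          using A_sub nonneg by blast
      next
        fix x :: "int ^ 'n"
        assume "x \<in> {x. (\<forall>k. 0 \<le> x $ k) \<and> (\<Sum>k\<in>S. x $ k) \<le> 1 \<and> (\<Sum>k\<in>- S. x $ k) \<le> 1}"
        then have x: "\<And>k. 0 \<le> x $ k" "(\<Sum>k\<in>S. x $ k) \<le> 1" "(\<Sum>k\<in>- S. x $ k) \<le> 1" by auto
        then consider "height x \<le> 0" | "height x = 1" | "height x = 2" using sumsplit[of x] by linarith
        then show "x \<in> A"
        proof cases
          case 1
          then show ?thesis using nonneg_height_0[of x] x origin_in_A by blast
        next
          case 2
          then show ?thesis using nonneg_height_1[of x] x unit_vec_in_A by blast
        next
          case 3
          then show ?thesis using split2[of x] x cross by blast
        qed
      qed
      then show ?thesis using True by blast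
    next
      case False
      have single: "T = {t}" if "t \<in> T" "\<not> 2 \<le> card T" for T :: "'n set" and t
      proof -
        have "card T \<noteq> 0" using that by auto
        then have "card T = 1" using that by linarith
        then show ?thesis using that by (metis card_1_singletonE singletonD)
      qed
      have "\<exists>p. \<forall>x\<in>far. \<exists>b. x = unit_vec p + unit_vec b \<and> b \<noteq> p"
      proof (cases "2 \<le> card S")
        case True
        then have Sj: "- S = {j}" using False single[of j "- S"] jS by auto
        have "\<exists>b. x = unit_vec j + unit_vec b \<and> b \<noteq> j" if x: "x \<in> far" for x
        proof -
          obtain a b where ab: "a \<in> S" "b \<notin> S" "x = unit_vec a + unit_vec b" using far_form[OF x] by blast
          then have "b = j" using Sj by blast
          then show ?thesis using ab jS by (intro exI[of _ a]) (auto simp: add.commute)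
        qed
        then show ?thesis by blast
      next
        case False
        then have "S = {i}" using single iS by auto
        then show ?thesis using far_form by blast
      qed
      then obtain p where p: "\<And>x. x \<in> far \<Longrightarrow> \<exists>b. x = unit_vec p + unit_vec b \<and> b \<noteq> p" by blast
      have "\<exists>f. \<forall>q\<in>far. aff f q = (if q = x then 1 else 0)" if x: "x \<in> far" for x
      proof -
        obtain b where b: "x = unit_vec p + unit_vec b" "b \<noteq> p" using p[OF x] by blast
        define f :: "'n option \<Rightarrow> complex" where
          "f m = (case m of None \<Rightarrow> 0 | Some k \<Rightarrow> if k = b then 1 else 0)" for m
        have "aff f q = (if q = x then 1 else 0)" if q: "q \<in> far" for q
        proof -
          obtain b' where b': "q = unit_vec p + unit_vec b'" "b' \<noteq> p" using p[OF q] by blast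
          have "q = x \<longleftrightarrow> b' = b" by (simp add: b b' axis_eq_axis)
          then show ?thesis using b b' by (auto simp: lin_part_simps f_def)
        qed
        then show ?thesis by blast
      qed
      then show ?thesis by (simp add: aff_indep_def)
    qed
  qed
qed

end

section \<open>The classification at a suitable base vertex\<close>

context based_config
begin

lemma edge_config_exists:
  shows "\<exists>l \<phi>. edge_config A V G \<beta> l \<phi>"
proof -
  define Q where "Q i l \<phi> \<longleftrightarrow> 0 < l \<and> l *s unit_vec i \<in> V \<and> - unit_vec i \<in> G (l *s unit_vec i) \<and>
    (\<forall>x y. \<phi> (x + y) = \<phi> x + \<phi> y) \<and> (\<forall>c x. \<phi> (c *s x) = c * \<phi> x) \<and> \<phi> (unit_vec i) = -1 \<and>
    (\<forall>j. j \<noteq> i \<longrightarrow> unit_vec j + \<phi> (unit_vec j) *s unit_vec i \<in> G (l *s unit_vec i)) \<and> (\<forall>x\<in>A. 0 \<le> l + \<phi> x)"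
    for i l \<phi>
  have "\<exists>l \<phi>. Q i l \<phi>" for i
  proof -
    obtain l where l: "0 < l" "l *s unit_vec i \<in> V" "- unit_vec i \<in> G (l *s unit_vec i)"
      using edge[OF origin, of "unit_vec i"] by (auto simp: G_origin)
    from opposite_vertex[OF l(2,3)] obtain \<phi> where "Q i l \<phi>" using l unfolding Q_def by blast
    then show ?thesis by blast
  qed
  then obtain l \<phi> where "\<And>i. Q i (l i) (\<phi> i)" by metis
  then have "edge_config A V G \<beta> l \<phi>" unfolding Q_def by unfold_locales simp_all
  then show ?thesis by blast
qed

text \<open>The hypothesis records the choice of the base vertex: if all edges at the origin have
  length 1, its first alternative fails and the second one governs every vertex.\<close>

theorem classification:
  assumes "(\<exists>g\<in>G 0. g \<notin> V) \<or> (\<forall>v\<in>V. \<forall>g\<in>G v. v + g \<in> V)"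
  shows "aff_generic far \<or> aff_indep far \<or>
    (\<exists>S. 2 \<le> card S \<and> A = {x. (\<forall>k. 0 \<le> x $ k) \<and> height x \<le> 2 \<and> (\<Sum>k\<in>- S. x $ k) \<le> 1}) \<or>
    (\<exists>S. 2 \<le> card S \<and> 2 \<le> card (- S) \<and>
      A = {x. (\<forall>k. 0 \<le> x $ k) \<and> (\<Sum>k\<in>S. x $ k) \<le> 1 \<and> (\<Sum>k\<in>- S. x $ k) \<le> 1})"
proof -
  obtain l \<phi> where "edge_config A V G \<beta> l \<phi>" using edge_config_exists by blast
  then interpret edge_config A V G \<beta> l \<phi> .
  show ?thesis
  proof (cases "\<forall>i. l i = 1")
    case False
    show ?thesis
    proof (cases "\<exists>i. 3 \<le> l i")
      case True
      then obtain i where "3 \<le> l i" by blast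
      then have "aff_generic far" by (rule generic_of_long_edge)
      then show ?thesis by (rule disjI1)
    next
      case le2: False
      have l2: "l j \<le> 2" for j
      proof -
        have "\<not> 3 \<le> l j" using le2 by blast
        then show ?thesis by linarith
      qed
      obtain i where "l i \<noteq> 1" using False by blast
      then have "l i = 2" using l2[of i] l_pos[of i] by linarith
      then have "l i = 2" .
      show ?thesis
      proof (cases "aff_generic far")
        case False
        show ?thesis using quadric_case[OF l2 \<open>l i = 2\<close> False] by (elim disjE) simp_all
      qed simp
    qed
  next
    case l1: True
    have "v + g \<in> V \<and> - g \<in> G (v + g)" if v: "v \<in> V" "g \<in> G v" for v g
    proof -
      have "unit_vec i \<in> V" for i using end_vertex(1)[of i] l1 by simp
      then have "\<forall>g\<in>G 0. g \<in> V" by (auto simp: G_origin)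
      then have vg: "v + g \<in> V" using assms v by blast
      obtain m where m: "0 < m" "v + m *s g \<in> V" "- g \<in> G (v + m *s g)" using edge[OF v] by blast
      \<comment> \<open>If the vertex \<open>v + g\<close> lay inside the edge, its cone would
        contain both \<open>g\<close> and \<open>- g\<close>, so all coordinates of \<open>g\<close>
        would vanish.\<close>
      have "m = 1"
      proof (rule ccontr)
        assume "m \<noteq> 1"
        then have m2: "0 < m - 1" using m by simp
        have "\<beta> (v + g) h g = 0" if h: "h \<in> G (v + g)" for h
        proof -
          have "0 \<le> \<beta> (v + g) h (v - (v + g))" using v V_subset by (intro cone[OF vg h]) auto
          then have "\<beta> (v + g) h g \<le> 0" by (simp add: \<beta>_minus[OF vg h])
          moreover have "0 \<le> \<beta> (v + g) h (v + m *s g - (v + g))" using m V_subset by (intro cone[OF vg h]) auto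
          then have "0 \<le> \<beta> (v + g) h ((m - 1) *s g)"
            by (simp add: vec.scale_left_diff_distrib)
          then have "0 \<le> (m - 1) * \<beta> (v + g) h g" by (simp only: \<beta>_scale[OF vg h])
          then have "0 \<le> \<beta> (v + g) h g" using m2 by (simp add: zero_le_mult_iff)
          ultimately show ?thesis by simp
        qed
        then have "g = 0" using expand[OF vg, of g] by simp
        then show False using dual[OF v v(2)] \<beta>_scale[OF v, of 0 0] by simp
      qed
      then show ?thesis using m by simp
    qed
    then interpret unit_edge_config A V G \<beta> l \<phi>
      using l1 by unfold_locales auto
    show ?thesis
    proof (cases "aff_generic far")
      case False
      show ?thesis using product_case[OF False] by (elim disjE) simp_all
    qed simp
  qed
qed

end


section \<open>Edges at a vertex of a polytope\<close>

text \<open>A face of minimal dimension through \<open>q\<close> works, since otherwise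
  \<open>q\<close> would lie on one of its facets.\<close>

lemma polytope_face_rel_interior:
  fixes P :: "'a::euclidean_space set"
  assumes "polyhedron P" "q \<in> P" obtains F where "F face_of P" "q \<in> rel_interior F"
proof -
  define Q where "Q F \<longleftrightarrow> F face_of P \<and> q \<in> F" for F
  have "Q P" using assms by (simp add: Q_def face_of_refl polyhedron_imp_convex)
  then obtain F where F: "Q F" "\<And>F'. Q F' \<Longrightarrow> nat (aff_dim F) \<le> nat (aff_dim F')"
    using ex_has_least_nat[of Q P "\<lambda>F. nat (aff_dim F)"] by blast
  have FP: "F face_of P" and qF: "q \<in> F" using F by (auto simp: Q_def)
  have "q \<in> rel_interior F"
  proof (rule ccontr)
    assume "q \<notin> rel_interior F"
    moreover have "polyhedron F" using assms(1) FP by (rule face_of_polyhedron_polyhedron)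
    ultimately obtain F' where F': "F' facet_of F" "q \<in> F'" using rel_boundary_of_polyhedron qF by blast
    then have "Q F'" using FP face_of_trans by (auto simp: Q_def facet_of_def)
    then have "nat (aff_dim F) \<le> nat (aff_dim F')" by (rule F)
    moreover have "aff_dim F' = aff_dim F - 1" using F' by (simp add: facet_of_def)
    moreover have "\<not> aff_dim F' < 0" using F' unfolding aff_dim_negative_iff by blast
    ultimately show False by linarith
  qed
  then show ?thesis using that FP by blast
qed

text \<open>If the face with \<open>q\<close> in its relative interior had dimension 2 or more, the
  hyperplane would meet it in a segment with midpoint \<open>q\<close>.\<close>

lemma extreme_point_slice:
  fixes P :: "'a::euclidean_space set"
  assumes P: "polyhedron P" and q: "q extreme_point_of (P \<inter> {x. a \<bullet> x = \<gamma>})"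
  obtains F where "F face_of P" "q \<in> F" "aff_dim F \<le> 1"
proof -
  have "q \<in> P" "a \<bullet> q = \<gamma>" using q by (auto simp: extreme_point_of_def)
  obtain F where F: "F face_of P" "q \<in> rel_interior F" using polytope_face_rel_interior[OF P \<open>q \<in> P\<close>] .
  have qF: "q \<in> F" using F rel_interior_subset by blast
  have "aff_dim F \<le> 1"
  proof (rule ccontr)
    assume "\<not> aff_dim F \<le> 1"
    define L where "L = affine hull F \<inter> {x. a \<bullet> x = \<gamma>}"
    have qL: "q \<in> L" using qF \<open>a \<bullet> q = \<gamma>\<close> by (simp add: L_def hull_inc)
    then have ne: "affine hull F \<inter> {x. a \<bullet> x = \<gamma>} \<noteq> {}" by (auto simp: L_def)
    have "aff_dim L \<ge> aff_dim F - 1"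
      unfolding L_def using aff_dim_affine_Int_hyperplane[of "affine hull F" a \<gamma>] ne by auto
    then have "aff_dim L \<noteq> 0" using \<open>\<not> aff_dim F \<le> 1\<close> by simp
    then have "L \<noteq> {q}" by auto
    then obtain p where p: "p \<in> L" "p \<noteq> q" using qL by blast
    obtain e where e: "e > 0" "ball q e \<inter> affine hull F \<subseteq> F" using F(2) by (auto simp: mem_rel_interior_ball)
    define t where "t = e / (2 * norm (p - q))"
    have t: "t > 0" using e p by (simp add: t_def)
    have mem: "q + s *\<^sub>R (p - q) \<in> P \<inter> {x. a \<bullet> x = \<gamma>}" if s: "\<bar>s\<bar> = t" for s
    proof -
      have "q + s *\<^sub>R (p - q) \<in> affine hull F"
      proof -
        have "q + s *\<^sub>R (p - q) = (1 - s) *\<^sub>R q + s *\<^sub>R p" by (simp add: algebra_simps)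
        then show ?thesis using p qF by (simp add: L_def mem_affine affine_affine_hull hull_inc)
      qed
      moreover have "norm (s *\<^sub>R (p - q)) < e" using s t e p by (simp add: t_def)
      then have "q + s *\<^sub>R (p - q) \<in> ball q e" by (simp add: dist_norm)
      ultimately have "q + s *\<^sub>R (p - q) \<in> F" using e by blast
      then have "q + s *\<^sub>R (p - q) \<in> P" using F face_of_imp_subset by blast
      moreover have "a \<bullet> p = \<gamma>" using p by (simp add: L_def)
      ultimately show ?thesis using \<open>a \<bullet> q = \<gamma>\<close> by (simp add: inner_add_right inner_diff_right)
    qed
    define x where "x = q + t *\<^sub>R (p - q)"
    define y where "y = q + (- t) *\<^sub>R (p - q)"
    have "x \<in> P \<inter> {x. a \<bullet> x = \<gamma>}" unfolding x_def using t by (intro mem) simp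
    moreover have "y \<in> P \<inter> {x. a \<bullet> x = \<gamma>}" unfolding y_def using t by (intro mem) simp
    moreover have "q \<in> open_segment x y"
    proof -
      have "x + y = q + q" by (simp add: x_def y_def)
      then have "q = midpoint x y" by (simp add: midpoint_def flip: scaleR_2)
      moreover have "x - y = t *\<^sub>R (p - q) + t *\<^sub>R (p - q)" by (simp add: x_def y_def)
      then have "x - y = (t + t) *\<^sub>R (p - q)" by (simp only: scaleR_left_distrib)
      then have "x \<noteq> y" using t p by auto
      ultimately show ?thesis using midpoint_in_open_segment by blast
    qed
    ultimately show False using q unfolding extreme_point_of_def by blast
  qed
  then show ?thesis using that F qF by blast
qed

text \<open>The extreme points of the vertex figure lie on the edges at \<open>v\<close>.\<close>

lemma local_minimum_on_edges:
  fixes S :: "'a::euclidean_space set"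
  assumes S: "finite S" and v: "v extreme_point_of (convex hull S)"
    and edges: "\<And>e x. e edge_of (convex hull S) \<Longrightarrow> v \<in> e \<Longrightarrow> x \<in> e \<Longrightarrow> c \<bullet> v \<le> c \<bullet> x"
    and y: "y \<in> convex hull S"
  shows "c \<bullet> v \<le> c \<bullet> y"
proof -
  let ?P = "convex hull S"
  have poly: "polyhedron ?P" using S by (intro polytope_imp_polyhedron) (auto simp: polytope_def)
  have "{v} exposed_face_of ?P"
    using v exposed_face_of_polyhedron[OF poly] by (simp add: face_of_singleton)
  then obtain a b where ab: "?P \<subseteq> {x. a \<bullet> x \<le> b}" "{v} = ?P \<inter> {x. a \<bullet> x = b}"
    by (auto simp: exposed_face_of_def)
  have av: "a \<bullet> v = b" using ab by blast
  \<comment> \<open>The level \<open>\<gamma>\<close> between \<open>M\<close> and \<open>b\<close>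
    separates \<open>v\<close> from the rest of \<open>S\<close>; \<open>b - 1\<close> keeps the
    maximum defined if there is no other point.\<close>
  define M where "M = Max (insert (b - 1) ((\<bullet>) a ` (S - {v})))"
  have "a \<bullet> x < b" if "x \<in> S - {v}" for x
  proof -
    have "x \<in> ?P" using that by (simp add: hull_inc)
    then show ?thesis using ab that by force
  qed
  then have Mb: "M < b" using S by (simp add: M_def)
  have Mx: "a \<bullet> x \<le> M" if "x \<in> S - {v}" for x using S that by (simp add: M_def)
  define \<gamma> where "\<gamma> = (M + b) / 2"
  have \<gamma>: "M < \<gamma>" "\<gamma> < b" using Mb by (auto simp: \<gamma>_def)
  define Q where "Q = ?P \<inter> {x. a \<bullet> x = \<gamma>}"
  have ext: "c \<bullet> v \<le> c \<bullet> q" if q: "q extreme_point_of Q" for q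
  proof -
    obtain F where F: "F face_of ?P" "q \<in> F" "aff_dim F \<le> 1"
      using extreme_point_slice[OF poly] q unfolding Q_def by blast
    have aq: "a \<bullet> q = \<gamma>" using q by (auto simp: Q_def extreme_point_of_def)
    have Fc: "compact F" "convex F"
      using F(1) face_of_imp_compact face_of_imp_convex compact_convex_hull finite_imp_compact[OF S] by blast+
    \<comment> \<open>A face avoiding \<open>v\<close> is the hull of points of
      \<open>S - {v}\<close> and stays below the slice.\<close>
    have vF: "v \<in> F"
    proof (rule ccontr)
      assume "v \<notin> F"
      have "x \<in> {x. a \<bullet> x \<le> M}" if "x extreme_point_of F" for x
      proof -
        have "x extreme_point_of ?P" "x \<in> F" using that extreme_point_of_face[OF F(1)] by auto
        then have "x \<in> S - {v}" using extreme_point_of_convex_hull \<open>v \<notin> F\<close> by blast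
        then show ?thesis using Mx by simp
      qed
      then have "convex hull {x. x extreme_point_of F} \<subseteq> {x. a \<bullet> x \<le> M}"
        by (intro hull_minimal convex_halfspace_le) auto
      then have "F \<subseteq> {x. a \<bullet> x \<le> M}" using Krein_Milman_Minkowski[OF Fc] by simp
      then show False using F(2) aq \<gamma> by auto
    qed
    moreover have "aff_dim F = 1"
    proof -
      have "aff_dim F \<noteq> 0"
      proof
        assume "aff_dim F = 0"
        then have "q = v" using F(2) vF by (auto simp: aff_dim_eq_0)
        then show False using aq av \<gamma> by simp
      qed
      moreover have "aff_dim F \<noteq> -1" using F(2) aff_dim_empty[of F] by auto
      ultimately show ?thesis using F(3) aff_dim_geq[of F] by linarith
    qed
    ultimately show ?thesis using edges[of F q] F by (simp add: edge_of_def)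
  qed
  have Qle: "c \<bullet> v \<le> c \<bullet> z" if "z \<in> Q" for z
  proof -
    have "compact Q" unfolding Q_def
      by (intro compact_Int_closed compact_convex_hull finite_imp_compact S closed_hyperplane)
    moreover have "convex Q" unfolding Q_def by (intro convex_Int convex_convex_hull convex_hyperplane)
    ultimately have "Q = convex hull {x. x extreme_point_of Q}" by (rule Krein_Milman_Minkowski)
    also have "\<dots> \<subseteq> {x. c \<bullet> v \<le> c \<bullet> x}"
      using ext convex_halfspace_ge[of "c \<bullet> v" c] by (intro hull_minimal) (auto simp: inner_commute)
    finally show ?thesis using that by blast
  qed
  have "c \<bullet> v \<le> c \<bullet> x" if x: "x \<in> S" for x
  proof (cases "x = v")
    case False
    then have ax: "a \<bullet> x < \<gamma>" using Mx[of x] x \<gamma> by simp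
    \<comment> \<open>The parameter at which the segment from \<open>v\<close> to \<open>x\<close>
      crosses the slice.\<close>
    define t where "t = (b - \<gamma>) / (b - a \<bullet> x)"
    have t: "0 < t" "t < 1" using ax \<gamma> by (auto simp: t_def field_simps)
    define z where "z = (1 - t) *\<^sub>R v + t *\<^sub>R x"
    have "v \<in> ?P" using v by (simp add: extreme_point_of_def)
    then have "z \<in> ?P" using t x convex_convex_hull[of S]
      by (auto simp: z_def convex_alt hull_inc)
    moreover have "a \<bullet> z = b - t * (b - a \<bullet> x)" by (simp add: z_def inner_add_right av algebra_simps)
    then have "a \<bullet> z = \<gamma>" using ax \<gamma> by (simp add: t_def)
    ultimately have "z \<in> Q" by (simp add: Q_def)
    then have "c \<bullet> v \<le> c \<bullet> z" by (rule Qle)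
    then have "0 \<le> t * (c \<bullet> x - c \<bullet> v)" by (simp add: z_def inner_add_right algebra_simps)
    then show ?thesis using t by (simp add: zero_le_mult_iff)
  qed simp
  then have "S \<subseteq> {x. c \<bullet> v \<le> c \<bullet> x}" by blast
  then have "?P \<subseteq> {x. c \<bullet> v \<le> c \<bullet> x}" by (intro hull_minimal convex_halfspace_ge)
  then show ?thesis using y by blast
qed

section \<open>From smooth polytopes to lattice configurations\<close>

lemma real_of_lattice_add: "real_of_lattice (x + y) = real_of_lattice x + real_of_lattice y"
  by (simp add: real_of_lattice_def vec_eq_iff)

lemma real_of_lattice_diff: "real_of_lattice (x - y) = real_of_lattice x - real_of_lattice y"
  by (simp add: real_of_lattice_def vec_eq_iff)

lemma real_of_lattice_scale: "real_of_lattice (c *s x) = of_int c *\<^sub>R real_of_lattice x"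
  by (simp add: real_of_lattice_def vec_eq_iff)

lemma real_of_lattice_eq_iff: "real_of_lattice x = real_of_lattice y \<longleftrightarrow> x = y"
  by (simp add: real_of_lattice_def vec_eq_iff)

definition int_functional :: "(int ^ 'n::finite \<Rightarrow> int) \<Rightarrow> bool" where
  "int_functional f \<longleftrightarrow> (\<forall>x y. f (x + y) = f x + f y) \<and> (\<forall>c x. f (c *s x) = c * f x)"

definition functional_vec :: "(int ^ 'n::finite \<Rightarrow> int) \<Rightarrow> real ^ 'n" where
  "functional_vec f = (\<chi> k. of_int (f (unit_vec k)))"

lemma int_functional_sum:
  assumes "int_functional f" shows "f (\<Sum>k\<in>S. g k) = (\<Sum>k\<in>S. f (g k))"
proof -
  have "f (0 *s 0) = 0" using assms unfolding int_functional_def by (metis mult_zero_left)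
  then show ?thesis using assms
    by (induction S rule: infinite_finite_induct) (auto simp: int_functional_def)
qed

lemma functional_vec_inner:
  assumes "int_functional f" shows "functional_vec f \<bullet> real_of_lattice x = of_int (f x)"
proof -
  have "f x = f (\<Sum>k\<in>UNIV. x $ k *s unit_vec k)" using unit_vec_expand[of x] by simp
  also have "\<dots> = (\<Sum>k\<in>UNIV. x $ k * f (unit_vec k))"
    using assms by (simp add: int_functional_sum) (simp add: int_functional_def)
  finally show ?thesis
    by (simp add: functional_vec_def real_of_lattice_def inner_vec_def mult.commute)
qed

text \<open>Finiteness comes from the unit vectors: a basis element occurring in none of their
  expansions would have a coordinate function that vanishes identically.\<close>

lemma lattice_basis_dual:
  fixes B :: "(int ^ 'n::finite) set"
  assumes "lattice_basis B"
  obtains \<beta> where "finite B" "\<And>g. int_functional (\<beta> g)"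
    "\<And>g h. g \<in> B \<Longrightarrow> h \<in> B \<Longrightarrow> \<beta> g h = (if g = h then 1 else 0)"
    "\<And>x. x = (\<Sum>g\<in>B. \<beta> g x *s g)"
proof -
  interpret M: module "(*s) :: int \<Rightarrow> int ^ 'n \<Rightarrow> int ^ 'n" by (rule module_lattice)
  have ind: "M.independent B" and span: "M.span B = UNIV" using assms by (auto simp: lattice_basis_def)
  define \<beta> where "\<beta> g x = M.representation B x g" for g x
  have lin: "int_functional (\<beta> g)" for g
    using M.representation_add[OF ind] M.representation_scale[OF ind]
    by (simp add: int_functional_def \<beta>_def span)
  have dual: "\<beta> g h = (if g = h then 1 else 0)" if "g \<in> B" "h \<in> B" for g h
    using M.representation_basis[OF ind that(2)] by (simp add: \<beta>_def)
  define T where "T = (\<Union>k. {g. M.representation B (unit_vec k) g \<noteq> 0})"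
  have "finite T" unfolding T_def by (intro finite_UN_I) (auto simp: M.finite_representation)
  moreover have "B \<subseteq> T"
  proof
    fix g assume g: "g \<in> B"
    show "g \<in> T"
    proof (rule ccontr)
      assume "g \<notin> T"
      then have "\<beta> g (unit_vec k) = 0" for k by (simp add: T_def \<beta>_def)
      moreover have "\<beta> g g = (\<Sum>k\<in>UNIV. g $ k * \<beta> g (unit_vec k))"
        using functional_vec_inner[OF lin[of g], of g]
        unfolding functional_vec_def real_of_lattice_def inner_vec_def
        by (simp add: mult.commute flip: of_int_mult of_int_sum)
      ultimately show False using dual[OF g g] by simp
    qed
  qed
  ultimately have fin: "finite B" by (rule rev_finite_subset)
  moreover have "x = (\<Sum>g\<in>B. \<beta> g x *s g)" for x
    unfolding \<beta>_def by (rule M.sum_representation_eq[symmetric, OF ind]) (use fin span in auto)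
  ultimately show ?thesis using that lin dual by blast
qed

lemma edge_of_lattice_polytope:
  fixes A :: "(int ^ 'n::finite) set"
  assumes A: "finite A" "P = convex hull (real_of_lattice ` A)"
    and e: "e edge_of P" "real_of_lattice v \<in> e" "real_of_lattice v extreme_point_of P"
  obtains v' where "real_of_lattice v' extreme_point_of P" "v' \<noteq> v"
    "e = closed_segment (real_of_lattice v) (real_of_lattice v')"
proof -
  have eP: "e face_of P" "aff_dim e = 1" using e by (auto simp: edge_of_def)
  have "compact P" using A by (simp add: compact_convex_hull finite_imp_compact)
  then have "compact e" "convex e" using eP face_of_imp_compact face_of_imp_convex A by blast+
  then obtain p p' where seg: "e = closed_segment p p'"
    using compact_convex_collinear_segment[of e] e(2) eP(2) collinear_aff_dim[of e] by auto
  have lat: "\<exists>w. x = real_of_lattice w \<and> x extreme_point_of P" if "x extreme_point_of e" for x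
  proof -
    have "x extreme_point_of P" using that extreme_point_of_face[OF eP(1)] by blast
    then show ?thesis using extreme_point_of_convex_hull A by blast
  qed
  obtain w where w: "p = real_of_lattice w" "p extreme_point_of P"
    using lat[of p] extreme_point_of_segment[of p p p'] seg by blast
  obtain w' where w': "p' = real_of_lattice w'" "p' extreme_point_of P"
    using lat[of p'] extreme_point_of_segment[of p' p p'] seg by blast
  have "p \<noteq> p'" using eP(2) seg by auto
  have "real_of_lattice v extreme_point_of e" using e extreme_point_of_face[OF eP(1)] by blast
  then have "real_of_lattice v = p \<or> real_of_lattice v = p'"
    using seg extreme_point_of_segment by blast
  then show ?thesis
  proof
    assume "real_of_lattice v = p"
    then show ?thesis using that[of w'] w w' seg \<open>p \<noteq> p'\<close> by (auto simp: real_of_lattice_eq_iff)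
  next
    assume "real_of_lattice v = p'"
    then show ?thesis using that[of w] w w' seg \<open>p \<noteq> p'\<close>
      by (auto simp: real_of_lattice_eq_iff closed_segment_commute)
  qed
qed

lemma finite_lattice_points_segment:
  fixes v v' :: "int ^ 'n::finite"
  assumes "v \<noteq> v'"
  shows "finite (lattice_points (closed_segment (real_of_lattice v) (real_of_lattice v')))" (is "finite ?L")
proof -
  obtain k where k: "v $ k \<noteq> v' $ k" using assms by (auto simp: vec_eq_iff)
  have par: "\<exists>t::real. 0 \<le> t \<and> t \<le> 1 \<and> (\<forall>j. of_int (x $ j) = of_int (v $ j) + t * (of_int (v' $ j) - of_int (v $ j)))"
    if x: "x \<in> ?L" for x
  proof -
    obtain t where t: "0 \<le> t" "t \<le> 1" "real_of_lattice x = (1 - t) *\<^sub>R real_of_lattice v + t *\<^sub>R real_of_lattice v'"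
      using x by (auto simp: lattice_points_def in_segment)
    then have "of_int (x $ j) = of_int (v $ j) + t * (of_int (v' $ j) - of_int (v $ j))" for j
      by (auto simp: vec_eq_iff real_of_lattice_def algebra_simps)
    then show ?thesis using t by blast
  qed
  have "(\<lambda>x. x $ k) ` ?L \<subseteq> {min (v $ k) (v' $ k)..max (v $ k) (v' $ k)}"
  proof clarify
    fix x assume "x \<in> ?L"
    then obtain t where t: "0 \<le> t" "t \<le> 1" "of_int (x $ k) = of_int (v $ k) + t * (of_int (v' $ k) - of_int (v $ k) :: real)"
      using par by blast
    have "of_int (x $ k) = (1 - t) * of_int (v $ k) + t * (of_int (v' $ k) :: real)" by (simp add: t algebra_simps)
    then have "of_int (x $ k) \<in> closed_segment (of_int (v $ k)) (of_int (v' $ k) :: real)"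
      using t by (auto simp: in_segment)
    then have "(of_int (x $ k) :: real) \<in> {min (of_int (v $ k)) (of_int (v' $ k))..max (of_int (v $ k)) (of_int (v' $ k))}"
      by (auto simp: closed_segment_eq_real_ivl split: if_splits)
    then show "x $ k \<in> {min (v $ k) (v' $ k)..max (v $ k) (v' $ k)}"
      by (simp add: min_def max_def split: if_splits)
  qed
  then have "finite ((\<lambda>x. x $ k) ` ?L)" by (rule finite_subset) simp
  moreover have "inj_on (\<lambda>x. x $ k) ?L"
  proof (rule inj_onI)
    fix x y assume xy: "x \<in> ?L" "y \<in> ?L" "x $ k = y $ k"
    obtain t :: real where t: "\<And>j. of_int (x $ j) = of_int (v $ j) + t * (of_int (v' $ j) - of_int (v $ j))"
      using par[OF xy(1)] by blast
    obtain s :: real where s: "\<And>j. of_int (y $ j) = of_int (v $ j) + s * (of_int (v' $ j) - of_int (v $ j))"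
      using par[OF xy(2)] by blast
    have "t * (of_int (v' $ k) - of_int (v $ k)) = s * (of_int (v' $ k) - of_int (v $ k))"
      using t[of k] s[of k] xy(3) by linarith
    then have "t = s" using k by simp
    then have "real_of_int (x $ j) = of_int (y $ j)" for j using t[of j] s[of j] by simp
    then show "x = y" by (simp add: vec_eq_iff)
  qed
  ultimately show ?thesis by (rule finite_imageD)
qed

lemma nearest_neighbor_exists:
  fixes v v' :: "int ^ 'n::finite"
  assumes "v \<noteq> v'"
  shows "\<exists>w. nearest_neighbor v (closed_segment (real_of_lattice v) (real_of_lattice v')) w"
  unfolding nearest_neighbor_def
proof (rule ex_is_arg_min_if_finite)
  show "finite (lattice_points (closed_segment (real_of_lattice v) (real_of_lattice v')) - {v})"
    using finite_lattice_points_segment[OF assms] by simp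
  have "v' \<in> lattice_points (closed_segment (real_of_lattice v) (real_of_lattice v')) - {v}"
    using assms by (auto simp: lattice_points_def)
  then show "lattice_points (closed_segment (real_of_lattice v) (real_of_lattice v')) - {v} \<noteq> {}" by blast
qed

text \<open>The functional \<open>f\<close> measures lattice length along the edge. Its value 1 on
  \<open>w - v\<close> makes this vector primitive, so the edge is \<open>l = f (v' - v)\<close>
  times it, and the first lattice vector from the other end is its negative.\<close>

lemma nearest_neighbor_step:
  fixes v v' w :: "int ^ 'n::finite"
  assumes vv': "v \<noteq> v'" and w: "nearest_neighbor v (closed_segment (real_of_lattice v) (real_of_lattice v')) w"
    and f: "int_functional f" "f (w - v) = 1"
  shows "\<exists>l>0. v' = v + l *s (w - v) \<and>
    nearest_neighbor v' (closed_segment (real_of_lattice v) (real_of_lattice v')) (v' - (w - v))"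
proof -
  let ?e = "closed_segment (real_of_lattice v) (real_of_lattice v')"
  define g where "g = w - v"
  have wv: "w \<in> lattice_points ?e" "w \<noteq> v" using w by (auto simp: nearest_neighbor_def is_arg_min_def)
  then obtain t where t: "0 \<le> t" "t \<le> 1" "real_of_lattice w = (1 - t) *\<^sub>R real_of_lattice v + t *\<^sub>R real_of_lattice v'"
    by (auto simp: lattice_points_def in_segment)
  then have g: "real_of_lattice g = t *\<^sub>R real_of_lattice (v' - v)"
    by (simp add: g_def real_of_lattice_diff algebra_simps)
  define l where "l = f (v' - v)"
  have "of_int (f g) = t * of_int l"
    using functional_vec_inner[OF f(1), of g] functional_vec_inner[OF f(1), of "v' - v"]
    by (simp add: g l_def)
  then have tl: "t * of_int l = 1" using f(2) by (simp add: g_def)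
  then have t0: "t > 0" using t(1) by (cases "t = 0") auto
  then have l0: "l > 0" using tl by (metis of_int_0_less_iff zero_less_mult_pos zero_less_one)
  have "real_of_lattice (l *s g) = real_of_lattice (v' - v)"
    using tl by (simp add: real_of_lattice_scale g mult.commute)
  then have v': "v' = v + l *s g" by (simp add: real_of_lattice_eq_iff)

  have "nearest_neighbor v' ?e (v' - g)"
    unfolding nearest_neighbor_def is_arg_min_def
  proof (intro conjI notI)
    have "real_of_lattice (v' - g) = (1 - (1 - t)) *\<^sub>R real_of_lattice v + (1 - t) *\<^sub>R real_of_lattice v'"
      by (simp add: real_of_lattice_diff g algebra_simps)
    then have "real_of_lattice (v' - g) \<in> ?e" using t unfolding in_segment by (intro exI[of _ "1 - t"]) auto
    moreover have "g \<noteq> 0" using wv by (simp add: g_def)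
    ultimately show "v' - g \<in> lattice_points ?e - {v'}" by (simp add: lattice_points_def)
    assume "\<exists>y. y \<in> lattice_points ?e - {v'} \<and>
      dist (real_of_lattice v') (real_of_lattice y) < dist (real_of_lattice v') (real_of_lattice (v' - g))"
    then obtain y where y: "y \<in> lattice_points ?e" "y \<noteq> v'"
      "dist (real_of_lattice v') (real_of_lattice y) < dist (real_of_lattice v') (real_of_lattice (v' - g))" by blast
    obtain s where s: "0 \<le> s" "s \<le> 1" "real_of_lattice y = (1 - s) *\<^sub>R real_of_lattice v + s *\<^sub>R real_of_lattice v'"
      using y(1) by (auto simp: lattice_points_def in_segment)
    have vy: "real_of_lattice (v' - y) = (1 - s) *\<^sub>R real_of_lattice (v' - v)"
      by (simp add: real_of_lattice_diff s algebra_simps)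
    have "of_int (f (v' - y)) = (1 - s) * of_int l"
      using functional_vec_inner[OF f(1), of "v' - y"] functional_vec_inner[OF f(1), of "v' - v"]
      by (simp add: vy l_def)
    moreover have "s \<noteq> 1" using s y(2) by (auto simp: real_of_lattice_eq_iff)
    ultimately have "of_int (f (v' - y)) > (0 :: real)" using s l0 by simp
    then have "f (v' - y) \<ge> 1" by simp
    then have "1 \<le> (of_int (f (v' - y)) :: real)" by simp
    then have "t * of_int l \<le> (1 - s) * of_int l" using \<open>of_int (f (v' - y)) = (1 - s) * of_int l\<close> tl by simp
    then have "t \<le> 1 - s" using l0 by simp
    have "dist (real_of_lattice v') (real_of_lattice y) = (1 - s) * norm (real_of_lattice (v' - v))"
    proof -
      have "dist (real_of_lattice v') (real_of_lattice y) = norm (real_of_lattice (v' - y))"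
        by (simp only: dist_norm real_of_lattice_diff)
      then show ?thesis using s(2) by (simp add: vy)
    qed
    moreover have "dist (real_of_lattice v') (real_of_lattice (v' - g)) = t * norm (real_of_lattice (v' - v))"
      using g t by (simp add: dist_norm flip: real_of_lattice_diff)
    ultimately show False using y(3) \<open>t \<le> 1 - s\<close> by (simp add: mult_right_mono leD)
  qed
  then show ?thesis using l0 v' unfolding g_def by blast
qed

text \<open>The dual coordinates of a lattice basis containing the edge vectors become
  \<open>\<beta>\<close>. The cone condition is \<open>local_minimum_on_edges\<close>: a functional
  nonnegative on the edge vectors at \<open>v\<close> is minimal over \<open>P\<close> at
  \<open>v\<close>.\<close>

lemma smooth_polytope_config:
  fixes A :: "(int ^ 'n::finite) set"
  assumes A: "finite A" "P = convex hull (real_of_lattice ` A)"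
    and smooth: "smooth_polytope P" and dim: "aff_dim P = int CARD('n)"
    and nbr: "\<And>v w. is_neighbor P v w \<Longrightarrow> w \<in> A"
  shows "\<exists>V G \<beta>. V \<noteq> {} \<and> smooth_config A V G \<beta>"
proof -
  define V where "V = {v. real_of_lattice v extreme_point_of P}"
  define G where "G v = {w - v | w. is_neighbor P v w}" for v
  have Vext: "real_of_lattice v extreme_point_of P" if "v \<in> V" for v using that by (simp add: V_def)
  have VA: "V \<subseteq> A"
  proof
    fix v assume "v \<in> V"
    then have "real_of_lattice v \<in> real_of_lattice ` A"
      using Vext extreme_point_of_convex_hull A by blast
    then show "v \<in> A" by (auto simp: real_of_lattice_eq_iff)
  qed
  define Q where "Q v B \<beta> \<longleftrightarrow> G v \<subseteq> B \<and> finite B \<and> (\<forall>g. int_functional (\<beta> g)) \<and>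
      (\<forall>g\<in>B. \<forall>h\<in>B. \<beta> g h = (if g = h then 1 else 0)) \<and> (\<forall>x. x = (\<Sum>g\<in>B. \<beta> g x *s g))" for v B \<beta>
  have "\<exists>B \<beta>. Q v B \<beta>" if v: "v \<in> V" for v
  proof -
    obtain B where B: "lattice_basis B" "G v \<subseteq> B"
      using smooth Vext[OF v] unfolding smooth_polytope_def G_def by blast
    show ?thesis
    proof (rule lattice_basis_dual[OF B(1)])
      fix \<beta>
      assume "finite B" "\<And>g. int_functional (\<beta> g)"
        "\<And>g h. g \<in> B \<Longrightarrow> h \<in> B \<Longrightarrow> \<beta> g h = (if g = h then 1 else 0)" "\<And>x. x = (\<Sum>g\<in>B. \<beta> g x *s g)"
      then have "Q v B \<beta>" unfolding Q_def using B(2) by blast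
      then show ?thesis by blast
    qed
  qed
  then obtain B \<beta> where B\<beta>: "\<And>v. v \<in> V \<Longrightarrow> Q v (B v) (\<beta> v)" by metis
  have GB: "G v \<subseteq> B v" "finite (B v)" if "v \<in> V" for v using B\<beta>[OF that] unfolding Q_def by blast+
  have lin: "int_functional (\<beta> v g)" if "v \<in> V" for v g using B\<beta>[OF that] unfolding Q_def by blast
  have dual: "\<beta> v g h = (if g = h then 1 else 0)" if "v \<in> V" "g \<in> B v" "h \<in> B v" for v g h
    using B\<beta>[OF that(1)] that(2,3) unfolding Q_def by blast
  have expand: "x = (\<Sum>g\<in>B v. \<beta> v g x *s g)" if "v \<in> V" for v x using B\<beta>[OF that] unfolding Q_def by blast
  have step: "\<exists>l>0. v + l *s g \<in> V \<and> - g \<in> G (v + l *s g) \<and>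
      e = closed_segment (real_of_lattice v) (real_of_lattice (v + l *s g))"
    if v: "v \<in> V" and e: "e edge_of P" "real_of_lattice v \<in> e" and w: "nearest_neighbor v e (v + g)" for v e g
  proof -
    obtain v' where v': "real_of_lattice v' extreme_point_of P" "v' \<noteq> v"
      "e = closed_segment (real_of_lattice v) (real_of_lattice v')"
      using edge_of_lattice_polytope[OF A e Vext[OF v]] .
    have "is_neighbor P v (v + g)" using Vext[OF v] e w by (auto simp: is_neighbor_def)
    then have "\<exists>w'. g = w' - v \<and> is_neighbor P v w'" by (intro exI[of _ "v + g"]) simp
    then have "g \<in> G v" by (simp add: G_def)
    then have "g \<in> B v" using GB v by blast
    then have "\<beta> v g (v + g - v) = 1" using dual[OF v] by simp
    from nearest_neighbor_step[OF v'(2)[symmetric] w[unfolded v'(3)] lin[OF v] this]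
    obtain l where l: "l > 0" "v' = v + l *s g" "nearest_neighbor v' e (v' - g)" unfolding v'(3) by auto
    have "real_of_lattice v' \<in> e" by (simp add: v'(3))
    then have "is_neighbor P v' (v' - g)" using v' e l by (auto simp: is_neighbor_def)
    then have "\<exists>w'. - g = w' - v' \<and> is_neighbor P v' w'" by (intro exI[of _ "v' - g"]) simp
    then have "- g \<in> G v'" by (simp add: G_def)
    then show ?thesis using l v' by (auto simp: V_def)
  qed
  have edge_dir: "\<exists>g\<in>G v. \<exists>l>0. e = closed_segment (real_of_lattice v) (real_of_lattice (v + l *s g))"
    if v: "v \<in> V" and e: "e edge_of P" "real_of_lattice v \<in> e" for v e
  proof -
    obtain v' where v': "v' \<noteq> v" "e = closed_segment (real_of_lattice v) (real_of_lattice v')"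
      using edge_of_lattice_polytope[OF A e Vext[OF v]] .
    obtain w where w: "nearest_neighbor v e w" using nearest_neighbor_exists v' by metis
    then have "w - v \<in> G v" using Vext[OF v] e by (auto simp: G_def is_neighbor_def)
    moreover have "nearest_neighbor v e (v + (w - v))" using w by simp
    ultimately show ?thesis using step[OF v e] by blast
  qed
  have on_edge: "\<exists>t\<ge>0. \<forall>f. int_functional f \<longrightarrow> functional_vec f \<bullet> x - functional_vec f \<bullet> real_of_lattice v = t * of_int (f g)"
    if x: "x \<in> closed_segment (real_of_lattice v) (real_of_lattice (v + l *s g))" and l: "l > 0" for x v g l
  proof -
    obtain t where t: "0 \<le> t" "x = (1 - t) *\<^sub>R real_of_lattice v + t *\<^sub>R real_of_lattice (v + l *s g)"
      using x by (auto simp: in_segment)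
    then have "x = real_of_lattice v + (t * of_int l) *\<^sub>R real_of_lattice g"
      by (simp add: real_of_lattice_add real_of_lattice_scale algebra_simps)
    then have "functional_vec f \<bullet> x - functional_vec f \<bullet> real_of_lattice v = (t * of_int l) * of_int (f g)"
      if "int_functional f" for f
      using functional_vec_inner[OF that] by (simp add: inner_add_right)
    then show ?thesis using t l by (intro exI[of _ "t * of_int l"]) auto
  qed
  have minimum: "functional_vec f \<bullet> real_of_lattice v \<le> functional_vec f \<bullet> y"
    if v: "v \<in> V" and f: "int_functional f" "\<And>g. g \<in> G v \<Longrightarrow> 0 \<le> f g" and y: "y \<in> P" for v f y
  proof (rule local_minimum_on_edges[of "real_of_lattice ` A"])
    show "finite (real_of_lattice ` A)" using A by simp
    show "real_of_lattice v extreme_point_of convex hull (real_of_lattice ` A)" using Vext[OF v] A by simp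
    show "y \<in> convex hull (real_of_lattice ` A)" using y A by simp
    fix e x assume "e edge_of convex hull (real_of_lattice ` A)" "real_of_lattice v \<in> e" "x \<in> e"
    then obtain g l where g: "g \<in> G v" "l > 0" "x \<in> closed_segment (real_of_lattice v) (real_of_lattice (v + l *s g))"
      using edge_dir[OF v] A(2) by blast
    obtain t where "t \<ge> 0" "functional_vec f \<bullet> x - functional_vec f \<bullet> real_of_lattice v = t * of_int (f g)"
      using on_edge[OF g(3,2)] f(1) by blast
    moreover have "0 \<le> t * of_int (f g)" using \<open>t \<ge> 0\<close> f(2)[OF g(1)] by simp
    ultimately show "functional_vec f \<bullet> real_of_lattice v \<le> functional_vec f \<bullet> x" by linarith
  qed
  \<comment> \<open>A basis element that is no edge vector would give a coordinate constant on
    \<open>P\<close>, contradicting full dimension.\<close>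
  have BG: "B v = G v" if v: "v \<in> V" for v
  proof (rule ccontr)
    assume "B v \<noteq> G v"
    then obtain b where b: "b \<in> B v" "b \<notin> G v" using GB[OF v] by blast
    define f where "f = \<beta> v b"
    have f: "int_functional f" using lin[OF v] by (simp add: f_def)
    have fg: "f g = 0" if "g \<in> G v" for g using dual[OF v b(1), of g] GB(1)[OF v] that b(2) by (auto simp: f_def)
    have f': "int_functional (\<lambda>x. - f x)" using f by (simp add: int_functional_def)
    have "functional_vec (\<lambda>x. - f x) = - functional_vec f" by (simp add: functional_vec_def vec_eq_iff)
    then have "P \<subseteq> {x. functional_vec f \<bullet> x = functional_vec f \<bullet> real_of_lattice v}"
      using minimum[OF v f] minimum[OF v f'] fg by (auto intro: antisym)
    then have "aff_dim P \<le> aff_dim {x. functional_vec f \<bullet> x = functional_vec f \<bullet> real_of_lattice v}"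
      by (rule aff_dim_subset)
    moreover have "functional_vec f \<noteq> 0"
      using functional_vec_inner[OF f, of b] dual[OF v b(1) b(1)] by (auto simp: f_def)
    ultimately show False using dim by (simp add: aff_dim_hyperplane)
  qed
  have "smooth_config A V G \<beta>"
  proof
    show "finite A" "V \<subseteq> A" by (fact A VA)+
    fix v assume v: "v \<in> V"
    show "finite (G v)" using GB BG v by metis
    show "x = (\<Sum>g\<in>G v. \<beta> v g x *s g)" for x using expand[OF v, of x] BG[OF v] by simp
    fix g assume g: "g \<in> G v"
    show "\<beta> v g (x + y) = \<beta> v g x + \<beta> v g y" "\<beta> v g (c *s x) = c * \<beta> v g x" for x y c
      using lin[OF v, of g] by (auto simp: int_functional_def)
    show dg: "\<beta> v g h = (if g = h then 1 else 0)" if "h \<in> G v" for h using dual[OF v] g that BG[OF v] by simp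
    show "0 \<le> \<beta> v g (x - v)" if x: "x \<in> A" for x
    proof -
      have "real_of_lattice x \<in> P" using x A by (simp add: hull_inc)
      then have "functional_vec (\<beta> v g) \<bullet> real_of_lattice v \<le> functional_vec (\<beta> v g) \<bullet> real_of_lattice x"
        using g dual[OF v] BG[OF v] by (intro minimum[OF v lin[OF v]]) auto
      then have "\<beta> v g v \<le> \<beta> v g x" by (simp add: functional_vec_inner[OF lin[OF v]])
      moreover have "\<beta> v g x = \<beta> v g (x - v) + \<beta> v g v"
        using lin[OF v, of g] unfolding int_functional_def by (metis diff_add_cancel)
      ultimately show ?thesis by simp
    qed
    obtain w where w: "g = w - v" "is_neighbor P v w" using g by (auto simp: G_def)
    show "v + g \<in> A" using w nbr by simp
    obtain e where e: "e edge_of P" "real_of_lattice v \<in> e" "nearest_neighbor v e w"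
      using w by (auto simp: is_neighbor_def)
    have "nearest_neighbor v e (v + g)" using e w by simp
    then show "\<exists>l>0. v + l *s g \<in> V \<and> - g \<in> G (v + l *s g)" using step[OF v e(1,2)] by blast
  qed
  moreover have "V \<noteq> {}"
  proof -
    have "P \<noteq> {}" using dim by auto
    moreover have "compact P" "convex P" using A by (simp_all add: compact_convex_hull finite_imp_compact)
    ultimately obtain x where x: "x extreme_point_of P" using extreme_point_exists_convex by blast
    then have "x \<in> real_of_lattice ` A" using extreme_point_of_convex_hull A by blast
    then show ?thesis using x by (auto simp: V_def)
  qed
  ultimately show ?thesis by blast
qed


section \<open>Normalization at a vertex\<close>

lemma dual_basis_card:
  fixes B :: "(int ^ 'n::finite) set"
  assumes fin: "finite B" and lin: "\<And>g. g \<in> B \<Longrightarrow> int_functional (\<beta> g)"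
    and dual: "\<And>g h. g \<in> B \<Longrightarrow> h \<in> B \<Longrightarrow> \<beta> g h = (if g = h then 1 else 0)"
    and expand: "\<And>x. x = (\<Sum>g\<in>B. \<beta> g x *s g)"
  shows "card B = CARD('n)"
proof (rule antisym)
  show "card B \<le> CARD('n)"
  proof (rule ccontr)
    assume "\<not> ?thesis"
    then have "card (UNIV :: 'n set) < card B" by simp
    from underdetermined_system[OF finite this, of "\<lambda>k g. real_of_int (g $ k)"] obtain c where
      c: "\<exists>g\<in>B. c g \<noteq> 0" "\<And>k. (\<Sum>g\<in>B. c g * real_of_int (g $ k)) = 0" by auto
    have "c h = 0" if h: "h \<in> B" for h
    proof -
      have "(\<Sum>g\<in>B. c g *\<^sub>R real_of_lattice g) = 0"
        using c(2) by (simp add: vec_eq_iff real_of_lattice_def)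
      then have "0 = functional_vec (\<beta> h) \<bullet> (\<Sum>g\<in>B. c g *\<^sub>R real_of_lattice g)" by simp
      also have "\<dots> = (\<Sum>g\<in>B. c g * of_int (\<beta> h g))"
        by (simp add: inner_sum_right functional_vec_inner[OF lin[OF h]])
      also have "\<dots> = (\<Sum>g\<in>B. if g = h then c h else 0)" using dual h by (intro sum.cong) auto
      finally show ?thesis using h fin by simp
    qed
    then show False using c(1) by blast
  qed
  show "CARD('n) \<le> card B"
  proof (rule ccontr)
    assume "\<not> ?thesis"
    then have "card B < card (UNIV :: 'n set)" by simp
    from underdetermined_system[OF fin this, of "\<lambda>g k. real_of_int (\<beta> g (unit_vec k))"] obtain c where
      c: "\<exists>k. c k \<noteq> 0" "\<And>g. g \<in> B \<Longrightarrow> (\<Sum>k\<in>UNIV. c k * real_of_int (\<beta> g (unit_vec k))) = 0" by auto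
    have "c j = 0" for j
    proof -
      have ex: "(\<Sum>g\<in>B. \<beta> g (unit_vec k) * g $ j) = (if j = k then 1 else 0)" for k
      proof -
        have "unit_vec k $ j = (\<Sum>g\<in>B. \<beta> g (unit_vec k) *s g) $ j" using expand[of "unit_vec k"] by simp
        then show ?thesis by (simp add: unit_vec_nth)
      qed
      have "0 = (\<Sum>g\<in>B. (\<Sum>k\<in>UNIV. c k * real_of_int (\<beta> g (unit_vec k))) * of_int (g $ j))" by (simp add: c(2))
      also have "\<dots> = (\<Sum>k\<in>UNIV. c k * of_int (\<Sum>g\<in>B. \<beta> g (unit_vec k) * g $ j))"
        unfolding sum_distrib_right by (subst sum.swap) (simp add: sum_distrib_left mult_ac)
      also have "\<dots> = c j" by (simp add: ex if_distrib[of of_int] if_distrib[of "\<lambda>x. _ * x"] cong: if_cong)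
      finally show ?thesis by simp
    qed
    then show False using c(1) by blast
  qed
qed

text \<open>The rows of \<open>M\<close> are the dual coordinates at \<open>v0\<close> and the
  columns of its inverse \<open>N\<close> are the edge vectors there, so these go to the unit
  vectors.\<close>

lemma based_config_normalize:
  fixes A :: "(int ^ 'n::finite) set"
  assumes "smooth_config A V G \<beta>" and v0: "v0 \<in> V"
  shows "\<exists>(M :: int ^ 'n ^ 'n) b V' G' \<beta>'. invertible M \<and> M *v v0 + b = 0 \<and> V' = (\<lambda>x. M *v x + b) ` V \<and>
    (\<forall>v\<in>V. G' (M *v v + b) = (*v) M ` G v) \<and> based_config ((\<lambda>x. M *v x + b) ` A) V' G' \<beta>'"
proof -
  interpret smooth_config A V G \<beta> by fact
  have "card (G v0) = CARD('n)"
    using finite_G[OF v0] dual[OF v0] expand[OF v0] \<beta>_add[OF v0] \<beta>_scale[OF v0]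
    by (intro dual_basis_card[where \<beta> = "\<beta> v0"]) (auto simp: int_functional_def)
  then obtain e :: "'n \<Rightarrow> int ^ 'n" where e: "bij_betw e UNIV (G v0)"
    using finite_same_card_bij[of "UNIV :: 'n set" "G v0"] finite_G[OF v0] by auto
  have eG: "e k \<in> G v0" for k using e by (auto simp: bij_betw_def)
  have einj: "e k = e l \<longleftrightarrow> k = l" for k l using e by (auto simp: bij_betw_def inj_on_def)
  define M :: "int ^ 'n ^ 'n" where "M = (\<chi> k j. \<beta> v0 (e k) (unit_vec j))"
  define N :: "int ^ 'n ^ 'n" where "N = (\<chi> j k. e k $ j)"
  have M: "(M *v x) $ k = \<beta> v0 (e k) x" for x k
  proof -
    have f: "int_functional (\<beta> v0 (e k))"
      using \<beta>_add[OF v0 eG] \<beta>_scale[OF v0 eG] by (simp add: int_functional_def)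
    have "\<beta> v0 (e k) x = \<beta> v0 (e k) (\<Sum>j\<in>UNIV. x $ j *s unit_vec j)" using unit_vec_expand[of x] by simp
    also have "\<dots> = (\<Sum>j\<in>UNIV. x $ j * \<beta> v0 (e k) (unit_vec j))"
      using f by (simp add: int_functional_sum) (simp add: int_functional_def)
    finally show ?thesis by (simp add: M_def matrix_vector_mult_def mult.commute)
  qed
  have NM: "N *v (M *v x) = x" for x
  proof -
    have "x $ j = (\<Sum>k\<in>UNIV. \<beta> v0 (e k) x * e k $ j)" for j
      using expand_nth[OF v0, of x j] e sum.reindex_bij_betw[OF e, of "\<lambda>g. \<beta> v0 g x * g $ j"] by simp
    moreover have "(N *v (M *v x)) $ j = (\<Sum>k\<in>UNIV. \<beta> v0 (e k) x * e k $ j)" for j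
      unfolding matrix_vector_mult_def[of N "M *v x"] by (simp add: N_def M mult.commute)
    ultimately show ?thesis by (simp add: vec_eq_iff)
  qed
  have "\<beta> v0 (e l) (e k) = (if l = k then 1 else 0)" for k l
    using dual[OF v0 eG eG] einj by simp
  then have Me: "M *v e k = unit_vec k" for k by (simp add: vec_eq_iff M unit_vec_nth)

  have MN: "M *v (N *v x) = x" for x
  proof -
    have "N *v x = (\<Sum>k\<in>UNIV. x $ k *s e k)"
      by (simp add: vec_eq_iff N_def matrix_vector_mult_def mult.commute)
    then have "(M *v (N *v x)) $ l = (\<Sum>k\<in>UNIV. x $ k * (M *v e k) $ l)" for l
      using \<beta>_add[OF v0 eG] \<beta>_scale[OF v0 eG]
      by (simp add: M int_functional_sum[of "\<beta> v0 (e l)"] int_functional_def)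
    then show ?thesis
      by (simp add: Me vec_eq_iff unit_vec_nth if_distrib[of "\<lambda>c. _ * c"] cong: if_cong)
  qed
  have inv: "invertible M"
    unfolding invertible_def
  proof (intro exI[of _ N] conjI)
    have *: "X = Y" if "\<And>k. X *v unit_vec k = Y *v unit_vec k" for X Y :: "int ^ 'n ^ 'n"
    proof -
      have "(Z *v unit_vec k) $ j = Z $ j $ k" for Z :: "int ^ 'n ^ 'n" and j k
        by (simp add: matrix_vector_mult_def unit_vec_nth if_distrib[of "\<lambda>c. _ * c"] cong: if_cong)
      then show ?thesis using that by (simp add: vec_eq_iff)
    qed
    show "M ** N = mat 1" "N ** M = mat 1"
      by (rule *, simp add: MN NM flip: matrix_vector_mul_assoc)+
  qed
  define b where "b = - (M *v v0)"
  define \<pi> where "\<pi> x = M *v x + b" for x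
  define \<rho> where "\<rho> y = v0 + N *v y" for y
  have addM: "M *v (x + y) = M *v x + M *v y" for x y by (rule matrix_vector_right_distrib)
  have subM: "M *v (x - y) = M *v x - M *v y" for x y by (rule matrix_vector_mult_diff_distrib)
  have addN: "N *v (x + y) = N *v x + N *v y" for x y by (rule matrix_vector_right_distrib)
  have subN: "N *v (x - y) = N *v x - N *v y" for x y by (rule matrix_vector_mult_diff_distrib)
  have scM: "M *v (c *s x) = c *s (M *v x)" for c x
    by (simp add: vec_eq_iff matrix_vector_mult_def sum_distrib_left mult_ac)
  have scN: "N *v (c *s x) = c *s (N *v x)" for c x
    by (simp add: vec_eq_iff matrix_vector_mult_def sum_distrib_left mult_ac)
  have \<rho>\<pi>: "\<rho> (\<pi> x) = x" for x
    by (simp add: \<rho>_def \<pi>_def b_def addN NM flip: subM)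
  have \<pi>_add: "\<pi> (x + y) = \<pi> x + M *v y" for x y by (simp add: \<pi>_def addM)
  have N\<pi>: "N *v (\<pi> x - \<pi> y) = x - y" for x y by (simp add: \<pi>_def subN NM)
  define G' where "G' y = (*v) M ` G (\<rho> y)" for y
  define \<beta>' where "\<beta>' y h x = \<beta> (\<rho> y) (N *v h) (N *v x)" for y h x
  have Minj: "M *v x = M *v y \<longleftrightarrow> x = y" for x y using NM by metis
  have "based_config (\<pi> ` A) (\<pi> ` V) G' \<beta>'"
  proof
    show "finite (\<pi> ` A)" using finite_A by simp
    show "\<pi> ` V \<subseteq> \<pi> ` A" using V_subset by blast
    have \<pi>0: "\<pi> v0 = 0" by (simp add: \<pi>_def b_def)
    then show "0 \<in> \<pi> ` V" using v0 by (metis imageI)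
    have "G' 0 = (*v) M ` range e" using \<rho>\<pi>[of v0] \<pi>0 e by (simp add: G'_def bij_betw_def)
    then show "G' 0 = range unit_vec" by (auto simp: Me image_iff)
    fix y assume "y \<in> \<pi> ` V"
    then obtain v where v: "v \<in> V" "y = \<pi> v" by blast
    have G'y: "G' y = (*v) M ` G v" by (simp add: G'_def v \<rho>\<pi>)
    show "finite (G' y)" using finite_G[OF v(1)] by (simp add: G'y)
    have \<beta>'y: "\<beta>' y (M *v g) x = \<beta> v g (N *v x)" for g x by (simp add: \<beta>'_def v \<rho>\<pi> NM)
    show "x = (\<Sum>h\<in>G' y. \<beta>' y h x *s h)" for x
    proof -
      have "(\<Sum>h\<in>G' y. \<beta>' y h x *s h) = (\<Sum>g\<in>G v. \<beta> v g (N *v x) *s (M *v g))"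
        unfolding G'y using Minj by (subst sum.reindex) (auto simp: inj_on_def \<beta>'y)
      also have "\<dots> = M *v (\<Sum>g\<in>G v. \<beta> v g (N *v x) *s g)"
      proof -
        have "M *v (\<Sum>g\<in>S. c g *s g) = (\<Sum>g\<in>S. c g *s (M *v g))" for S c
          by (induction S rule: infinite_finite_induct) (auto simp: addM scM)
        then show ?thesis by simp
      qed
      finally show ?thesis using expand[OF v(1), of "N *v x"] MN by simp
    qed
    fix h assume "h \<in> G' y"
    then obtain g where g: "g \<in> G v" "h = M *v g" by (auto simp: G'y)
    show "\<beta>' y h (x + z) = \<beta>' y h x + \<beta>' y h z" "\<beta>' y h (c *s x) = c * \<beta>' y h x" for x z c
      using \<beta>_add[OF v(1) g(1)] \<beta>_scale[OF v(1) g(1)] by (simp_all add: g \<beta>'y addN scN)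
    show "\<beta>' y h h' = (if h = h' then 1 else 0)" if "h' \<in> G' y" for h'
      using that dual[OF v(1) g(1)] by (auto simp: G'y g \<beta>'y NM Minj)
    show "0 \<le> \<beta>' y h (x - y)" if "x \<in> \<pi> ` A" for x
      using that cone[OF v(1) g(1)] by (auto simp: g v \<beta>'y[unfolded v] N\<pi>)
    show "y + h \<in> \<pi> ` A" using neighbor[OF v(1) g(1)] by (simp add: v g flip: \<pi>_add)
    obtain l where l: "0 < l" "v + l *s g \<in> V" "- g \<in> G (v + l *s g)" using edge[OF v(1) g(1)] by blast
    have yl: "y + l *s h = \<pi> (v + l *s g)" by (simp add: v g \<pi>_add scM)
    have "- h = M *v (- g)" by (simp add: g vec_eq_iff matrix_vector_mult_def sum_negf)
    then have "- h \<in> G' (y + l *s h)" using l unfolding yl by (simp add: G'_def \<rho>\<pi>)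
    then show "\<exists>l>0. y + l *s h \<in> \<pi> ` V \<and> - h \<in> G' (y + l *s h)" using l yl by auto
  qed
  moreover have "\<pi> = (\<lambda>x. M *v x + b)" by (simp add: \<pi>_def fun_eq_iff)
  moreover have "\<forall>v\<in>V. G' (\<pi> v) = (*v) M ` G v" by (simp add: G'_def \<rho>\<pi>)
  ultimately show ?thesis using inv by (intro exI[of _ M] exI[of _ b] exI[of _ "\<pi> ` V"] exI[of _ G'] exI[of _ \<beta>'])
      (simp add: b_def)
qed

text \<open>The columns of \<open>M\<close> define a monomial substitution of the torus that carries
  characters to characters; the translation \<open>b\<close> contributes one common factor, which
  does not move the projective point.\<close>

lemma toric_variety_AGL_subset:
  fixes u :: "'i::finite \<Rightarrow> int ^ 'n::finite" and M :: "int ^ 'n ^ 'n"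
  shows "spans (tvec (\<lambda>i. M *v u i + b) ` torus) \<subseteq> spans (tvec u ` torus)"
proof clarify
  fix t :: "complex ^ 'n" assume t: "t \<in> torus"
  define s :: "complex ^ 'n" where "s = (\<chi> k. \<Prod>j\<in>UNIV. t $ j powi (M $ j $ k))"
  have tj: "t $ j \<noteq> 0" for j using t by (simp add: torus_def)
  have s: "s \<in> torus" using tj by (simp add: s_def torus_def)
  have "torus_character (M *v a + b) t = torus_character b t * torus_character a s" for a
  proof -
    have powi_sum: "z powi (\<Sum>k\<in>S. f k) = (\<Prod>k\<in>S. z powi f k)" if "z \<noteq> 0" for z :: complex and S and f :: "'n \<Rightarrow> int"
      using that by (induction S rule: infinite_finite_induct) (auto simp: power_int_add)
    have powi_prod: "(\<Prod>j\<in>S. f j) powi m = (\<Prod>j\<in>S. f j powi m)" for S m and f :: "'n \<Rightarrow> complex"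
      by (induction S rule: infinite_finite_induct) (auto simp: power_int_mult_distrib)
    have "torus_character a s = (\<Prod>k\<in>UNIV. \<Prod>j\<in>UNIV. t $ j powi (M $ j $ k * a $ k))"
      by (simp add: torus_character_def s_def powi_prod power_int_mult)
    also have "\<dots> = (\<Prod>j\<in>UNIV. t $ j powi ((M *v a) $ j))"
      by (subst prod.swap) (simp add: powi_sum tj matrix_vector_mult_def)
    finally show ?thesis
      by (simp add: torus_character_def power_int_add tj prod.distrib mult.commute)
  qed
  then have "tvec (\<lambda>i. M *v u i + b) t = torus_character b t *s tvec u s"
    by (simp add: tvec_def vec_eq_iff)
  then have "vec.span {tvec (\<lambda>i. M *v u i + b) t} = vec.span {tvec u s}"
    using span_scale_eq[of "torus_character b t" "tvec u s"] torus_character_nonzero[OF t] by simp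
  then show "vec.span {tvec (\<lambda>i. M *v u i + b) t} \<in> spans (tvec u ` torus)" using s by blast
qed

lemma toric_variety_AGL:
  fixes u :: "'i::finite \<Rightarrow> int ^ 'n::finite" and M :: "int ^ 'n ^ 'n"
  assumes "invertible M" shows "toric_variety (\<lambda>i. M *v u i + b) = toric_variety u"
proof -
  obtain N where N: "N ** M = mat 1" using assms by (auto simp: invertible_def)
  have "N *v (M *v x + b) + - (N *v b) = x" for x
    by (simp add: matrix_vector_right_distrib matrix_vector_mul_assoc N)
  then have "(\<lambda>i. N *v (M *v u i + b) + - (N *v b)) = u" by (simp add: fun_eq_iff)
  then have "spans (tvec u ` torus) \<subseteq> spans (tvec (\<lambda>i. M *v u i + b) ` torus)"
    using toric_variety_AGL_subset[of N "\<lambda>i. M *v u i + b" "- (N *v b)"] by simp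
  then show ?thesis
    unfolding toric_variety_tvec using toric_variety_AGL_subset[of M u b] by (metis subset_antisym)
qed

section \<open>Affinely independent subsets\<close>

text \<open>A maximal independent subset with at most \<open>n\<close> points is annihilated by a
  nonzero affine function; a point of \<open>B\<close> where this function is nonzero could be
  added.\<close>

lemma generic_imp_independent_subset:
  fixes B :: "(int ^ 'n::finite) set"
  assumes "finite B" "aff_generic B"
  shows "\<exists>S\<subseteq>B. aff_indep S \<and> CARD('n) + 1 \<le> card S"
proof -
  define Q where "Q S \<longleftrightarrow> S \<subseteq> B \<and> aff_indep S" for S
  have "Q {}" by (simp add: Q_def aff_indep_def)
  moreover have "\<forall>S. Q S \<longrightarrow> card S < card B + 1" using card_mono[OF assms(1)] by (auto simp: Q_def less_Suc_eq_le)
  ultimately obtain S where S: "Q S" "\<And>S'. Q S' \<Longrightarrow> card S' \<le> card S"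
    using ex_has_greatest_nat[of Q "{}" card "card B + 1"] by blast
  have finS: "finite S" using S assms by (auto simp: Q_def intro: finite_subset)
  have "CARD('n) + 1 \<le> card S"
  proof (rule ccontr)
    assume "\<not> ?thesis"
    then have "card S < card (UNIV :: 'n option set)" by (simp add: card_UNIV_option)
    from underdetermined_system[OF finS this, of "\<lambda>x m. case m of None \<Rightarrow> 1 | Some k \<Rightarrow> of_int (x $ k)"]
    obtain f :: "'n option \<Rightarrow> complex" where f: "\<exists>m. f m \<noteq> 0" "\<And>x. x \<in> S \<Longrightarrow> aff f x = 0"
      by (auto simp: sum_option aff_def)
    then obtain b where b: "b \<in> B" "aff f b \<noteq> 0" using assms(2) by (auto simp: aff_generic_def)
    have bS: "b \<notin> S" using f b by auto
    have comb: "aff (\<lambda>m. h m - c * f m) x = aff h x - c * aff f x" for h c x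
      by (simp add: aff_def algebra_simps sum_subtractf sum_distrib_left)
    have scale: "aff (\<lambda>m. f m / c) x = aff f x / c" for c x
      by (simp add: aff_def add_divide_distrib sum_divide_distrib)
    have "\<exists>h. \<forall>q\<in>insert b S. aff h q = (if q = p then 1 else 0)" if p: "p \<in> insert b S" for p
    proof (cases "p = b")
      case True
      then show ?thesis
        using f(2) b bS by (intro exI[of _ "\<lambda>m. f m / aff f b"]) (auto simp: scale)
    next
      case False
      then obtain h where h: "\<forall>q\<in>S. aff h q = (if q = p then 1 else 0)"
        using p S(1) by (auto simp: Q_def aff_indep_def)
      define c where "c = aff h b / aff f b"
      have "c * aff f b = aff h b" using b by (simp add: c_def)
      then show ?thesis
        using f(2) h bS False by (intro exI[of _ "\<lambda>m. h m - c * f m"]) (auto simp: comb)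
    qed
    then have "Q (insert b S)" using S(1) b by (simp add: Q_def aff_indep_def)
    then show False using S(2)[of "insert b S"] bS finS by simp
  qed
  then show ?thesis using S(1) by (auto simp: Q_def)
qed

lemma aff_indep_preimage:
  assumes "aff_indep T" "inj u" "u i \<in> T"
  shows "\<exists>f. \<forall>j\<in>{j. u j \<in> T}. aff f (u j) = (if j = i then 1 else 0)"
proof -
  obtain f where "\<forall>q\<in>T. aff f q = (if q = u i then 1 else 0)" using assms by (auto simp: aff_indep_def)
  then show ?thesis using assms(2) by (intro exI[of _ f]) (auto simp: inj_eq)
qed

lemma aff_indep_unit_simplex: "aff_indep (insert 0 (range unit_vec))"
  unfolding aff_indep_def
proof
  fix p :: "int ^ 'n" assume p: "p \<in> insert 0 (range unit_vec)"
  show "\<exists>f. \<forall>q\<in>insert 0 (range unit_vec). aff f q = (if q = p then 1 else 0)"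
  proof (cases "p = 0")
    case True
    define f :: "'n option \<Rightarrow> complex" where "f m = (case m of None \<Rightarrow> 1 | Some k \<Rightarrow> -1)" for m
    have "aff f 0 = 1" by (simp add: f_def aff_def)
    moreover have "aff f (unit_vec k) = 0" for k by (simp add: f_def lin_part_simps)
    moreover have "unit_vec k \<noteq> 0" for k :: 'n by (metis height_unit_vec height_zero zero_neq_one)
    ultimately show ?thesis using True by (intro exI[of _ f]) auto
  next
    case False
    then obtain k where k: "p = unit_vec k" using p by blast
    define f :: "'n option \<Rightarrow> complex" where "f m = (case m of None \<Rightarrow> 0 | Some j \<Rightarrow> if j = k then 1 else 0)" for m
    have "aff f 0 = 0" by (simp add: f_def aff_def)
    moreover have "aff f (unit_vec j) = (if j = k then 1 else 0)" for j by (simp add: f_def lin_part_simps)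
    ultimately show ?thesis using False k by (intro exI[of _ f]) (auto simp: axis_eq_axis)
  qed
qed

section \<open>The exceptional sets\<close>

lemma lattice_points_two_simplex:
  "lattice_points (two_simplex :: (real ^ 'n::finite) set) = {x. (\<forall>k. 0 \<le> x $ k) \<and> height x \<le> 2}"
proof -
  have "(\<Sum>j\<in>UNIV. real_of_int (x $ j)) \<le> 2 \<longleftrightarrow> height x \<le> 2" for x :: "int ^ 'n"
    unfolding height_def by (simp flip: of_int_sum)
  then show ?thesis by (auto simp: lattice_points_def two_simplex_def real_of_lattice_def)
qed

lemma lattice_points_simplex_product:
  "lattice_points (simplex_product S) =
     {x. (\<forall>k. 0 \<le> x $ k) \<and> (\<Sum>k\<in>S. x $ k) \<le> 1 \<and> (\<Sum>k\<in>- S. x $ k) \<le> 1}"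
proof -
  have "(\<Sum>j\<in>T. real_of_int (x $ j)) \<le> 1 \<longleftrightarrow> (\<Sum>k\<in>T. x $ k) \<le> 1" for x :: "int ^ 'n" and T
    by (simp flip: of_int_sum)
  then show ?thesis by (auto simp: lattice_points_def simplex_product_def real_of_lattice_def)
qed

lemma convex_two_simplex: "convex (two_simplex :: (real ^ 'n::finite) set)"
proof -
  have "(\<chi> j. 1) \<bullet> p = (\<Sum>j\<in>UNIV. p $ j)" for p :: "real ^ 'n" by (simp add: inner_vec_def)
  then have "two_simplex = (\<Inter>j. {p :: real ^ 'n. axis j 1 \<bullet> p \<ge> 0}) \<inter> {p. (\<chi> j. 1) \<bullet> p \<le> 2}"
    by (auto simp: two_simplex_def inner_axis')
  moreover have "convex ((\<Inter>j. {p :: real ^ 'n. axis j 1 \<bullet> p \<ge> 0}) \<inter> {p. (\<chi> j. 1) \<bullet> p \<le> 2})"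
    by (intro convex_Int convex_INT convex_halfspace_le convex_halfspace_ge)
  ultimately show ?thesis by simp
qed

text \<open>For lattice points, leaving out the face where the sum over \<open>- S\<close> is 2
  means that this integer is at most 1; taking the hull adds no points because
  \<open>two_simplex - F\<close> is convex. \<open>S \<noteq> UNIV\<close> makes the face nonempty,
  so that the truncated subtraction is exact.\<close>

lemma two_simplex_face:
  fixes S :: "'n::finite set"
  assumes "S \<noteq> UNIV"
  defines "F \<equiv> {p :: real ^ 'n. p \<in> two_simplex \<and> (\<Sum>j\<in>- S. p $ j) = 2}"
  shows "F face_of two_simplex" "aff_dim F = int (card (- S) - 1)"
    "lattice_points (two_simplex_minus F) = {x. (\<forall>k. 0 \<le> x $ k) \<and> height x \<le> 2 \<and> (\<Sum>k\<in>- S. x $ k) \<le> 1}"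
proof -
  define a :: "real ^ 'n" where "a = (\<chi> j. if j \<in> - S then 1 else 0)"
  have a: "a \<bullet> p = (\<Sum>j\<in>- S. p $ j)" for p
    by (simp add: a_def inner_vec_def if_distrib[of "\<lambda>c. c * _"] sum.If_cases Compl_eq cong: if_cong)
  have split: "(\<Sum>j\<in>UNIV. p $ j) = (\<Sum>j\<in>S. p $ j) + (\<Sum>j\<in>- S. p $ j)" for p :: "real ^ 'n"
    using sum.union_disjoint[of S "- S" "\<lambda>j. p $ j"] by simp
  have le2: "a \<bullet> p \<le> 2" if "p \<in> two_simplex" for p
  proof -
    have "0 \<le> (\<Sum>j\<in>S. p $ j)" using that by (intro sum_nonneg) (auto simp: two_simplex_def)
    then show ?thesis using that split[of p] by (simp add: a two_simplex_def)
  qed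
  have F: "F = two_simplex \<inter> {p. a \<bullet> p = 2}" by (auto simp: F_def a)
  show "F face_of two_simplex"
    unfolding F using le2 by (intro face_of_Int_supporting_hyperplane_le convex_two_simplex)
  define E where "E = (\<lambda>j. axis j 2 :: real ^ 'n) ` (- S)"
  have hull: "F = convex hull E"
  proof
    have "convex F" unfolding F by (intro convex_Int convex_two_simplex convex_hyperplane)
    moreover have "E \<subseteq> F" by (auto simp: E_def F_def two_simplex_def axis_def)
    ultimately show "convex hull E \<subseteq> F" by (intro hull_minimal)
    show "F \<subseteq> convex hull E"
    proof
      fix p assume p: "p \<in> F"
      have nn: "0 \<le> p $ j" for j using p by (simp add: F_def two_simplex_def)
      have "(\<Sum>j\<in>S. p $ j) \<le> 0" using p split[of p] by (simp add: F_def two_simplex_def)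
      then have "(\<Sum>j\<in>S. p $ j) = 0" using nn by (meson antisym sum_nonneg)
      then have zero: "p $ j = 0" if "j \<in> S" for j using that nn by (simp add: sum_nonneg_eq_0_iff)
      have "p = (\<Sum>j\<in>- S. (p $ j / 2) *\<^sub>R axis j 2)"
      proof -
        have "(\<Sum>j\<in>- S. (p $ j / 2) *\<^sub>R axis j (2::real)) $ k = (\<Sum>j\<in>- S. if j = k then p $ k else 0)" for k
          unfolding sum_component by (intro sum.cong) (auto simp: axis_def)
        then show ?thesis using zero by (auto simp: vec_eq_iff)
      qed
      moreover have "(\<Sum>j\<in>- S. (p $ j / 2) *\<^sub>R axis j 2) \<in> convex hull E"
      proof (rule convex_sum)
        show "(\<Sum>j\<in>- S. p $ j / 2) = 1" using p by (simp add: F_def flip: sum_divide_distrib)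
        show "axis j 2 \<in> convex hull E" if "j \<in> - S" for j using that by (simp add: E_def hull_inc)
      qed (use nn in auto)
      ultimately show "p \<in> convex hull E" by simp
    qed
  qed
  have "pairwise orthogonal E"
    by (auto simp: pairwise_def E_def orthogonal_def inner_axis_axis)
  moreover have "0 \<notin> E" by (auto simp: E_def axis_eq_0_iff)
  ultimately have "independent E" by (rule pairwise_orthogonal_independent)
  then have "\<not> affine_dependent E" using affine_dependent_imp_dependent by blast
  then have "aff_dim E = int (card E) - 1" by (simp add: aff_dim_affine_independent)
  moreover have "card E = card (- S)"
    unfolding E_def by (intro card_image) (auto simp: inj_on_def axis_eq_axis)
  moreover have "card (- S) \<noteq> 0" using assms by auto
  ultimately show "aff_dim F = int (card (- S) - 1)"
    unfolding hull aff_dim_convex_hull by linarith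
  let ?A = "{x :: int ^ 'n. (\<forall>k. 0 \<le> x $ k) \<and> height x \<le> 2 \<and> (\<Sum>k\<in>- S. x $ k) \<le> 1}"
  have compl: "two_simplex - F = two_simplex \<inter> {p. a \<bullet> p < 2}"
    using le2 unfolding F by (auto simp: order.order_iff_strict)
  have lat: "lattice_points (two_simplex - F) = ?A"
  proof -
    have "a \<bullet> real_of_lattice x < 2 \<longleftrightarrow> (\<Sum>k\<in>- S. x $ k) \<le> 1" for x
    proof -
      have "a \<bullet> real_of_lattice x = of_int (\<Sum>k\<in>- S. x $ k)" by (simp add: a real_of_lattice_def)
      then show ?thesis by linarith
    qed
    then show ?thesis
      using lattice_points_two_simplex unfolding compl by (auto simp: lattice_points_def)
  qed
  show "lattice_points (two_simplex_minus F) = ?A"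
  proof
    have "convex hull (real_of_lattice ` lattice_points (two_simplex - F)) \<subseteq> two_simplex - F"
    proof (rule hull_minimal)
      show "convex (two_simplex - F)"
        unfolding compl by (intro convex_Int convex_two_simplex convex_halfspace_lt)
    qed (auto simp: lattice_points_def)
    then show "lattice_points (two_simplex_minus F) \<subseteq> ?A"
      unfolding lat[symmetric] two_simplex_minus_def by (auto simp: lattice_points_def)
    show "?A \<subseteq> lattice_points (two_simplex_minus F)"
      unfolding lat[symmetric] two_simplex_minus_def
      by (auto simp: lattice_points_def[of "convex hull _"] intro: hull_inc)
  qed
qed

section \<open>The dimension of the secant variety\<close>

text \<open>The unit simplex gives \<open>n + 1\<close> rows and an independent subset
  \<open>S\<close> of \<open>far\<close> gives \<open>card S\<close> more; projectivization costs
  one. Generic \<open>far\<close> allows \<open>card S \<ge> n + 1\<close>, and independent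
  \<open>far\<close> can be taken as a whole.\<close>

lemma proj_dim_secant_normalized:
  fixes u :: "'i::finite \<Rightarrow> int ^ 'n::finite"
  assumes "CARD('i) = s + 1" "inj u" and config: "based_config (range u) V G \<beta>"
    and far: "aff_generic (based_config.far (range u)) \<or> aff_indep (based_config.far (range u))"
  shows "proj_dim (secant_variety (toric_variety u)) = enat (min s (2 * CARD('n) + 1))"
proof -
  interpret based_config "range u" V G \<beta> by fact
  let ?Y = "secant_variety (toric_variety u)"
  have nn: "0 \<le> u i $ k" for i k using nonneg by blast
  have "proj_dim ?Y \<le> enat s"
    using proj_dim_le_ambient[of ?Y s] assms by (simp add: secant_variety_def)
  moreover have "proj_dim ?Y \<le> enat (2 * CARD('n) + 1)" using nn by (rule proj_dim_secant_toric_le)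
  ultimately have upper: "proj_dim ?Y \<le> enat (min s (2 * CARD('n) + 1))" by (simp add: min_def)
  let ?T = "insert 0 (range (unit_vec :: 'n \<Rightarrow> _))"
  have heightnat: "int (\<Sum>k\<in>UNIV. nat (u i $ k)) = height (u i)" for i using nn by (simp add: height_def)
  have lower: "enat (CARD('n) + card S) \<le> proj_dim ?Y" if S: "S \<subseteq> far" "aff_indep S" for S
  proof -
    define I where "I = {i. u i \<in> ?T}"
    define K where "K = {i. u i \<in> S}"
    have T: "?T \<subseteq> range u" using origin_in_A unit_vec_in_A by auto
    have SA: "S \<subseteq> range u" using S(1) by (auto simp: far_def)
    have img: "card {i. u i \<in> X} = card X" if "X \<subseteq> range u" for X
    proof -
      have "u ` {i. u i \<in> X} = X" using that by auto
      then show ?thesis using card_image[of u "{i. u i \<in> X}"] assms(2) by (metis inj_on_subset subset_UNIV)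
    qed
    have "card ?T = CARD('n) + 1"
    proof -
      have "inj (unit_vec :: 'n \<Rightarrow> _)" by (auto simp: inj_def axis_eq_axis)
      moreover have "0 \<notin> range (unit_vec :: 'n \<Rightarrow> _)" by (metis height_unit_vec height_zero imageE zero_neq_one)
      ultimately show ?thesis by (simp add: card_image)
    qed
    have disj: "I \<inter> K = {}" using S(1) by (auto simp: I_def K_def far_def)
    have "card (I \<union> K) = card I + card K" using disj by (intro card_Un_disjoint) auto
    also have "\<dots> = CARD('n) + card S + 1"
      unfolding I_def K_def using img[OF T] img[OF SA] \<open>card ?T = CARD('n) + 1\<close> by simp
    finally have card: "card (I \<union> K) = CARD('n) + card S + 1" .
    obtain i0 where i0: "u i0 = 0" using origin_in_A by (metis imageE)
    have axes: "\<exists>i. u i = axis k 1" for k using unit_vec_in_A[of k] by (metis imageE)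
    show ?thesis
    proof (rule proj_dim_secant_toric_ge[OF nn i0 axes disj])
      show "\<exists>f. \<forall>j\<in>I. aff f (u j) = (if j = i then 1 else 0)" if "i \<in> I" for i
        unfolding I_def using that aff_indep_unit_simplex assms(2) by (intro aff_indep_preimage) (auto simp: I_def)
      show "\<exists>f. \<forall>j\<in>K. aff f (u j) = (if j = i then 1 else 0)" if "i \<in> K" for i
        unfolding K_def using that S(2) assms(2) by (intro aff_indep_preimage) (auto simp: K_def)
      show "(\<Sum>k\<in>UNIV. nat (u i $ k)) \<le> 1" if "i \<in> I" for i
      proof -
        have "height (u i) \<le> 1" using that by (auto simp: I_def)
        then show ?thesis using heightnat[of i] by linarith
      qed
      show "2 \<le> (\<Sum>k\<in>UNIV. nat (u i $ k))" if "i \<in> K" for i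
      proof -
        have "u i \<in> far" using that S(1) by (auto simp: K_def)
        then have "2 \<le> height (u i)" by (simp add: far_iff)
        then show ?thesis using heightnat[of i] by linarith
      qed
      show "card (I \<union> K) = CARD('n) + card S + 1" by (rule card)
    qed
  qed
  have "enat (min s (2 * CARD('n) + 1)) \<le> proj_dim ?Y"
    using far
  proof
    assume "aff_generic far"
    then obtain S where S: "S \<subseteq> far" "aff_indep S" "CARD('n) + 1 \<le> card S"
      using generic_imp_independent_subset[of far] finite_A by (auto simp: far_def)
    have "enat (min s (2 * CARD('n) + 1)) \<le> enat (CARD('n) + card S)" using S(3) by simp
    then show ?thesis using lower[OF S(1,2)] by (rule order.trans)
  next
    assume "aff_indep far"
    then have l: "enat (CARD('n) + card far) \<le> proj_dim ?Y" by (intro lower) auto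
    have "card (range u) = s + 1" using assms(1,2) by (simp add: card_image)
    moreover have "card (range u) \<le> card ?T + card far"
    proof -
      have "range u \<subseteq> ?T \<union> far" by (auto simp: far_def)
      then have "card (range u) \<le> card (?T \<union> far)" using finite_A by (intro card_mono) (auto simp: far_def)
      then show ?thesis using card_Un_le[of ?T far] by linarith
    qed
    moreover have "card ?T \<le> CARD('n) + 1"
      using card_insert_le_m1[of "CARD('n) + 1" "range (unit_vec :: 'n \<Rightarrow> _)" 0] card_image_le[of UNIV "unit_vec :: 'n \<Rightarrow> _"] by simp
    ultimately have "s \<le> CARD('n) + card far" by linarith
    then have "enat (min s (2 * CARD('n) + 1)) \<le> enat (CARD('n) + card far)" by simp
    then show ?thesis using l by (rule order.trans)
  qed
  then show ?thesis using upper by (rule antisym[rotated])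
qed

theorem theorem5p2:
  fixes u :: "'i::finite \<Rightarrow> int ^ 'n" and A :: "(int ^ 'n) set"
    and P :: "(real ^ 'n) set" and s :: nat
  assumes "CARD('i) = s + 1" and "inj u" and "A = range u"
    and "P = convex hull (real_of_lattice ` A)"
    and "smooth_polytope P" and "aff_dim P = int CARD('n)"
    and "\<And>v w. is_neighbor P v w \<Longrightarrow> w \<in> A"
    and "\<not> (2 \<le> CARD('n) \<and> AGL_equivalent A (lattice_points two_simplex))"
    and "\<not> (\<exists>k F. k + 3 \<le> CARD('n) \<and> F face_of (two_simplex :: (real ^ 'n) set) \<and>
          aff_dim F = int k \<and> AGL_equivalent A (lattice_points (two_simplex_minus F)))"
    and "\<not> (\<exists>l L. 2 \<le> l \<and> l + 2 \<le> CARD('n) \<and> card L = l \<and>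
          AGL_equivalent A (lattice_points (simplex_product L)))"
  shows "proj_dim (secant_variety (toric_variety u)) = enat (min s (2 * CARD('n) + 1))"
proof -
  have "finite A" using assms(3) by simp
  then have "\<exists>V G \<beta>. V \<noteq> {} \<and> smooth_config A V G \<beta>"
    using assms(4-7) by (rule smooth_polytope_config)
  then obtain V G \<beta> where V: "V \<noteq> {}" and config: "smooth_config A V G \<beta>" by (elim exE conjE)
  \<comment> \<open>Prefer a base vertex with an edge of length at least 2.\<close>
  obtain v0 where v0: "v0 \<in> V" "(\<exists>g\<in>G v0. v0 + g \<notin> V) \<or> (\<forall>v\<in>V. \<forall>g\<in>G v. v + g \<in> V)"
  proof (cases "\<exists>v\<in>V. \<exists>g\<in>G v. v + g \<notin> V")
    case True
    then obtain v g where "v \<in> V" "g \<in> G v" "v + g \<notin> V" by blast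
    then show ?thesis using that by blast
  next
    case False
    then have "\<forall>v\<in>V. \<forall>g\<in>G v. v + g \<in> V" by simp
    moreover obtain v where "v \<in> V" using V by blast
    ultimately show ?thesis using that by simp
  qed
  obtain M :: "int ^ 'n ^ 'n" and b V' G' \<beta>' where M: "invertible M" "M *v v0 + b = 0" "V' = (\<lambda>x. M *v x + b) ` V"
    "\<forall>v\<in>V. G' (M *v v + b) = (*v) M ` G v" "based_config ((\<lambda>x. M *v x + b) ` A) V' G' \<beta>'"
    using based_config_normalize[OF config v0(1)] by blast
  define \<pi> where "\<pi> x = M *v x + b" for x
  have \<pi>: "(\<lambda>x. M *v x + b) = \<pi>" by (simp add: \<pi>_def fun_eq_iff)
  have AGL: "\<pi> \<in> AGL" unfolding AGL_def using M(1) \<pi> by blast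
  then have equiv: "AGL_equivalent A C" if "\<pi> ` A = C" for C using that by (auto simp: AGL_equivalent_def)
  interpret based_config "\<pi> ` A" V' G' \<beta>' using M(5) unfolding \<pi> .
  have \<pi>_inj: "\<pi> x = \<pi> y \<longleftrightarrow> x = y" for x y
  proof -
    obtain N where "N ** M = mat 1" using M(1) by (auto simp: invertible_def)
    then have "N *v (M *v x) = x" for x by (simp add: matrix_vector_mul_assoc)
    then show ?thesis unfolding \<pi>_def by (metis add_right_cancel)
  qed
  have \<pi>_add: "\<pi> (x + y) = \<pi> x + M *v y" for x y by (simp add: \<pi>_def matrix_vector_right_distrib)
  have in_V': "\<pi> v + M *v g \<in> V' \<longleftrightarrow> v + g \<in> V" for v g
    unfolding M(3) \<pi> \<pi>_add[symmetric] by (auto simp: \<pi>_inj)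
  have G'\<pi>: "G' (\<pi> v) = (*v) M ` G v" if "v \<in> V" for v using M(4) that by (simp add: \<pi>_def)
  have \<pi>0: "\<pi> v0 = 0" using M(2) by (simp add: \<pi>_def)
  have "(\<exists>g\<in>G' 0. g \<notin> V') \<or> (\<forall>v\<in>V'. \<forall>g\<in>G' v. v + g \<in> V')"
    using v0(2)
  proof
    assume "\<exists>g\<in>G v0. v0 + g \<notin> V"
    then obtain g where "g \<in> G v0" "v0 + g \<notin> V" by blast
    then show ?thesis using G'\<pi>[OF v0(1)] in_V'[of v0 g] by (auto simp: \<pi>0)
  next
    assume "\<forall>v\<in>V. \<forall>g\<in>G v. v + g \<in> V"
    moreover have "V' = \<pi> ` V" using M(3) unfolding \<pi> .
    ultimately show ?thesis using G'\<pi> in_V' by auto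
  qed
  from classification[OF this] have "aff_generic far \<or> aff_indep far"
  proof (elim disjE exE conjE)
    fix S :: "'n set"
    assume S: "2 \<le> card S" and A: "\<pi> ` A = {x. (\<forall>k. 0 \<le> x $ k) \<and> height x \<le> 2 \<and> (\<Sum>k\<in>- S. x $ k) \<le> 1}"
    show ?thesis
    \<comment> \<open>\<open>S = UNIV\<close> is the full doubled simplex. Otherwise the removed
      face has dimension \<open>k = n - card S - 1\<close>, and \<open>card S \<ge> 2\<close>
      becomes \<open>k \<le> n - 3\<close>.\<close>
    proof (cases "S = UNIV")
      case True
      then show ?thesis using assms(8) equiv[of "lattice_points two_simplex"] A S
        by (simp add: lattice_points_two_simplex)
    next
      case False
      have "card (- S) = CARD('n) - card S" by (simp add: Compl_eq_Diff_UNIV card_Diff_subset)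
      moreover have "card S < CARD('n)" using False by (metis finite psubset_card_mono top.not_eq_extremum)
      ultimately have "card (- S) - 1 + 3 \<le> CARD('n)" using S by linarith
      moreover have "AGL_equivalent A (lattice_points (two_simplex_minus
          {p. p \<in> two_simplex \<and> (\<Sum>j\<in>- S. p $ j) = 2}))"
        unfolding two_simplex_face(3)[OF False] using A by (rule equiv)
      ultimately have "\<exists>k F. k + 3 \<le> CARD('n) \<and> F face_of (two_simplex :: (real ^ 'n) set) \<and>
          aff_dim F = int k \<and> AGL_equivalent A (lattice_points (two_simplex_minus F))"
        using two_simplex_face(1,2)[OF False] by (intro exI conjI)
      then show ?thesis using assms(9) by (rule notE[rotated])
    qed
  next
    fix S :: "'n set"
    assume S: "2 \<le> card S" "2 \<le> card (- S)"
      and A: "\<pi> ` A = {x. (\<forall>k. 0 \<le> x $ k) \<and> (\<Sum>k\<in>S. x $ k) \<le> 1 \<and> (\<Sum>k\<in>- S. x $ k) \<le> 1}"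
    have "card (- S) = CARD('n) - card S" by (simp add: Compl_eq_Diff_UNIV card_Diff_subset)
    then have "card S + 2 \<le> CARD('n)" using S by linarith
    then show ?thesis using assms(10) S(1) equiv[of "lattice_points (simplex_product S)"] A
      by (auto simp: lattice_points_simplex_product)
  qed auto
  moreover have "\<pi> ` A = range (\<lambda>i. \<pi> (u i))" using assms(3) by auto
  moreover have "inj (\<lambda>i. \<pi> (u i))" using assms(2) by (auto simp: inj_def \<pi>_inj)
  ultimately have "proj_dim (secant_variety (toric_variety (\<lambda>i. \<pi> (u i)))) = enat (min s (2 * CARD('n) + 1))"
    using proj_dim_secant_normalized[of s "\<lambda>i. \<pi> (u i)" V' G' \<beta>'] assms(1) based_config_axioms by simp
  moreover have "toric_variety (\<lambda>i. \<pi> (u i)) = toric_variety u"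
    unfolding \<pi>_def using M(1) by (rule toric_variety_AGL)
  ultimately show ?thesis by simp
qed

end
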